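(* Let $\mathcal T$ be a triangulated category, $\mathcal A$ a full subcategory of $\mathcal T$ and $\mathcal X$ a functorially finite subcategory of $\mathcal A$. If every $\mathcal X$-monomorphism of $\mathcal A$ has a cone in $\mathcal A$ and every $\mathcal X$-epimorphism of $\mathcal A$ has a cocone in $\mathcal A$, then the subfactor category $\mathcal A/[\mathcal X]$ admits a pretriangulated structure in the sense of Beligiannis-Reiten (with underlying functors $\Sigma,\Omega$ and classes of triangles $\nabla,\triangle$ described in the context).
   Context: Conventions. All categories are $k$-linear over a field $k$, Hom-finite, skeletally small and Krull-Schmidt. "Subcategory" means full subcategory closed under isomorphisms, (finite) direct sums and direct summands. The shift of $\mathcal T$ is $[1]$; "triangle" means distinguished triangle of $\mathcal T$. Approximations. A left $\mathcal X$-approximation of $A\in\mathcal A$ is a morphism $A\to X_A$ with $X_A\in\mathcal X$ through which every morphism from $A$ to an object of $\mathcal X$ factors; right $\mathcal X$-approximations are dual. $\mathcal X$ is functorially finite in $\mathcal A$ if every object of $\mathcal A$ has both a left and a right $\mathcal X$-approximation. A morphism $f:A\to B$ is $\mathcal X$-monic if $\mathcal T(f,X):\mathcal T(B,X)\to\mathcal T(A,X)$ is surjective for all $X\in\mathcal X$, and $\mathcal X$-epic if $\mathcal T(X,f)$ is surjective for all $X\in\mathcal X$. "Every $\mathcal X$-monomorphism of $\mathcal A$ has a cone" means: for every $\mathcal X$-monic $f:A\to B$ with $A,B\in\mathcal A$, in the triangle $A\xrightarrow{f}B\to C\to A[1]$ one has $C\in\mathcal A$; "every $\mathcal X$-epimorphism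 has a cocone" means: for every $\mathcal X$-epic $f:B\to C$ with $B,C\in\mathcal A$, in the triangle $K\to B\xrightarrow{f}C\to K[1]$ one has $K\in\mathcal A$. Subfactor category. $\mathcal A/[\mathcal X]$ has the objects of $\mathcal A$ (written $\bar A$) and morphisms $\mathcal A(A,B)$ modulo those factoring through an object of $\mathcal X$; $\bar f$ is the class of $f$. Right triangulated category. Let $\mathcal C$ be an additive category with an additive endofunctor $\Sigma$. A sextuple is a diagram $A\xrightarrow{f}B\xrightarrow{g}C\xrightarrow{h}\Sigma A$; a morphism of sextuples is a triple $(\alpha,\beta,\gamma)$ with $\beta f=f'\alpha$, $\gamma g=g'\beta$, $(\Sigma\alpha)h=h'\gamma$. $(\mathcal C,\Sigma,\nabla)$ is right triangulated if $\nabla$ is a class of sextuples ("right triangles") closed under isomorphism such that: [rTR0] $0\to A\xrightarrow{1}A\to 0$ is in $\nabla$ for every $A$. [rTR1] Every $f:A\to B$ embeds in a right triangle $A\xrightarrow{f}B\xrightarrow{g}C\xrightarrow{h}\Sigma A$. [rTR2] If $A\xrightarrow{f}B\xrightarrow{g}C\xrightarrow{h}\Sigma A$ is in $\nabla$, so is $B\xrightarrow{g}C\xrightarrow{h}\Sigma A\xrightarrow{-\Sigma f}\Sigma B$. [rTR3] Given right triangles $(A,B,C,f,g,h)$, $(A',B',C',f',g',h')$ and $\alpha:A\to A'$, $\beta:B\to B'$ with $\beta f=f'\alpha$, there is $\gamma$ such that $(\alpha,\beta,\gamma)$ is a morphism of sextuples. [rTR4] Given right triangles $A\xrightarrow{f}B\xrightarrow{g}C\xrightarrow{h}\Sigma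 A$, $B\xrightarrow{a}X\xrightarrow{b}Y\xrightarrow{c}\Sigma B$, $A\xrightarrow{af}X\xrightarrow{d}Z\xrightarrow{e}\Sigma A$, there are $s:C\to Z$, $t:Z\to Y$ with $sg=da$, $es=h$, $td=b$, $ct=(\Sigma f)e$, and $C\xrightarrow{s}Z\xrightarrow{t}Y\xrightarrow{(\Sigma g)c}\Sigma C$ is in $\nabla$. A left triangulated category $(\mathcal C,\Omega,\triangle)$, with left triangles $\Omega C\to A\to B\to C$, is defined dually, i.e. $(\mathcal C^{op},\Omega^{op},\triangle^{op})$ is right triangulated. Pretriangulated category (Beligiannis-Reiten). A pretriangulation of an additive category $\mathcal C$ is $(\Omega,\Sigma,\triangle,\nabla)$ together with an adjunction with $\Sigma$ left adjoint to $\Omega$ (unit $\eta$, counit $\varepsilon$), such that $(\mathcal C,\Sigma,\nabla)$ is right triangulated, $(\mathcal C,\Omega,\triangle)$ is left triangulated, and for every $A\xrightarrow{f}B\xrightarrow{g}C\xrightarrow{h}\Sigma A$ in $\nabla$ and every $\Omega C'\xrightarrow{f'}A'\xrightarrow{g'}B'\xrightarrow{h'}C'$ in $\triangle$: (i) if $\alpha:A\to\Omega C'$ and $\beta:B\to A'$ satisfy $\beta f=f'\alpha$, there is $\gamma:C\to B'$ with $\gamma g=g'\beta$ and $h'\gamma=\varepsilon_{C'}\,\Sigma(\alpha)\,h$; (ii) if $\gamma:C\to B'$ and $\delta:\Sigma A\to C'$ satisfy $\delta h=h'\gamma$, there is $\beta:B\to A'$ with $g'\beta=\gamma g$ and $\beta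 f=f'\,\Omega(\delta)\,\eta_A$. Structure on $\mathcal A/[\mathcal X]$. Suspension $\Sigma$: for each $A\in\mathcal A$ fix a triangle $A\xrightarrow{\alpha_A}X_A\xrightarrow{\beta_A}\Sigma A\xrightarrow{\gamma_A}A[1]$ with $\alpha_A$ a left $\mathcal X$-approximation; $\Sigma\bar A=\overline{\Sigma A}$, and for $f:A\to A'$, $\Sigma\bar f=\bar h$ where $(f,g,h)$ is any morphism between the fixed triangles. $\nabla$ is the class of sextuples isomorphic to some $\bar A\xrightarrow{\bar f}\bar B\xrightarrow{\bar g}\bar C_f\xrightarrow{\bar h}\Sigma\bar A$, where $f:A\to B$ is in $\mathcal A$ and $B\xrightarrow{g}C_f\xrightarrow{h}\Sigma A\xrightarrow{f[1]\gamma_A}B[1]$ is a triangle. Loop functor $\Omega$, dually: for each $C\in\mathcal A$ fix a triangle $\Omega C\xrightarrow{a_C}Y_C\xrightarrow{b_C}C\xrightarrow{c_C}\Omega C[1]$ with $b_C$ a right $\mathcal X$-approximation, $\Omega$ on morphisms being induced by morphisms of triangles. $\triangle$ is the class of diagrams isomorphic to some $\Omega\bar C\xrightarrow{\bar h}\bar K_f\xrightarrow{\bar g}\bar B\xrightarrow{\bar f}\bar C$, where $f:B\to C$ is in $\mathcal A$ and $\Omega C\xrightarrow{h}K_f\xrightarrow{g}B\xrightarrow{c_Cf}\Omega C[1]$ is a triangle. The adjunction between $\Sigma$ and $\Omega$ is part of the structure whose existence is asserted. *)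

theory Defs
  imports "HOL-Algebra.Module" "HOL-Algebra.AbelCoset"
begin

section \<open>Linear categories\<close>

text \<open>
  Morphism sets are modules in the sense of HOL-Algebra; the ring product and the unit that
  a module record also carries are never used. Composition is written in the usual order,
  and it needs no object arguments because distinct morphism sets are disjoint.
\<close>

record ('o, 'm, 'k) lincat =
  Ob :: "'o set"
  Hom :: "'o \<Rightarrow> 'o \<Rightarrow> ('k, 'm) module"
  ident :: "'o \<Rightarrow> 'm"
  Comp :: "'m \<Rightarrow> 'm \<Rightarrow> 'm"  (infixl "\<cdot>\<index>" 70)

abbreviation Mor :: "('o, 'm, 'k) lincat \<Rightarrow> 'o \<Rightarrow> 'o \<Rightarrow> 'm set" where
  "Mor C A B \<equiv> carrier (Hom C A B)"

locale linear_category =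
  fixes K :: "'k ring" and C :: "('o, 'm, 'k) lincat"
  assumes base_field: "field K"
    and Hom_module: "\<lbrakk>A \<in> Ob C; B \<in> Ob C\<rbrakk> \<Longrightarrow> module K (Hom C A B)"
    and Mor_disjoint:
      "\<lbrakk>A \<in> Ob C; B \<in> Ob C; A' \<in> Ob C; B' \<in> Ob C; f \<in> Mor C A B; f \<in> Mor C A' B'\<rbrakk>
        \<Longrightarrow> A = A' \<and> B = B'"
    and ident_mor: "A \<in> Ob C \<Longrightarrow> ident C A \<in> Mor C A A"
    and comp_mor:
      "\<lbrakk>A \<in> Ob C; B \<in> Ob C; D \<in> Ob C; f \<in> Mor C A B; g \<in> Mor C B D\<rbrakk>
        \<Longrightarrow> g \<cdot>\<^bsub>C\<^esub> f \<in> Mor C A D"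
    and comp_ident: "\<lbrakk>A \<in> Ob C; B \<in> Ob C; f \<in> Mor C A B\<rbrakk> \<Longrightarrow> f \<cdot>\<^bsub>C\<^esub> ident C A = f"
    and ident_comp: "\<lbrakk>A \<in> Ob C; B \<in> Ob C; f \<in> Mor C A B\<rbrakk> \<Longrightarrow> ident C B \<cdot>\<^bsub>C\<^esub> f = f"
    and comp_assoc:
      "\<lbrakk>A \<in> Ob C; B \<in> Ob C; D \<in> Ob C; E \<in> Ob C;
        f \<in> Mor C A B; g \<in> Mor C B D; h \<in> Mor C D E\<rbrakk>
        \<Longrightarrow> (h \<cdot>\<^bsub>C\<^esub> g) \<cdot>\<^bsub>C\<^esub> f = h \<cdot>\<^bsub>C\<^esub> (g \<cdot>\<^bsub>C\<^esub> f)"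
    and comp_add_left:
      "\<lbrakk>A \<in> Ob C; B \<in> Ob C; D \<in> Ob C; f \<in> Mor C A B; g \<in> Mor C B D; g' \<in> Mor C B D\<rbrakk>
        \<Longrightarrow> (g \<oplus>\<^bsub>Hom C B D\<^esub> g') \<cdot>\<^bsub>C\<^esub> f = g \<cdot>\<^bsub>C\<^esub> f \<oplus>\<^bsub>Hom C A D\<^esub> g' \<cdot>\<^bsub>C\<^esub> f"
    and comp_add_right:
      "\<lbrakk>A \<in> Ob C; B \<in> Ob C; D \<in> Ob C; f \<in> Mor C A B; f' \<in> Mor C A B; g \<in> Mor C B D\<rbrakk>
        \<Longrightarrow> g \<cdot>\<^bsub>C\<^esub> (f \<oplus>\<^bsub>Hom C A B\<^esub> f') = g \<cdot>\<^bsub>C\<^esub> f \<oplus>\<^bsub>Hom C A D\<^esub> g \<cdot>\<^bsub>C\<^esub> f'"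
    and comp_smult_left:
      "\<lbrakk>A \<in> Ob C; B \<in> Ob C; D \<in> Ob C; k \<in> carrier K; f \<in> Mor C A B; g \<in> Mor C B D\<rbrakk>
        \<Longrightarrow> (k \<odot>\<^bsub>Hom C B D\<^esub> g) \<cdot>\<^bsub>C\<^esub> f = k \<odot>\<^bsub>Hom C A D\<^esub> (g \<cdot>\<^bsub>C\<^esub> f)"
    and comp_smult_right:
      "\<lbrakk>A \<in> Ob C; B \<in> Ob C; D \<in> Ob C; k \<in> carrier K; f \<in> Mor C A B; g \<in> Mor C B D\<rbrakk>
        \<Longrightarrow> g \<cdot>\<^bsub>C\<^esub> (k \<odot>\<^bsub>Hom C A B\<^esub> f) = k \<odot>\<^bsub>Hom C A D\<^esub> (g \<cdot>\<^bsub>C\<^esub> f)"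

definition op_cat :: "('o, 'm, 'k) lincat \<Rightarrow> ('o, 'm, 'k) lincat" where
  "op_cat C = \<lparr>Ob = Ob C, Hom = (\<lambda>A B. Hom C B A), ident = ident C, Comp = (\<lambda>g f. f \<cdot>\<^bsub>C\<^esub> g)\<rparr>"

definition full_subcat :: "('o, 'm, 'k) lincat \<Rightarrow> 'o set \<Rightarrow> ('o, 'm, 'k) lincat" where
  "full_subcat C S = C\<lparr>Ob := S\<rparr>"

definition is_iso :: "('o, 'm, 'k) lincat \<Rightarrow> 'o \<Rightarrow> 'o \<Rightarrow> 'm \<Rightarrow> bool" where
  "is_iso C A B f \<longleftrightarrow> f \<in> Mor C A B \<and>
     (\<exists>g \<in> Mor C B A. g \<cdot>\<^bsub>C\<^esub> f = ident C A \<and> f \<cdot>\<^bsub>C\<^esub> g = ident C B)"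

definition isomorphic :: "('o, 'm, 'k) lincat \<Rightarrow> 'o \<Rightarrow> 'o \<Rightarrow> bool" where
  "isomorphic C A B \<longleftrightarrow> A \<in> Ob C \<and> B \<in> Ob C \<and> (\<exists>f. is_iso C A B f)"

definition zero_object :: "('o, 'm, 'k) lincat \<Rightarrow> 'o \<Rightarrow> bool" where
  "zero_object C Z \<longleftrightarrow> Z \<in> Ob C \<and>
     (\<forall>A \<in> Ob C. (\<exists>!f. f \<in> Mor C Z A) \<and> (\<exists>!f. f \<in> Mor C A Z))"

text \<open>
  \<^term>\<open>A\<close> is the direct sum of \<^term>\<open>B 0\<close>, ..., \<^term>\<open>B (n - 1)\<close>; for \<^term>\<open>n = 0\<close> this says that
  the identity of \<^term>\<open>A\<close> is zero, so that zero objects are the empty direct sums.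
\<close>

definition direct_sum :: "('o, 'm, 'k) lincat \<Rightarrow> nat \<Rightarrow> (nat \<Rightarrow> 'o) \<Rightarrow> 'o \<Rightarrow> bool" where
  "direct_sum C n B A \<longleftrightarrow> A \<in> Ob C \<and> (\<forall>j<n. B j \<in> Ob C) \<and>
     (\<exists>inj proj.
        (\<forall>j<n. inj j \<in> Mor C (B j) A \<and> proj j \<in> Mor C A (B j)) \<and>
        (\<forall>j<n. proj j \<cdot>\<^bsub>C\<^esub> inj j = ident C (B j)) \<and>
        (\<forall>i<n. \<forall>j<n. i \<noteq> j \<longrightarrow> proj i \<cdot>\<^bsub>C\<^esub> inj j = \<zero>\<^bsub>Hom C (B j) (B i)\<^esub>) \<and>
        finsum (Hom C A A) (\<lambda>j. inj j \<cdot>\<^bsub>C\<^esub> proj j) {..<n} = ident C A)"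

locale additive_category = linear_category +
  assumes direct_sums: "\<forall>j<n. B j \<in> Ob C \<Longrightarrow> \<exists>A. direct_sum C n B A"

definition hom_finite :: "'k ring \<Rightarrow> ('o, 'm, 'k) lincat \<Rightarrow> bool" where
  "hom_finite K C \<longleftrightarrow> (\<forall>A \<in> Ob C. \<forall>B \<in> Ob C. \<exists>S. finite S \<and> S \<subseteq> Mor C A B \<and>
     (\<forall>f \<in> Mor C A B. \<exists>c \<in> S \<rightarrow> carrier K.
        f = finsum (Hom C A B) (\<lambda>s. c s \<odot>\<^bsub>Hom C A B\<^esub> s) S))"

definition End_ring :: "('o, 'm, 'k) lincat \<Rightarrow> 'o \<Rightarrow> 'm ring" where
  "End_ring C A = \<lparr>carrier = Mor C A A, mult = Comp C, one = ident C A,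
     zero = \<zero>\<^bsub>Hom C A A\<^esub>, add = add (Hom C A A)\<rparr>"

text \<open>Local in the noncommutative sense: the non-units are closed under addition.\<close>

definition local_ring :: "'a ring \<Rightarrow> bool" where
  "local_ring R \<longleftrightarrow> ring R \<and> \<one>\<^bsub>R\<^esub> \<noteq> \<zero>\<^bsub>R\<^esub> \<and>
     (\<forall>a \<in> carrier R - Units R. \<forall>b \<in> carrier R - Units R. a \<oplus>\<^bsub>R\<^esub> b \<notin> Units R)"

definition krull_schmidt :: "('o, 'm, 'k) lincat \<Rightarrow> bool" where
  "krull_schmidt C \<longleftrightarrow> (\<forall>A \<in> Ob C. \<exists>n B. direct_sum C n B A \<and>
     (\<forall>j<n. local_ring (End_ring C (B j))))"

definition subcategory :: "('o, 'm, 'k) lincat \<Rightarrow> 'o set \<Rightarrow> bool" where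
  "subcategory C S \<longleftrightarrow> S \<subseteq> Ob C \<and>
     (\<forall>A B. A \<in> S \<and> isomorphic C A B \<longrightarrow> B \<in> S) \<and>
     (\<forall>n B A. (\<forall>j<n. B j \<in> S) \<and> direct_sum C n B A \<longrightarrow> A \<in> S) \<and>
     (\<forall>n B A. A \<in> S \<and> direct_sum C n B A \<longrightarrow> (\<forall>j<n. B j \<in> S))"


section \<open>Additive endofunctors\<close>

record ('o, 'm) endofunctor =
  Fob :: "'o \<Rightarrow> 'o"
  Fmor :: "'m \<Rightarrow> 'm"

definition additive_endofunctor :: "('o, 'm, 'k) lincat \<Rightarrow> ('o, 'm) endofunctor \<Rightarrow> bool" where
  "additive_endofunctor C F \<longleftrightarrow>
     (\<forall>A \<in> Ob C. Fob F A \<in> Ob C \<and> Fmor F (ident C A) = ident C (Fob F A)) \<and>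
     (\<forall>A \<in> Ob C. \<forall>B \<in> Ob C. \<forall>f \<in> Mor C A B. Fmor F f \<in> Mor C (Fob F A) (Fob F B)) \<and>
     (\<forall>A \<in> Ob C. \<forall>B \<in> Ob C. \<forall>D \<in> Ob C. \<forall>f \<in> Mor C A B. \<forall>g \<in> Mor C B D.
        Fmor F (g \<cdot>\<^bsub>C\<^esub> f) = Fmor F g \<cdot>\<^bsub>C\<^esub> Fmor F f) \<and>
     (\<forall>A \<in> Ob C. \<forall>B \<in> Ob C. \<forall>f \<in> Mor C A B. \<forall>f' \<in> Mor C A B.
        Fmor F (f \<oplus>\<^bsub>Hom C A B\<^esub> f') = Fmor F f \<oplus>\<^bsub>Hom C (Fob F A) (Fob F B)\<^esub> Fmor F f')"

definition autoequivalence :: "('o, 'm, 'k) lincat \<Rightarrow> ('o, 'm) endofunctor \<Rightarrow> bool" where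
  "autoequivalence C F \<longleftrightarrow> additive_endofunctor C F \<and>
     (\<forall>A \<in> Ob C. \<forall>B \<in> Ob C. bij_betw (Fmor F) (Mor C A B) (Mor C (Fob F A) (Fob F B))) \<and>
     (\<forall>B \<in> Ob C. \<exists>A \<in> Ob C. isomorphic C (Fob F A) B)"

definition adjunction ::
    "('o, 'm, 'k) lincat \<Rightarrow> ('o, 'm) endofunctor \<Rightarrow> ('o, 'm) endofunctor
      \<Rightarrow> ('o \<Rightarrow> 'm) \<Rightarrow> ('o \<Rightarrow> 'm) \<Rightarrow> bool" where
  "adjunction C L R \<eta> \<epsilon> \<longleftrightarrow>
     (\<forall>A \<in> Ob C. \<eta> A \<in> Mor C A (Fob R (Fob L A)) \<and> \<epsilon> A \<in> Mor C (Fob L (Fob R A)) A) \<and>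
     (\<forall>A \<in> Ob C. \<forall>B \<in> Ob C. \<forall>f \<in> Mor C A B.
        \<eta> B \<cdot>\<^bsub>C\<^esub> f = Fmor R (Fmor L f) \<cdot>\<^bsub>C\<^esub> \<eta> A \<and>
        f \<cdot>\<^bsub>C\<^esub> \<epsilon> A = \<epsilon> B \<cdot>\<^bsub>C\<^esub> Fmor L (Fmor R f)) \<and>
     (\<forall>A \<in> Ob C.
        \<epsilon> (Fob L A) \<cdot>\<^bsub>C\<^esub> Fmor L (\<eta> A) = ident C (Fob L A) \<and>
        Fmor R (\<epsilon> A) \<cdot>\<^bsub>C\<^esub> \<eta> (Fob R A) = ident C (Fob R A))"


section \<open>Sextuples\<close>

text \<open>
  \<open>Sext A B C f g h\<close> stands for the diagram with arrows \<open>f : A \<rightarrow> B\<close>, \<open>g : B \<rightarrow> C\<close> and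
  \<open>h : C \<rightarrow> F A\<close>, where \<open>F\<close> is the endofunctor under consideration.
\<close>

datatype ('o, 'm) sextuple =
  Sext (ob1: 'o) (ob2: 'o) (ob3: 'o) (ar1: 'm) (ar2: 'm) (ar3: 'm)

definition is_sextuple ::
    "('o, 'm, 'k) lincat \<Rightarrow> ('o, 'm) endofunctor \<Rightarrow> ('o, 'm) sextuple \<Rightarrow> bool" where
  "is_sextuple C F s \<longleftrightarrow> ob1 s \<in> Ob C \<and> ob2 s \<in> Ob C \<and> ob3 s \<in> Ob C \<and>
     ar1 s \<in> Mor C (ob1 s) (ob2 s) \<and> ar2 s \<in> Mor C (ob2 s) (ob3 s) \<and>
     ar3 s \<in> Mor C (ob3 s) (Fob F (ob1 s))"

definition sext_morphism ::
    "('o, 'm, 'k) lincat \<Rightarrow> ('o, 'm) endofunctor \<Rightarrow> ('o, 'm) sextuple \<Rightarrow> ('o, 'm) sextuple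
      \<Rightarrow> 'm \<Rightarrow> 'm \<Rightarrow> 'm \<Rightarrow> bool" where
  "sext_morphism C F s s' \<alpha> \<beta> \<gamma> \<longleftrightarrow>
     \<alpha> \<in> Mor C (ob1 s) (ob1 s') \<and> \<beta> \<in> Mor C (ob2 s) (ob2 s') \<and> \<gamma> \<in> Mor C (ob3 s) (ob3 s') \<and>
     \<beta> \<cdot>\<^bsub>C\<^esub> ar1 s = ar1 s' \<cdot>\<^bsub>C\<^esub> \<alpha> \<and>
     \<gamma> \<cdot>\<^bsub>C\<^esub> ar2 s = ar2 s' \<cdot>\<^bsub>C\<^esub> \<beta> \<and>
     Fmor F \<alpha> \<cdot>\<^bsub>C\<^esub> ar3 s = ar3 s' \<cdot>\<^bsub>C\<^esub> \<gamma>"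

definition sext_isomorphic ::
    "('o, 'm, 'k) lincat \<Rightarrow> ('o, 'm) endofunctor \<Rightarrow> ('o, 'm) sextuple \<Rightarrow> ('o, 'm) sextuple
      \<Rightarrow> bool" where
  "sext_isomorphic C F s s' \<longleftrightarrow> is_sextuple C F s \<and> is_sextuple C F s' \<and>
     (\<exists>\<alpha> \<beta> \<gamma>. sext_morphism C F s s' \<alpha> \<beta> \<gamma> \<and>
        is_iso C (ob1 s) (ob1 s') \<alpha> \<and> is_iso C (ob2 s) (ob2 s') \<beta> \<and> is_iso C (ob3 s) (ob3 s') \<gamma>)"

text \<open>
  Read in the opposite category, the left-triangle diagram
  \<open>F C \<rightarrow> A \<rightarrow> B \<rightarrow> C\<close> with arrows \<open>f, g, h\<close> in this order, which is
  written \<open>Sext A B C f g h\<close> as well, is the sextuple \<open>op_sext (Sext A B C f g h)\<close>.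
\<close>

fun op_sext :: "('o, 'm) sextuple \<Rightarrow> ('o, 'm) sextuple" where
  "op_sext (Sext A B C f g h) = Sext C B A h g f"


section \<open>Right, left and pretriangulated categories\<close>

text \<open>
  The axioms common to triangulated and to right triangulated categories; for triangulated
  categories \<open>octahedral\<close> is Verdier's axiom. The two notions differ in the trivial triangles
  and in the invertibility of the functor and of the rotation.
\<close>

locale triangle_class = additive_category K C
  for K :: "'k ring" and C :: "('o, 'm, 'k) lincat" +
  fixes F :: "('o, 'm) endofunctor" and N :: "('o, 'm) sextuple set"
  assumes functor_F: "additive_endofunctor C F"
    and sextuples: "s \<in> N \<Longrightarrow> is_sextuple C F s"
    and iso_closed: "\<lbrakk>s \<in> N; sext_isomorphic C F s s'\<rbrakk> \<Longrightarrow> s' \<in> N"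
    and embed:
      "\<lbrakk>A \<in> Ob C; B \<in> Ob C; f \<in> Mor C A B\<rbrakk> \<Longrightarrow> \<exists>D g h. Sext A B D f g h \<in> N"
    and rotate:
      "Sext A B D f g h \<in> N
        \<Longrightarrow> Sext B D (Fob F A) g h (\<ominus>\<^bsub>Hom C (Fob F A) (Fob F B)\<^esub> Fmor F f) \<in> N"
    and complete_morphism:
      "\<lbrakk>Sext A B D f g h \<in> N; Sext A' B' D' f' g' h' \<in> N;
        \<alpha> \<in> Mor C A A'; \<beta> \<in> Mor C B B'; \<beta> \<cdot>\<^bsub>C\<^esub> f = f' \<cdot>\<^bsub>C\<^esub> \<alpha>\<rbrakk>
        \<Longrightarrow> \<exists>\<gamma>. sext_morphism C F (Sext A B D f g h) (Sext A' B' D' f' g' h') \<alpha> \<beta> \<gamma>"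
    and octahedral:
      "\<lbrakk>Sext A B D f g h \<in> N; Sext B X Y a b c \<in> N; Sext A X Z (a \<cdot>\<^bsub>C\<^esub> f) d e \<in> N\<rbrakk>
        \<Longrightarrow> \<exists>s \<in> Mor C D Z. \<exists>t \<in> Mor C Z Y.
              s \<cdot>\<^bsub>C\<^esub> g = d \<cdot>\<^bsub>C\<^esub> a \<and> e \<cdot>\<^bsub>C\<^esub> s = h \<and> t \<cdot>\<^bsub>C\<^esub> d = b \<and> c \<cdot>\<^bsub>C\<^esub> t = Fmor F f \<cdot>\<^bsub>C\<^esub> e \<and>
              Sext D Z Y s t (Fmor F g \<cdot>\<^bsub>C\<^esub> c) \<in> N"

locale triangulated_category = triangle_class +
  assumes shift_equivalence: "autoequivalence C F"
    and identity_triangle: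
      "\<lbrakk>A \<in> Ob C; zero_object C Z\<rbrakk>
        \<Longrightarrow> Sext A A Z (ident C A) \<zero>\<^bsub>Hom C A Z\<^esub> \<zero>\<^bsub>Hom C Z (Fob F A)\<^esub> \<in> N"
    and rotate_back:
      "\<lbrakk>is_sextuple C F (Sext A B D f g h);
        Sext B D (Fob F A) g h (\<ominus>\<^bsub>Hom C (Fob F A) (Fob F B)\<^esub> Fmor F f) \<in> N\<rbrakk>
        \<Longrightarrow> Sext A B D f g h \<in> N"

text \<open>For a zero object \<open>Z\<close>, also \<open>Fob F Z\<close> is a zero object, by additivity of \<open>F\<close>.\<close>

locale right_triangulated = triangle_class +
  assumes zero_triangle:
      "\<lbrakk>A \<in> Ob C; zero_object C Z\<rbrakk>
        \<Longrightarrow> Sext Z A A \<zero>\<^bsub>Hom C Z A\<^esub> (ident C A) \<zero>\<^bsub>Hom C A (Fob F Z)\<^esub> \<in> N"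

definition left_triangulated ::
    "'k ring \<Rightarrow> ('o, 'm, 'k) lincat \<Rightarrow> ('o, 'm) endofunctor \<Rightarrow> ('o, 'm) sextuple set \<Rightarrow> bool" where
  "left_triangulated K C \<Omega> LT \<longleftrightarrow> right_triangulated K (op_cat C) \<Omega> (op_sext ` LT)"

locale pretriangulation =
  fixes K :: "'k ring" and C :: "('o, 'm, 'k) lincat"
    and \<Omega> \<Sigma> :: "('o, 'm) endofunctor"
    and LT RT :: "('o, 'm) sextuple set"
    and \<eta> \<epsilon> :: "'o \<Rightarrow> 'm"
  assumes right_triangulated: "right_triangulated K C \<Sigma> RT"
    and left_triangulated: "left_triangulated K C \<Omega> LT"
    and adjunction: "adjunction C \<Sigma> \<Omega> \<eta> \<epsilon>"
    and fill_right:
      "\<lbrakk>Sext A B D f g h \<in> RT; Sext A' B' D' f' g' h' \<in> LT;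
        \<alpha> \<in> Mor C A (Fob \<Omega> D'); \<beta> \<in> Mor C B A'; \<beta> \<cdot>\<^bsub>C\<^esub> f = f' \<cdot>\<^bsub>C\<^esub> \<alpha>\<rbrakk>
        \<Longrightarrow> \<exists>\<gamma> \<in> Mor C D B'. \<gamma> \<cdot>\<^bsub>C\<^esub> g = g' \<cdot>\<^bsub>C\<^esub> \<beta> \<and> h' \<cdot>\<^bsub>C\<^esub> \<gamma> = \<epsilon> D' \<cdot>\<^bsub>C\<^esub> Fmor \<Sigma> \<alpha> \<cdot>\<^bsub>C\<^esub> h"
    and fill_left:
      "\<lbrakk>Sext A B D f g h \<in> RT; Sext A' B' D' f' g' h' \<in> LT;
        \<gamma> \<in> Mor C D B'; \<delta> \<in> Mor C (Fob \<Sigma> A) D'; \<delta> \<cdot>\<^bsub>C\<^esub> h = h' \<cdot>\<^bsub>C\<^esub> \<gamma>\<rbrakk>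
        \<Longrightarrow> \<exists>\<beta> \<in> Mor C B A'. g' \<cdot>\<^bsub>C\<^esub> \<beta> = \<gamma> \<cdot>\<^bsub>C\<^esub> g \<and> \<beta> \<cdot>\<^bsub>C\<^esub> f = f' \<cdot>\<^bsub>C\<^esub> Fmor \<Omega> \<delta> \<cdot>\<^bsub>C\<^esub> \<eta> A"


section \<open>Approximations\<close>

definition left_approximation ::
    "('o, 'm, 'k) lincat \<Rightarrow> 'o set \<Rightarrow> 'o \<Rightarrow> 'o \<Rightarrow> 'm \<Rightarrow> bool" where
  "left_approximation C \<X> A Y f \<longleftrightarrow> Y \<in> \<X> \<and> f \<in> Mor C A Y \<and>
     (\<forall>X \<in> \<X>. \<forall>u \<in> Mor C A X. \<exists>v \<in> Mor C Y X. u = v \<cdot>\<^bsub>C\<^esub> f)"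

definition right_approximation ::
    "('o, 'm, 'k) lincat \<Rightarrow> 'o set \<Rightarrow> 'o \<Rightarrow> 'o \<Rightarrow> 'm \<Rightarrow> bool" where
  "right_approximation C \<X> A Y f \<longleftrightarrow> Y \<in> \<X> \<and> f \<in> Mor C Y A \<and>
     (\<forall>X \<in> \<X>. \<forall>u \<in> Mor C X A. \<exists>v \<in> Mor C X Y. u = f \<cdot>\<^bsub>C\<^esub> v)"

definition functorially_finite :: "('o, 'm, 'k) lincat \<Rightarrow> 'o set \<Rightarrow> bool" where
  "functorially_finite C \<X> \<longleftrightarrow>
     (\<forall>A \<in> Ob C. (\<exists>Y f. left_approximation C \<X> A Y f) \<and> (\<exists>Y f. right_approximation C \<X> A Y f))"

definition monic_rel :: "('o, 'm, 'k) lincat \<Rightarrow> 'o set \<Rightarrow> 'o \<Rightarrow> 'o \<Rightarrow> 'm \<Rightarrow> bool" where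
  "monic_rel C \<X> A B f \<longleftrightarrow> f \<in> Mor C A B \<and>
     (\<forall>X \<in> \<X>. (\<lambda>u. u \<cdot>\<^bsub>C\<^esub> f) ` Mor C B X = Mor C A X)"

definition epic_rel :: "('o, 'm, 'k) lincat \<Rightarrow> 'o set \<Rightarrow> 'o \<Rightarrow> 'o \<Rightarrow> 'm \<Rightarrow> bool" where
  "epic_rel C \<X> A B f \<longleftrightarrow> f \<in> Mor C A B \<and>
     (\<forall>X \<in> \<X>. (\<lambda>u. f \<cdot>\<^bsub>C\<^esub> u) ` Mor C X A = Mor C X B)"

definition monics_have_cones ::
    "('o, 'm, 'k) lincat \<Rightarrow> ('o, 'm) sextuple set \<Rightarrow> 'o set \<Rightarrow> 'o set \<Rightarrow> bool" where
  "monics_have_cones T \<T> \<A> \<X> \<longleftrightarrow>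
     (\<forall>A \<in> \<A>. \<forall>B \<in> \<A>. \<forall>f. monic_rel T \<X> A B f \<longrightarrow>
        (\<forall>C g h. Sext A B C f g h \<in> \<T> \<longrightarrow> C \<in> \<A>))"

definition epics_have_cocones ::
    "('o, 'm, 'k) lincat \<Rightarrow> ('o, 'm) sextuple set \<Rightarrow> 'o set \<Rightarrow> 'o set \<Rightarrow> bool" where
  "epics_have_cocones T \<T> \<A> \<X> \<longleftrightarrow>
     (\<forall>B \<in> \<A>. \<forall>C \<in> \<A>. \<forall>f. epic_rel T \<X> B C f \<longrightarrow>
        (\<forall>K g h. Sext K B C g f h \<in> \<T> \<longrightarrow> K \<in> \<A>))"


section \<open>The subfactor category\<close>

definition factoring :: "('o, 'm, 'k) lincat \<Rightarrow> 'o set \<Rightarrow> 'o \<Rightarrow> 'o \<Rightarrow> 'm set" where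
  "factoring C \<X> A B = {v \<cdot>\<^bsub>C\<^esub> u | u v X. X \<in> \<X> \<and> u \<in> Mor C A X \<and> v \<in> Mor C X B}"

text \<open>
  The class of a morphism. As morphism sets are disjoint, the union is over a single pair of
  objects. In the operations below, unions over all representatives take the place of a choice
  of representatives: such a union is again a class only if the operation is well defined.
\<close>

definition mor_class :: "('o, 'm, 'k) lincat \<Rightarrow> 'o set \<Rightarrow> 'm \<Rightarrow> 'm set" where
  "mor_class C \<X> f =
     \<Union>{factoring C \<X> A B +>\<^bsub>Hom C A B\<^esub> f | A B. A \<in> Ob C \<and> B \<in> Ob C \<and> f \<in> Mor C A B}"

definition subfactor ::
    "('o, 'm, 'k) lincat \<Rightarrow> 'o set \<Rightarrow> 'o set \<Rightarrow> ('o, 'm set, 'k) lincat" where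
  "subfactor T \<A> \<X> = \<lparr>
     Ob = \<A>,
     Hom = (\<lambda>A B. \<lparr>
       carrier = a_rcosets\<^bsub>Hom T A B\<^esub> (factoring T \<X> A B),
       mult = undefined,
       one = undefined,
       zero = factoring T \<X> A B,
       add = set_add (Hom T A B),
       smult = (\<lambda>k F. \<Union>f \<in> F. mor_class T \<X> (k \<odot>\<^bsub>Hom T A B\<^esub> f))\<rparr>),
     ident = (\<lambda>A. mor_class T \<X> (ident T A)),
     Comp = (\<lambda>G F. \<Union>g \<in> G. \<Union>f \<in> F. mor_class T \<X> (g \<cdot>\<^bsub>T\<^esub> f))\<rparr>"

text \<open>
  In the following, \<open>S\<close> and \<open>\<T>\<close> are the shift and the class of distinguished triangles of
  \<open>T\<close>. The function \<open>P\<close> chooses for each object \<open>A\<close> of \<open>\<A>\<close> a distinguished triangle that starts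
  with a left approximation of \<open>A\<close>; it determines the suspension, with \<open>ob3 (P A)\<close> the suspension
  of \<open>A\<close> and \<open>ar3 (P A)\<close> its connecting morphism to \<open>Fob S A\<close>.
\<close>

definition suspension_choice ::
    "('o, 'm, 'k) lincat \<Rightarrow> ('o, 'm) sextuple set \<Rightarrow> 'o set \<Rightarrow> 'o set
      \<Rightarrow> ('o \<Rightarrow> ('o, 'm) sextuple) \<Rightarrow> bool" where
  "suspension_choice T \<T> \<A> \<X> P \<longleftrightarrow>
     (\<forall>A \<in> \<A>. P A \<in> \<T> \<and> ob1 (P A) = A \<and> left_approximation T \<X> A (ob2 (P A)) (ar1 (P A)))"

definition suspension ::
    "('o, 'm, 'k) lincat \<Rightarrow> ('o, 'm) endofunctor \<Rightarrow> 'o set \<Rightarrow> 'o set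
      \<Rightarrow> ('o \<Rightarrow> ('o, 'm) sextuple) \<Rightarrow> ('o, 'm set) endofunctor" where
  "suspension T S \<A> \<X> P = \<lparr>
     Fob = (\<lambda>A. ob3 (P A)),
     Fmor = (\<lambda>F. \<Union>{mor_class T \<X> h | f g h A A'. f \<in> F \<and> A \<in> \<A> \<and> A' \<in> \<A> \<and>
                      sext_morphism T S (P A) (P A') f g h})\<rparr>"

definition right_triangles ::
    "('o, 'm, 'k) lincat \<Rightarrow> ('o, 'm) endofunctor \<Rightarrow> ('o, 'm) sextuple set \<Rightarrow> 'o set \<Rightarrow> 'o set
      \<Rightarrow> ('o \<Rightarrow> ('o, 'm) sextuple) \<Rightarrow> ('o, 'm set) sextuple set" where
  "right_triangles T S \<T> \<A> \<X> P =
     {t. \<exists>A \<in> \<A>. \<exists>B \<in> \<A>. \<exists>f \<in> Mor T A B. \<exists>C g h.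
        Sext B C (ob3 (P A)) g h (Fmor S f \<cdot>\<^bsub>T\<^esub> ar3 (P A)) \<in> \<T> \<and>
        sext_isomorphic (subfactor T \<A> \<X>) (suspension T S \<A> \<X> P)
          (Sext A B C (mor_class T \<X> f) (mor_class T \<X> g) (mor_class T \<X> h)) t}"

text \<open>
  Dually, \<open>L\<close> chooses for each object \<open>C\<close> of \<open>\<A>\<close> a distinguished triangle whose second arrow is
  a right approximation of \<open>C\<close>; the loop object of \<open>C\<close> is \<open>ob1 (L C)\<close>.
\<close>

definition loop_choice ::
    "('o, 'm, 'k) lincat \<Rightarrow> ('o, 'm) sextuple set \<Rightarrow> 'o set \<Rightarrow> 'o set
      \<Rightarrow> ('o \<Rightarrow> ('o, 'm) sextuple) \<Rightarrow> bool" where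
  "loop_choice T \<T> \<A> \<X> L \<longleftrightarrow>
     (\<forall>C \<in> \<A>. L C \<in> \<T> \<and> ob3 (L C) = C \<and> right_approximation T \<X> C (ob2 (L C)) (ar2 (L C)))"

definition loop ::
    "('o, 'm, 'k) lincat \<Rightarrow> ('o, 'm) endofunctor \<Rightarrow> 'o set \<Rightarrow> 'o set
      \<Rightarrow> ('o \<Rightarrow> ('o, 'm) sextuple) \<Rightarrow> ('o, 'm set) endofunctor" where
  "loop T S \<A> \<X> L = \<lparr>
     Fob = (\<lambda>C. ob1 (L C)),
     Fmor = (\<lambda>F. \<Union>{mor_class T \<X> h | f g h C C'. f \<in> F \<and> C \<in> \<A> \<and> C' \<in> \<A> \<and>
                      sext_morphism T S (L C) (L C') h g f})\<rparr>"

definition left_triangles ::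
    "('o, 'm, 'k) lincat \<Rightarrow> ('o, 'm) endofunctor \<Rightarrow> ('o, 'm) sextuple set \<Rightarrow> 'o set \<Rightarrow> 'o set
      \<Rightarrow> ('o \<Rightarrow> ('o, 'm) sextuple) \<Rightarrow> ('o, 'm set) sextuple set" where
  "left_triangles T S \<T> \<A> \<X> L =
     {t. \<exists>B \<in> \<A>. \<exists>C \<in> \<A>. \<exists>f \<in> Mor T B C. \<exists>K g h.
        Sext (ob1 (L C)) K B h g (ar3 (L C) \<cdot>\<^bsub>T\<^esub> f) \<in> \<T> \<and>
        sext_isomorphic (op_cat (subfactor T \<A> \<X>)) (loop T S \<A> \<X> L)
          (op_sext (Sext K B C (mor_class T \<X> h) (mor_class T \<X> g) (mor_class T \<X> f)))
          (op_sext t)}"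

end

(*
Write E(D, A) for Hom(D, S A). The whole argument only uses the bifunctor E, with push-forward and
pull-back, and the distinguished triangles A -> B -> D with a class in E(D, A); the properties of
these that are needed form a self-dual list of axioms, so that the left triangulated half and one of
the two compatibility conditions are obtained by reading the other half in the opposite category.

A morphism h into the suspension of A is determined modulo X by the pull-back along h of the class
of the chosen triangle of A. Up to isomorphism in the quotient, right triangles can therefore be
computed with distinguished triangles whose first arrow is X-monic, where the octahedral axiom is
that of T. The transpose of phi : Sigma A -> C is the psi : A -> Omega C for which the push-forward
along psi and the pull-back along phi of the two chosen classes agree; unit and counit are the
negatives of the transposes of identities, since right triangles carry the opposite sign.
*)
theory Submission
  imports Defs
begin

text \<open>The obstacle is that the cone of a morphism f : A -> B of \<A> may leave \<A>: only
  X-monic arrows have their cones there. With al : A -> X_A the chosen approximation, f is replaced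
  by (f, al) : A -> B + X_A. This is X-monic, agrees with f in the quotient up to isomorphism, and
  its cone is the third vertex of the right triangle of f. The two ways to map A into that cone,
  through B and through X_A, differ by a sign; this is where the opposite sign of right triangles
  comes from. Monic arrows help a second time. A square that commutes only modulo X has an error
  that passes through an object of X. The error extends along an X-monic arrow and can then be
  subtracted from the second vertical arrow, without changing its class; the square then commutes
  strictly and the axioms of T apply. Classes in E(D, A) are never added. Additivity is expressed by
  adding and negating equations "push-forward of one class = pull-back of another", a form that is
  symmetric under passage to the opposite category.\<close>

section \<open>Arithmetic of morphisms\<close>

text \<open>Morphism sets are disjoint, so a morphism determines its ends. Typing thereby turns into
  equations between objects, which the simplifier can use to discharge the side conditions of all
  the rules below.\<close>

definition src :: "('o, 'm, 'k) lincat \<Rightarrow> 'm \<Rightarrow> 'o" where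
  "src C f = (THE A. A \<in> Ob C \<and> (\<exists>B \<in> Ob C. f \<in> Mor C A B))"

definition tgt :: "('o, 'm, 'k) lincat \<Rightarrow> 'm \<Rightarrow> 'o" where
  "tgt C f = (THE B. B \<in> Ob C \<and> (\<exists>A \<in> Ob C. f \<in> Mor C A B))"

definition arr :: "('o, 'm, 'k) lincat \<Rightarrow> 'm \<Rightarrow> bool" where
  "arr C f \<longleftrightarrow> (\<exists>A \<in> Ob C. \<exists>B \<in> Ob C. f \<in> Mor C A B)"

definition arrow :: "('o, 'm, 'k) lincat \<Rightarrow> 'o \<Rightarrow> 'o \<Rightarrow> 'm \<Rightarrow> bool" where
  "arrow C A B f \<longleftrightarrow> A \<in> Ob C \<and> B \<in> Ob C \<and> f \<in> Mor C A B"

text \<open>The addition of a morphism module carries two objects. Reading them off the first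
  summand gives an operation without object arguments, like the composition.\<close>

definition cadd :: "('o, 'm, 'k) lincat \<Rightarrow> 'm \<Rightarrow> 'm \<Rightarrow> 'm" (infixl "\<uplus>\<index>" 65) where
  "f \<uplus>\<^bsub>C\<^esub> g = f \<oplus>\<^bsub>Hom C (src C f) (tgt C f)\<^esub> g"

definition cneg :: "('o, 'm, 'k) lincat \<Rightarrow> 'm \<Rightarrow> 'm" ("\<sim>\<index> _" [80] 80) where
  "\<sim>\<^bsub>C\<^esub> f = \<ominus>\<^bsub>Hom C (src C f) (tgt C f)\<^esub> f"

abbreviation czero :: "('o, 'm, 'k) lincat \<Rightarrow> 'o \<Rightarrow> 'o \<Rightarrow> 'm" where
  "czero C A B \<equiv> \<zero>\<^bsub>Hom C A B\<^esub>"

context linear_category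
begin

abbreviation cmp (infixr "\<bullet>" 70) where "g \<bullet> f \<equiv> g \<cdot>\<^bsub>C\<^esub> f"
abbreviation plus_mor (infixl "\<boxplus>" 65) where "f \<boxplus> g \<equiv> f \<uplus>\<^bsub>C\<^esub> g"
abbreviation neg_mor ("\<boxminus> _" [80] 80) where "\<boxminus> f \<equiv> \<sim>\<^bsub>C\<^esub> f"
abbreviation zero_mor where "zero_mor A B \<equiv> czero C A B"

lemma Hom_abelian: "\<lbrakk>A \<in> Ob C; B \<in> Ob C\<rbrakk> \<Longrightarrow> abelian_group (Hom C A B)"
  using Hom_module module.axioms(2) by blast

lemma src_eq: "\<lbrakk>A \<in> Ob C; B \<in> Ob C; f \<in> Mor C A B\<rbrakk> \<Longrightarrow> src C f = A"
  unfolding src_def using Mor_disjoint by (intro the_equality) blast+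

lemma tgt_eq: "\<lbrakk>A \<in> Ob C; B \<in> Ob C; f \<in> Mor C A B\<rbrakk> \<Longrightarrow> tgt C f = B"
  unfolding tgt_def using Mor_disjoint by (intro the_equality) blast+

text \<open>As a simp rule this splits a typing judgement into equations. Where a judgement has to
  match a premise as a whole, the rule is removed by \<open>del: arrow_iff\<close>.\<close>

lemma arrow_iff [simp]:
  "arrow C A B f \<longleftrightarrow> A \<in> Ob C \<and> B \<in> Ob C \<and> arr C f \<and> src C f = A \<and> tgt C f = B"
  unfolding arrow_def arr_def using src_eq tgt_eq by blast

lemma arrow_mem: "arrow C A B f \<Longrightarrow> f \<in> Mor C A B"
  by (simp only: arrow_def)

lemma arrowI: "\<lbrakk>A \<in> Ob C; B \<in> Ob C; f \<in> Mor C A B\<rbrakk> \<Longrightarrow> arrow C A B f"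
  by (simp only: arrow_def)

lemma arrow_of_arr: "arr C f \<Longrightarrow> arrow C (src C f) (tgt C f) f"
  unfolding arr_def using src_eq tgt_eq arrow_def by metis

lemma Mor_iff: "\<lbrakk>A \<in> Ob C; B \<in> Ob C\<rbrakk> \<Longrightarrow> f \<in> Mor C A B \<longleftrightarrow> arr C f \<and> src C f = A \<and> tgt C f = B"
  using arrow_iff arrow_def by metis

lemma src_Ob [simp]: "arr C f \<Longrightarrow> src C f \<in> Ob C"
  using arrow_of_arr arrow_def by metis

lemma tgt_Ob [simp]: "arr C f \<Longrightarrow> tgt C f \<in> Ob C"
  using arrow_of_arr arrow_def by metis

lemma comp_typed:
  assumes "arr C f" "arr C g" "src C g = tgt C f"
  shows "arrow C (src C f) (tgt C g) (g \<bullet> f)"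
  using assms arrow_of_arr comp_mor unfolding arrow_def by metis

lemma arr_comp [simp]: "\<lbrakk>arr C f; arr C g; src C g = tgt C f\<rbrakk> \<Longrightarrow> arr C (g \<bullet> f)"
  and src_comp [simp]: "\<lbrakk>arr C f; arr C g; src C g = tgt C f\<rbrakk> \<Longrightarrow> src C (g \<bullet> f) = src C f"
  and tgt_comp [simp]: "\<lbrakk>arr C f; arr C g; src C g = tgt C f\<rbrakk> \<Longrightarrow> tgt C (g \<bullet> f) = tgt C g"
  using comp_typed arrow_iff by metis+

lemma ident_typed: "A \<in> Ob C \<Longrightarrow> arrow C A A (ident C A)"
  by (simp add: arrow_def ident_mor del: arrow_iff)

lemma arr_ident [simp]: "A \<in> Ob C \<Longrightarrow> arr C (ident C A)"
  and src_ident [simp]: "A \<in> Ob C \<Longrightarrow> src C (ident C A) = A"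
  and tgt_ident [simp]: "A \<in> Ob C \<Longrightarrow> tgt C (ident C A) = A"
  using ident_typed by simp_all

lemma comp_id [simp]: "\<lbrakk>arr C f; src C f = A\<rbrakk> \<Longrightarrow> f \<bullet> ident C A = f"
  using arrow_of_arr comp_ident unfolding arrow_def by metis

lemma id_comp [simp]: "\<lbrakk>arr C f; tgt C f = A\<rbrakk> \<Longrightarrow> ident C A \<bullet> f = f"
  using arrow_of_arr ident_comp unfolding arrow_def by metis

lemma assoc [simp]:
  "\<lbrakk>arr C f; arr C g; arr C h; src C g = tgt C f; src C h = tgt C g\<rbrakk>
    \<Longrightarrow> (h \<bullet> g) \<bullet> f = h \<bullet> g \<bullet> f"
  using comp_assoc[of "src C f" "tgt C f" "tgt C g" "tgt C h" f g h]
    arrow_of_arr[THEN arrow_mem, of f] arrow_of_arr[THEN arrow_mem, of g]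
    arrow_of_arr[THEN arrow_mem, of h] by simp

lemma add_typed:
  assumes "arr C f" "arr C g" "src C g = src C f" "tgt C g = tgt C f"
  shows "arrow C (src C f) (tgt C f) (f \<boxplus> g)"
  using arrow_of_arr[OF assms(1)] arrow_of_arr[OF assms(2)] assms
    abelian_monoid.a_closed[OF abelian_group.axioms(1)[OF Hom_abelian]]
  unfolding arrow_def cadd_def by auto

lemma arr_add [simp]:
    "\<lbrakk>arr C f; arr C g; src C g = src C f; tgt C g = tgt C f\<rbrakk> \<Longrightarrow> arr C (f \<boxplus> g)"
  and src_add [simp]:
    "\<lbrakk>arr C f; arr C g; src C g = src C f; tgt C g = tgt C f\<rbrakk> \<Longrightarrow> src C (f \<boxplus> g) = src C f"
  and tgt_add [simp]:
    "\<lbrakk>arr C f; arr C g; src C g = src C f; tgt C g = tgt C f\<rbrakk> \<Longrightarrow> tgt C (f \<boxplus> g) = tgt C f"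
  using add_typed arrow_iff by metis+

lemma neg_typed: "arr C f \<Longrightarrow> arrow C (src C f) (tgt C f) (\<boxminus> f)"
  using arrow_of_arr abelian_group.a_inv_closed[OF Hom_abelian]
  unfolding arrow_def cneg_def by auto

lemma arr_neg [simp]: "arr C f \<Longrightarrow> arr C (\<boxminus> f)"
  and src_neg [simp]: "arr C f \<Longrightarrow> src C (\<boxminus> f) = src C f"
  and tgt_neg [simp]: "arr C f \<Longrightarrow> tgt C (\<boxminus> f) = tgt C f"
  using neg_typed by simp_all

lemma zero_typed: "\<lbrakk>A \<in> Ob C; B \<in> Ob C\<rbrakk> \<Longrightarrow> arrow C A B (zero_mor A B)"
  using abelian_monoid.zero_closed[OF abelian_group.axioms(1)[OF Hom_abelian]]
  unfolding arrow_def by auto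

lemma arr_zero [simp]: "\<lbrakk>A \<in> Ob C; B \<in> Ob C\<rbrakk> \<Longrightarrow> arr C (zero_mor A B)"
  and src_zero [simp]: "\<lbrakk>A \<in> Ob C; B \<in> Ob C\<rbrakk> \<Longrightarrow> src C (zero_mor A B) = A"
  and tgt_zero [simp]: "\<lbrakk>A \<in> Ob C; B \<in> Ob C\<rbrakk> \<Longrightarrow> tgt C (zero_mor A B) = B"
  using zero_typed by simp_all

lemma add_eq: "\<lbrakk>A \<in> Ob C; B \<in> Ob C; f \<in> Mor C A B\<rbrakk> \<Longrightarrow> f \<oplus>\<^bsub>Hom C A B\<^esub> g = f \<boxplus> g"
  unfolding cadd_def by (simp add: src_eq tgt_eq)

lemma neg_eq: "\<lbrakk>A \<in> Ob C; B \<in> Ob C; f \<in> Mor C A B\<rbrakk> \<Longrightarrow> \<ominus>\<^bsub>Hom C A B\<^esub> f = \<boxminus> f"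
  unfolding cneg_def by (simp add: src_eq tgt_eq)

lemma add_assoc:
  assumes "arr C f" "arr C g" "arr C h" "src C g = src C f" "tgt C g = tgt C f"
    "src C h = src C f" "tgt C h = tgt C f"
  shows "(f \<boxplus> g) \<boxplus> h = f \<boxplus> (g \<boxplus> h)"
proof -
  interpret abelian_group "Hom C (src C f) (tgt C f)" using assms Hom_abelian by simp
  have mem: "f \<in> Mor C (src C f) (tgt C f)" "g \<in> Mor C (src C f) (tgt C f)"
    "h \<in> Mor C (src C f) (tgt C f)"
    using assms arrow_of_arr[THEN arrow_mem] by metis+
  have "src C (f \<boxplus> g) = src C f" "tgt C (f \<boxplus> g) = tgt C f" using assms by simp_all
  then show ?thesis using a_assoc[OF mem] assms unfolding cadd_def by simp
qed

lemma add_commute: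
  assumes "arr C f" "arr C g" "src C g = src C f" "tgt C g = tgt C f"
  shows "f \<boxplus> g = g \<boxplus> f"
proof -
  interpret abelian_group "Hom C (src C f) (tgt C f)" using assms Hom_abelian by simp
  show ?thesis
    using assms arrow_of_arr[OF assms(1), THEN arrow_mem] arrow_of_arr[OF assms(2), THEN arrow_mem]
      a_comm[of f g] by (simp add: cadd_def)
qed

lemma add_left_commute:
  assumes "arr C f" "arr C g" "arr C h" "src C g = src C f" "tgt C g = tgt C f"
    "src C h = src C f" "tgt C h = tgt C f"
  shows "f \<boxplus> (g \<boxplus> h) = g \<boxplus> (f \<boxplus> h)"
  using assms add_assoc[of f g h] add_assoc[of g f h] add_commute[of f g] by simp

lemmas add_ac = add_assoc add_commute add_left_commute

lemma zero_add [simp]: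
  assumes "arr C f" "src C f = A" "tgt C f = B" shows "zero_mor A B \<boxplus> f = f"
proof -
  have ob: "A \<in> Ob C" "B \<in> Ob C" using assms by auto
  interpret abelian_group "Hom C A B" using ob Hom_abelian by simp
  show ?thesis using assms ob arrow_of_arr[OF assms(1), THEN arrow_mem] by (simp add: cadd_def)
qed

lemma add_zero [simp]:
  assumes "arr C f" "src C f = A" "tgt C f = B" shows "f \<boxplus> zero_mor A B = f"
  using assms add_commute[of f "zero_mor A B"] by (metis arr_zero src_Ob tgt_Ob src_zero tgt_zero zero_add)

lemma add_neg [simp]: "arr C f \<Longrightarrow> f \<boxplus> \<boxminus> f = zero_mor (src C f) (tgt C f)"
  and neg_add_self [simp]: "arr C f \<Longrightarrow> \<boxminus> f \<boxplus> f = zero_mor (src C f) (tgt C f)"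
proof -
  assume f: "arr C f"
  interpret abelian_group "Hom C (src C f) (tgt C f)" using f Hom_abelian by simp
  show 1: "f \<boxplus> \<boxminus> f = zero_mor (src C f) (tgt C f)"
    using f arrow_of_arr[OF f, THEN arrow_mem] r_neg by (simp add: cadd_def cneg_def)
  then show "\<boxminus> f \<boxplus> f = zero_mor (src C f) (tgt C f)"
    using f add_commute[of f "\<boxminus> f"] by simp
qed

lemma add_neg_cancel [simp]:
  "\<lbrakk>arr C f; arr C g; src C g = src C f; tgt C g = tgt C f\<rbrakk> \<Longrightarrow> f \<boxplus> (\<boxminus> f \<boxplus> g) = g"
  and neg_add_cancel [simp]:
  "\<lbrakk>arr C f; arr C g; src C g = src C f; tgt C g = tgt C f\<rbrakk> \<Longrightarrow> \<boxminus> f \<boxplus> (f \<boxplus> g) = g"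
  using add_assoc[of f "\<boxminus> f" g] add_assoc[of "\<boxminus> f" f g] by simp_all

lemma add_eq_zero:
  assumes "arr C f" "arr C g" "src C g = src C f" "tgt C g = tgt C f"
    "f \<boxplus> g = zero_mor (src C f) (tgt C f)"
  shows "g = \<boxminus> f"
  using assms neg_add_cancel[of f g] add_zero[of "\<boxminus> f" "src C f" "tgt C f"] by simp

lemma neg_neg [simp]: "arr C f \<Longrightarrow> \<boxminus> \<boxminus> f = f"
  using add_eq_zero[of "\<boxminus> f" f] by simp

lemma neg_eq_iff: "\<lbrakk>arr C f; arr C g\<rbrakk> \<Longrightarrow> \<boxminus> f = \<boxminus> g \<longleftrightarrow> f = g"
  by (metis neg_neg)

lemma neg_zero [simp]: "\<lbrakk>A \<in> Ob C; B \<in> Ob C\<rbrakk> \<Longrightarrow> \<boxminus> zero_mor A B = zero_mor A B"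
  using add_eq_zero[of "zero_mor A B" "zero_mor A B"] by simp

lemma neg_add [simp]:
  assumes "arr C f" "arr C g" "src C g = src C f" "tgt C g = tgt C f"
  shows "\<boxminus> (f \<boxplus> g) = \<boxminus> f \<boxplus> \<boxminus> g"
proof (rule add_eq_zero[symmetric])
  have "(f \<boxplus> g) \<boxplus> (\<boxminus> f \<boxplus> \<boxminus> g) = f \<boxplus> (\<boxminus> f \<boxplus> (g \<boxplus> \<boxminus> g))"
    using assms by (simp add: add_assoc add_left_commute del: add_neg add_neg_cancel neg_add_cancel)
  then show "(f \<boxplus> g) \<boxplus> (\<boxminus> f \<boxplus> \<boxminus> g) = zero_mor (src C (f \<boxplus> g)) (tgt C (f \<boxplus> g))"
    using assms by simp
qed (use assms in simp_all)

lemma diff_eq_iff: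
  assumes "arr C f" "arr C g" "src C g = src C f" "tgt C g = tgt C f"
    "arr C h" "src C h = src C f" "tgt C h = tgt C f"
  shows "f \<boxplus> \<boxminus> g = h \<longleftrightarrow> f = g \<boxplus> h"
proof
  assume "f \<boxplus> \<boxminus> g = h"
  then have "g \<boxplus> h = g \<boxplus> (\<boxminus> g \<boxplus> f)" using assms(1-4) add_commute[of f "\<boxminus> g"] by simp
  then show "f = g \<boxplus> h" using assms(1-4) by simp
next
  assume f: "f = g \<boxplus> h"
  have "src C h = src C g" "tgt C h = tgt C g" using assms by simp_all
  then show "f \<boxplus> \<boxminus> g = h"
    unfolding f using assms(2,5) add_commute[of "g \<boxplus> h" "\<boxminus> g"] by simp
qed

lemma comp_add [simp]:
  assumes "arr C f" "arr C f'" "src C f' = src C f" "tgt C f' = tgt C f" "arr C g" "src C g = tgt C f"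
  shows "g \<bullet> (f \<boxplus> f') = g \<bullet> f \<boxplus> g \<bullet> f'"
  using assms arrow_of_arr[OF assms(1), THEN arrow_mem] arrow_of_arr[OF assms(2), THEN arrow_mem]
    arrow_of_arr[OF assms(5), THEN arrow_mem]
    comp_add_right[of "src C f" "tgt C f" "tgt C g" f f' g]
  by (simp add: cadd_def)

lemma add_comp [simp]:
  assumes "arr C g" "arr C g'" "src C g' = src C g" "tgt C g' = tgt C g" "arr C f" "src C g = tgt C f"
  shows "(g \<boxplus> g') \<bullet> f = g \<bullet> f \<boxplus> g' \<bullet> f"
  using assms arrow_of_arr[OF assms(1), THEN arrow_mem] arrow_of_arr[OF assms(2), THEN arrow_mem]
    arrow_of_arr[OF assms(5), THEN arrow_mem]
    comp_add_left[of "src C f" "tgt C f" "tgt C g" f g g']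
  by (simp add: cadd_def)

lemma add_self_zero:
  assumes "arr C f" "f \<boxplus> f = f" shows "f = zero_mor (src C f) (tgt C f)"
  using assms neg_add_cancel[of f f] by simp

lemma comp_zero [simp]:
  assumes "arr C g" "src C g = B" "A \<in> Ob C" shows "g \<bullet> zero_mor A B = zero_mor A (tgt C g)"
proof -
  have B: "B \<in> Ob C" using assms by auto
  then show ?thesis
    using assms add_self_zero[of "g \<bullet> zero_mor A B"] comp_add[of "zero_mor A B" "zero_mor A B" g]
    by (simp del: comp_add)
qed

lemma zero_comp [simp]:
  assumes "arr C f" "tgt C f = B" "D \<in> Ob C" shows "zero_mor B D \<bullet> f = zero_mor (src C f) D"
proof -
  have B: "B \<in> Ob C" using assms by auto
  then show ?thesis
    using assms add_self_zero[of "zero_mor B D \<bullet> f"] add_comp[of "zero_mor B D" "zero_mor B D" f]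
    by (simp del: add_comp)
qed

lemma neg_comp [simp]:
  assumes "arr C f" "arr C g" "src C g = tgt C f" shows "(\<boxminus> g) \<bullet> f = \<boxminus> (g \<bullet> f)"
  using assms add_eq_zero[of "g \<bullet> f" "(\<boxminus> g) \<bullet> f"] add_comp[of g "\<boxminus> g" f]
  by (simp del: add_comp)

lemma comp_neg [simp]:
  assumes "arr C f" "arr C g" "src C g = tgt C f" shows "g \<bullet> (\<boxminus> f) = \<boxminus> (g \<bullet> f)"
  using assms add_eq_zero[of "g \<bullet> f" "g \<bullet> (\<boxminus> f)"] comp_add[of f "\<boxminus> f" g]
  by (simp del: comp_add)

text \<open>Composites are normalised by bracketing to the right, which hides the subterm
  \<open>a b\<close> inside \<open>a b x\<close>. Applied with \<open>THEN\<close>, this makes a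
  known equation usable in the middle of a longer composite.\<close>

lemma comp_reassoc:
  assumes "a \<bullet> b = c" "arr C a" "arr C b" "src C a = tgt C b" "arr C x" "tgt C x = src C b"
  shows "a \<bullet> b \<bullet> x = c \<bullet> x"
  using assms assoc[of x b a] by simp

section \<open>Isomorphisms and the opposite category\<close>

lemma is_iso_iff:
  assumes "A \<in> Ob C" "B \<in> Ob C"
  shows "is_iso C A B f \<longleftrightarrow> arrow C A B f \<and>
    (\<exists>g. arrow C B A g \<and> g \<bullet> f = ident C A \<and> f \<bullet> g = ident C B)"
  unfolding is_iso_def using assms by (auto simp: Mor_iff)

lemma is_isoI:
  assumes "arrow C A B f" "arrow C B A g" "g \<bullet> f = ident C A" "f \<bullet> g = ident C B"
  shows "is_iso C A B f"
  using assms is_iso_iff[of A B f] by auto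

lemma is_isoE:
  assumes "is_iso C A B f" "A \<in> Ob C" "B \<in> Ob C"
  obtains g where "arrow C A B f" "arrow C B A g" "g \<bullet> f = ident C A" "f \<bullet> g = ident C B"
  using assms is_iso_iff by blast

lemma is_iso_of_one_sided:
  assumes "arrow C A B f" "arrow C B A g" "arrow C B A h"
    "g \<bullet> f = ident C A" "f \<bullet> h = ident C B"
  shows "is_iso C A B f"
proof -
  have "g = g \<bullet> (f \<bullet> h)" using assms by simp
  also have "\<dots> = h" using comp_reassoc[OF assms(4), of h] assms(1-3) by simp
  finally show ?thesis using assms by (intro is_isoI[of _ _ _ g]) auto
qed

text \<open>If \<open>p\<close> inverts \<open>g f\<close> and \<open>q\<close> inverts
  \<open>f g\<close>, then \<open>p g\<close> is a left and \<open>g q\<close> a right inverse of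
  \<open>f\<close>.\<close>

lemma is_iso_of_iso_comps:
  assumes "arrow C A B f" "arrow C B A g" "is_iso C A A (g \<bullet> f)" "is_iso C B B (f \<bullet> g)"
  shows "is_iso C A B f"
proof -
  have ob: "A \<in> Ob C" "B \<in> Ob C" using assms by auto
  obtain p where p: "arrow C A A p" "p \<bullet> (g \<bullet> f) = ident C A"
    using is_isoE[OF assms(3) ob(1) ob(1)] by metis
  obtain q where q: "arrow C B B q" "(f \<bullet> g) \<bullet> q = ident C B"
    using is_isoE[OF assms(4) ob(2) ob(2)] by metis
  show ?thesis
    by (rule is_iso_of_one_sided[of _ _ _ "p \<bullet> g" "g \<bullet> q"]) (use assms p q in auto)
qed

lemma is_iso_ident: "A \<in> Ob C \<Longrightarrow> is_iso C A A (ident C A)"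
  by (rule is_isoI[of _ _ _ "ident C A"]) auto

text \<open>If \<open>n\<close> squares to zero, then \<open>1 + n\<close> has the inverse
  \<open>1 - n\<close>. Every five lemma below is reduced to this.\<close>

lemma is_iso_unipotent:
  assumes "arrow C A A c" "n = c \<boxplus> \<boxminus> ident C A" "n \<bullet> n = zero_mor A A"
  shows "is_iso C A A c"
proof -
  have n: "arr C n" "src C n = A" "tgt C n = A" "A \<in> Ob C" using assms by auto
  have c: "c = ident C A \<boxplus> n" using assms diff_eq_iff[of c "ident C A" n] by auto
  show ?thesis
    unfolding c
    by (rule is_isoI[of _ _ _ "ident C A \<boxplus> \<boxminus> n"])
       (use n assms(3) in \<open>simp_all add: add_assoc\<close>)
qed

lemma linear_category_op: "linear_category K (op_cat C)"
proof (rule linear_category.intro, goal_cases)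
  case 1 show ?case by (rule base_field)
next
  case (2 A B) then show ?case using Hom_module by (simp add: op_cat_def)
next
  case (3 A B A' B' f) then show ?case using Mor_disjoint[of B A B' A' f] by (simp add: op_cat_def)
next
  case (4 A) then show ?case using ident_mor by (simp add: op_cat_def)
next
  case (5 A B D f g) then show ?case using comp_mor[of D B A g f] by (simp add: op_cat_def)
next
  case (6 A B f) then show ?case using ident_comp[of B A f] by (simp add: op_cat_def)
next
  case (7 A B f) then show ?case using comp_ident[of B A f] by (simp add: op_cat_def)
next
  case (8 A B D E f g h) then show ?case using comp_assoc[of E D B A h g f] by (simp add: op_cat_def)
next
  case (9 A B D f g g') then show ?case using comp_add_right[of D B A g g' f] by (simp add: op_cat_def)
next
  case (10 A B D f g g') then show ?case using comp_add_left[of D B A g' f g] by (simp add: op_cat_def)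
next
  case (11 A B D k f g) then show ?case using comp_smult_right[of D B A k g f] by (simp add: op_cat_def)
next
  case (12 A B D k f g) then show ?case using comp_smult_left[of D B A k g f] by (simp add: op_cat_def)
qed

end

lemma op_cat_simps [simp]:
  "Ob (op_cat C) = Ob C" "Hom (op_cat C) A B = Hom C B A" "ident (op_cat C) = ident C"
  "g \<cdot>\<^bsub>op_cat C\<^esub> f = f \<cdot>\<^bsub>C\<^esub> g"
  by (simp_all add: op_cat_def)

lemma op_op_cat [simp]: "op_cat (op_cat (C :: ('o, 'm, 'k) lincat)) = C"
  by (simp add: op_cat_def)

lemma op_cat_typing [simp]:
  "src (op_cat C) f = tgt C f" "tgt (op_cat C) f = src C f" "arr (op_cat C) f = arr C f"
  "arrow (op_cat C) A B f = arrow C B A f"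
  by (auto simp: src_def tgt_def arr_def arrow_def)

lemma op_cat_add [simp]: "f \<uplus>\<^bsub>op_cat C\<^esub> g = f \<uplus>\<^bsub>C\<^esub> g" "\<sim>\<^bsub>op_cat C\<^esub> f = \<sim>\<^bsub>C\<^esub> f"
  by (simp_all add: cadd_def cneg_def)

lemma is_iso_op [simp]: "is_iso (op_cat C) A B f \<longleftrightarrow> is_iso C B A f"
  by (auto simp: is_iso_def)

lemma isomorphic_op [simp]: "isomorphic (op_cat C) A B \<longleftrightarrow> isomorphic C B A"
  by (auto simp: isomorphic_def)

lemma direct_sum_op_imp: "direct_sum C n B A \<Longrightarrow> direct_sum (op_cat C) n B A"
  unfolding direct_sum_def
  by (simp add: op_cat_def, elim conjE exE, rule_tac x = proj in exI, rule_tac x = inj in exI) auto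

lemma direct_sum_op [simp]: "direct_sum (op_cat C) n B A \<longleftrightarrow> direct_sum C n B A"
  using direct_sum_op_imp[of C n B A] direct_sum_op_imp[of "op_cat C" n B A] by auto

lemma (in additive_category) additive_category_op: "additive_category K (op_cat C)"
proof -
  interpret op: linear_category K "op_cat C" by (rule linear_category_op)
  show ?thesis by unfold_locales (simp add: direct_sums)
qed

section \<open>Quotients by the ideal of morphisms factoring through a subcategory\<close>

text \<open>The binary case of \<open>direct_sum\<close> with its four structure maps named.
  Exchanging injections and projections preserves the equations, so the notion is self-dual.\<close>

definition biproduct ::
    "('o, 'm, 'k) lincat \<Rightarrow> 'o \<Rightarrow> 'o \<Rightarrow> 'o \<Rightarrow> 'm \<Rightarrow> 'm \<Rightarrow> 'm \<Rightarrow> 'm \<Rightarrow> bool" where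
  "biproduct C M A B i p j q \<longleftrightarrow>
     arrow C A M i \<and> arrow C M A p \<and> arrow C B M j \<and> arrow C M B q \<and>
     p \<cdot>\<^bsub>C\<^esub> i = ident C A \<and> q \<cdot>\<^bsub>C\<^esub> j = ident C B \<and>
     q \<cdot>\<^bsub>C\<^esub> i = czero C A B \<and> p \<cdot>\<^bsub>C\<^esub> j = czero C B A \<and>
     i \<cdot>\<^bsub>C\<^esub> p \<uplus>\<^bsub>C\<^esub> j \<cdot>\<^bsub>C\<^esub> q = ident C M"

lemma biproduct_op [simp]: "biproduct (op_cat C) M A B i p j q \<longleftrightarrow> biproduct C M A B p i q j"
  by (auto simp: biproduct_def)

lemma full_subcat_simps [simp]:
  "Ob (full_subcat C S) = S" "Hom (full_subcat C S) = Hom C" "ident (full_subcat C S) = ident C"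
  "g \<cdot>\<^bsub>full_subcat C S\<^esub> f = g \<cdot>\<^bsub>C\<^esub> f"
  by (simp_all add: full_subcat_def)

lemma direct_sum_full:
  "S \<subseteq> Ob C \<Longrightarrow> direct_sum (full_subcat C S) n B A \<longleftrightarrow>
    direct_sum C n B A \<and> A \<in> S \<and> (\<forall>j<n. B j \<in> S)"
  unfolding direct_sum_def by auto

lemma isomorphic_sym: "isomorphic C A B \<Longrightarrow> isomorphic C B A"
  unfolding isomorphic_def is_iso_def by blast

lemma subcategory_op: "subcategory C S \<Longrightarrow> subcategory (op_cat C) S"
  using isomorphic_sym[of C] unfolding subcategory_def isomorphic_op direct_sum_op op_cat_simps
  by metis

lemma subcategory_direct_sum:
  assumes "subcategory C S" "direct_sum C n B A" "\<And>j. j < n \<Longrightarrow> B j \<in> S" shows "A \<in> S"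
  using assms(1)[unfolded subcategory_def, THEN conjunct2, THEN conjunct2, THEN conjunct1,
      rule_format, of n B A] assms(2,3) by blast

lemma op_full_subcat: "full_subcat (op_cat C) S = op_cat (full_subcat C S)"
  by (simp add: full_subcat_def op_cat_def)

lemma (in linear_category) biproduct_of_direct_sum:
  assumes "direct_sum C 2 B M" shows "\<exists>i p j q. biproduct C M (B 0) (B 1) i p j q"
proof -
  obtain inj proj where *:
    "M \<in> Ob C" "\<And>j. j < 2 \<Longrightarrow> B j \<in> Ob C"
    "\<And>j. j < 2 \<Longrightarrow> inj j \<in> Mor C (B j) M \<and> proj j \<in> Mor C M (B j)"
    "\<And>j. j < 2 \<Longrightarrow> proj j \<bullet> inj j = ident C (B j)"
    "\<And>i j. i < 2 \<Longrightarrow> j < 2 \<Longrightarrow> i \<noteq> j \<Longrightarrow> proj i \<bullet> inj j = zero_mor (B j) (B i)"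
    "finsum (Hom C M M) (\<lambda>j. inj j \<bullet> proj j) {..<2} = ident C M"
    using assms unfolding direct_sum_def by (elim conjE exE) blast
  interpret H: abelian_group "Hom C M M" using Hom_abelian *(1) by blast
  have 01: "(0::nat) < 2" "(1::nat) < 2" by simp_all
  have t: "arrow C (B 0) M (inj 0)" "arrow C M (B 0) (proj 0)"
    "arrow C (B 1) M (inj 1)" "arrow C M (B 1) (proj 1)"
    using *(1) *(2)[OF 01(1)] *(2)[OF 01(2)] *(3)[OF 01(1)] *(3)[OF 01(2)]
    by (simp_all add: arrow_def del: arrow_iff)
  have m: "inj 0 \<bullet> proj 0 \<in> Mor C M M" "inj 1 \<bullet> proj 1 \<in> Mor C M M"
    using t by (simp_all add: Mor_iff)
  have "finsum (Hom C M M) (\<lambda>j. inj j \<bullet> proj j) {..<2} = inj 0 \<bullet> proj 0 \<oplus>\<^bsub>Hom C M M\<^esub> inj 1 \<bullet> proj 1"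
  proof -
    have "{..<2} = insert 0 (insert (1::nat) {})" by auto
    then show ?thesis using m H.finsum_insert[of "{1::nat}" 0 "\<lambda>j. inj j \<bullet> proj j"]
        H.finsum_insert[of "{}" "1::nat" "\<lambda>j. inj j \<bullet> proj j"] by simp
  qed
  then have "inj 0 \<bullet> proj 0 \<boxplus> inj 1 \<bullet> proj 1 = ident C M"
    using *(6) m *(1) by (simp add: add_eq)
  then show ?thesis
    unfolding biproduct_def using t *(4)[OF 01(1)] *(4)[OF 01(2)]
      *(5)[OF 01] *(5)[OF 01(2) 01(1)] by (metis zero_neq_one)
qed

lemma (in linear_category) biproduct_simps:
  assumes "biproduct C M A B i p j q"
  shows "A \<in> Ob C" "B \<in> Ob C" "M \<in> Ob C" "arr C i" "arr C p" "arr C j" "arr C q"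
    "src C i = A" "tgt C i = M" "src C p = M" "tgt C p = A"
    "src C j = B" "tgt C j = M" "src C q = M" "tgt C q = B"
    "p \<bullet> i = ident C A" "q \<bullet> j = ident C B" "q \<bullet> i = zero_mor A B" "p \<bullet> j = zero_mor B A"
    "\<And>x. \<lbrakk>arr C x; tgt C x = A\<rbrakk> \<Longrightarrow> p \<bullet> i \<bullet> x = x"
    "\<And>x. \<lbrakk>arr C x; tgt C x = B\<rbrakk> \<Longrightarrow> q \<bullet> j \<bullet> x = x"
    "\<And>x. \<lbrakk>arr C x; tgt C x = A\<rbrakk> \<Longrightarrow> q \<bullet> i \<bullet> x = zero_mor (src C x) B"
    "\<And>x. \<lbrakk>arr C x; tgt C x = B\<rbrakk> \<Longrightarrow> p \<bullet> j \<bullet> x = zero_mor (src C x) A"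
proof -
  show t: "A \<in> Ob C" "B \<in> Ob C" "M \<in> Ob C" "arr C i" "arr C p" "arr C j" "arr C q"
    "src C i = A" "tgt C i = M" "src C p = M" "tgt C p = A"
    "src C j = B" "tgt C j = M" "src C q = M" "tgt C q = B"
    and e: "p \<bullet> i = ident C A" "q \<bullet> j = ident C B" "q \<bullet> i = zero_mor A B" "p \<bullet> j = zero_mor B A"
    using assms unfolding biproduct_def by simp_all
  show "\<And>x. \<lbrakk>arr C x; tgt C x = A\<rbrakk> \<Longrightarrow> p \<bullet> i \<bullet> x = x"
    "\<And>x. \<lbrakk>arr C x; tgt C x = B\<rbrakk> \<Longrightarrow> q \<bullet> j \<bullet> x = x"
    "\<And>x. \<lbrakk>arr C x; tgt C x = A\<rbrakk> \<Longrightarrow> q \<bullet> i \<bullet> x = zero_mor (src C x) B"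
    "\<And>x. \<lbrakk>arr C x; tgt C x = B\<rbrakk> \<Longrightarrow> p \<bullet> j \<bullet> x = zero_mor (src C x) A"
    using t by (simp_all add: e[THEN comp_reassoc])
qed

locale ideal_quotient = additive_category K C
  for K :: "'k ring" and C :: "('o, 'm, 'k) lincat" +
  fixes \<A> \<X> :: "'o set"
  assumes A_subcategory: "subcategory C \<A>"
    and X_subcategory: "subcategory (full_subcat C \<A>) \<X>"
begin

lemma A_Ob [simp]: "A \<in> \<A> \<Longrightarrow> A \<in> Ob C"
  using A_subcategory unfolding subcategory_def by blast

lemma X_A [simp]: "A \<in> \<X> \<Longrightarrow> A \<in> \<A>"
  using X_subcategory unfolding subcategory_def full_subcat_simps by blast

lemma A_biproduct:
  assumes "A \<in> \<A>" "B \<in> \<A>" obtains M i p j q where "M \<in> \<A>" "biproduct C M A B i p j q"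
proof -
  obtain M where M: "direct_sum C 2 (\<lambda>k. if k = 0 then A else B) M"
    using direct_sums[of 2 "\<lambda>k. if k = 0 then A else B"] assms by auto
  then have "M \<in> \<A>"
    using subcategory_direct_sum[OF A_subcategory] assms by simp
  then show thesis using biproduct_of_direct_sum[OF M] that by auto
qed

lemma X_biproduct:
  assumes "A \<in> \<X>" "B \<in> \<X>" obtains M i p j q where "M \<in> \<X>" "biproduct C M A B i p j q"
proof -
  let ?B = "\<lambda>k::nat. if k = 0 then A else B"
  obtain M where M: "direct_sum C 2 ?B M"
    using direct_sums[of 2 ?B] assms by auto
  then have "M \<in> \<A>"
    using subcategory_direct_sum[OF A_subcategory] assms by simp
  then have "direct_sum (full_subcat C \<A>) 2 ?B M"
    using M assms by (subst direct_sum_full) auto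
  then have "M \<in> \<X>"
    using subcategory_direct_sum[OF X_subcategory] assms by simp
  then show thesis using biproduct_of_direct_sum[OF M] that by auto
qed

text \<open>The empty direct sum belongs to \<open>\<X>\<close>; this makes zero morphisms factor
  through \<open>\<X>\<close>.\<close>

lemma X_nonempty: obtains Z where "Z \<in> \<X>"
proof -
  obtain M where M: "direct_sum C 0 (\<lambda>_. undefined) M" using direct_sums[of 0] by blast
  then have "M \<in> \<A>"
    using subcategory_direct_sum[OF A_subcategory] by simp
  then have "direct_sum (full_subcat C \<A>) 0 (\<lambda>_. undefined) M"
    using M by (subst direct_sum_full) auto
  then have "M \<in> \<X>"
    using subcategory_direct_sum[OF X_subcategory] by simp
  then show thesis by (rule that)
qed

section \<open>The ideal of morphisms that factor through \<open>\<X>\<close>, and congruence modulo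
  it\<close>

definition null :: "'m \<Rightarrow> bool" where
  "null f \<longleftrightarrow> (\<exists>u v. arr C u \<and> arr C v \<and> tgt C u \<in> \<X> \<and> src C v = tgt C u \<and> f = v \<bullet> u)"

definition eqv :: "'m \<Rightarrow> 'm \<Rightarrow> bool" where
  "eqv f g \<longleftrightarrow> arr C f \<and> arr C g \<and> src C f = src C g \<and> tgt C f = tgt C g \<and> null (f \<boxplus> \<boxminus> g)"

lemma nullI: "\<lbrakk>arr C u; arr C v; tgt C u \<in> \<X>; src C v = tgt C u\<rbrakk> \<Longrightarrow> null (v \<bullet> u)"
  unfolding null_def by blast

lemma null_arr: "null f \<Longrightarrow> arr C f"
  unfolding null_def by auto

lemma null_comp_right:
  assumes "null f" "arr C g" "src C f = tgt C g" shows "null (f \<bullet> g)"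
proof -
  obtain u v where uv: "arr C u" "arr C v" "tgt C u \<in> \<X>" "src C v = tgt C u" "f = v \<bullet> u"
    using assms unfolding null_def by blast
  then have "null (v \<bullet> u \<bullet> g)" using assms by (intro nullI) simp_all
  then show ?thesis using uv assms by simp
qed

lemma null_comp_left:
  assumes "null f" "arr C g" "src C g = tgt C f" shows "null (g \<bullet> f)"
proof -
  obtain u v where uv: "arr C u" "arr C v" "tgt C u \<in> \<X>" "src C v = tgt C u" "f = v \<bullet> u"
    using assms unfolding null_def by blast
  then have "null ((g \<bullet> v) \<bullet> u)" using assms by (intro nullI) simp_all
  then show ?thesis using uv assms by simp
qed

lemma null_zero: assumes "A \<in> Ob C" "B \<in> Ob C" shows "null (zero_mor A B)"
proof -
  obtain Z where "Z \<in> \<X>" using X_nonempty .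
  then have "null (zero_mor Z B \<bullet> zero_mor A Z)" using assms by (intro nullI) simp_all
  then show ?thesis using \<open>Z \<in> \<X>\<close> assms by simp
qed

lemma null_neg: assumes "null f" shows "null (\<boxminus> f)"
proof -
  have f: "arr C f" using assms null_arr by simp
  then have "\<boxminus> f = (\<boxminus> ident C (tgt C f)) \<bullet> f" by simp
  then show ?thesis using null_comp_left[OF assms, of "\<boxminus> ident C (tgt C f)"] f by simp
qed

text \<open>A sum of morphisms through two objects of \<open>\<X>\<close> factors through their
  biproduct, which is again in \<open>\<X>\<close>.\<close>

lemma null_add:
  assumes "null f" "null g" "src C g = src C f" "tgt C g = tgt C f" shows "null (f \<boxplus> g)"
proof -
  obtain u v where uv: "arr C u" "arr C v" "tgt C u \<in> \<X>" "src C v = tgt C u" "f = v \<bullet> u"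
    using assms unfolding null_def by blast
  obtain u' v' where uv': "arr C u'" "arr C v'" "tgt C u' \<in> \<X>" "src C v' = tgt C u'" "g = v' \<bullet> u'"
    using assms unfolding null_def by blast
  obtain M i p j q where M: "M \<in> \<X>" "biproduct C M (tgt C u) (tgt C u') i p j q"
    using X_biproduct uv(3) uv'(3) by metis
  have st: "src C u' = src C u" "tgt C v' = tgt C v" using assms uv uv' by simp_all
  have "(v \<bullet> p \<boxplus> v' \<bullet> q) \<bullet> (i \<bullet> u \<boxplus> j \<bullet> u') = f \<boxplus> g"
    using uv uv' st by (simp add: biproduct_simps[OF M(2)])
  moreover have "null ((v \<bullet> p \<boxplus> v' \<bullet> q) \<bullet> (i \<bullet> u \<boxplus> j \<bullet> u'))"
    using uv uv' st M(1) by (intro nullI) (simp_all add: biproduct_simps[OF M(2)])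
  ultimately show ?thesis by simp
qed

lemma eqvD:
  assumes "eqv f g"
  shows "arr C f" "arr C g" "src C f = src C g" "tgt C f = tgt C g" "null (f \<boxplus> \<boxminus> g)"
  using assms unfolding eqv_def by simp_all

lemma eqv_refl: "arr C f \<Longrightarrow> eqv f f"
  unfolding eqv_def by (simp add: null_zero)

lemma eqv_sym: assumes "eqv f g" shows "eqv g f"
proof -
  note f = eqvD[OF assms]
  have "null (\<boxminus> (f \<boxplus> \<boxminus> g))" using null_neg f(5) .
  moreover have "\<boxminus> (f \<boxplus> \<boxminus> g) = g \<boxplus> \<boxminus> f" using f(1-4) add_commute[of "\<boxminus> f" g] by simp
  ultimately show ?thesis using f unfolding eqv_def by simp
qed

lemma eqv_trans: assumes "eqv f g" "eqv g h" shows "eqv f h"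
proof -
  note f = eqvD[OF assms(1)] and g = eqvD[OF assms(2)]
  have "null ((f \<boxplus> \<boxminus> g) \<boxplus> (g \<boxplus> \<boxminus> h))" using f(1-4) g(1-4) by (intro null_add[OF f(5) g(5)]) simp_all
  moreover have "(f \<boxplus> \<boxminus> g) \<boxplus> (g \<boxplus> \<boxminus> h) = f \<boxplus> \<boxminus> h"
    using f(1-4) g(1-4) by (simp add: add_assoc)
  ultimately show ?thesis using f g unfolding eqv_def by simp
qed

lemma eqv_add:
  assumes "eqv f f'" "eqv g g'" "src C g = src C f" "tgt C g = tgt C f"
  shows "eqv (f \<boxplus> g) (f' \<boxplus> g')"
proof -
  note f = eqvD[OF assms(1)] and g = eqvD[OF assms(2)]
  have t: "src C f = src C f'" "tgt C f = tgt C f'" "src C g = src C f'" "tgt C g = tgt C f'"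
     "src C g' = src C f'" "tgt C g' = tgt C f'"
    using f g assms by simp_all
  have "null ((f \<boxplus> \<boxminus> f') \<boxplus> (g \<boxplus> \<boxminus> g'))"
    using f(1,2) g(1,2) t by (intro null_add[OF f(5) g(5)]) simp_all
  moreover have "(f \<boxplus> \<boxminus> f') \<boxplus> (g \<boxplus> \<boxminus> g') = (f \<boxplus> g) \<boxplus> \<boxminus> (f' \<boxplus> g')"
    using f(1,2) g(1,2) t by (simp add: add_ac)
  ultimately show ?thesis using f(1,2) g(1,2) t unfolding eqv_def by simp
qed

lemma eqv_comp:
  assumes "eqv f f'" "eqv g g'" "src C g = tgt C f" shows "eqv (g \<bullet> f) (g' \<bullet> f')"
proof -
  note f = eqvD[OF assms(1)] and g = eqvD[OF assms(2)]
  have t: "src C f = src C f'" "tgt C f = tgt C f'" "src C g = tgt C f'" "tgt C g = tgt C g'"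
     "src C g' = tgt C f'"
    using f g assms by simp_all
  have 1: "null (g \<bullet> (f \<boxplus> \<boxminus> f'))" using f(5) f(1,2) g(1,2) t by (intro null_comp_left) simp_all
  have 2: "null ((g \<boxplus> \<boxminus> g') \<bullet> f')" using g(5) f(1,2) g(1,2) t by (intro null_comp_right) simp_all
  have "null (g \<bullet> (f \<boxplus> \<boxminus> f') \<boxplus> (g \<boxplus> \<boxminus> g') \<bullet> f')"
    using null_add[OF 1 2] f(1,2) g(1,2) t by simp
  moreover have "g \<bullet> (f \<boxplus> \<boxminus> f') \<boxplus> (g \<boxplus> \<boxminus> g') \<bullet> f' = g \<bullet> f \<boxplus> \<boxminus> (g' \<bullet> f')"
    using f(1,2) g(1,2) t by (simp add: add_assoc)
  ultimately show ?thesis using f(1,2) g(1,2) t unfolding eqv_def by simp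
qed

lemma eqv_of_null_sum:
  assumes "arr C f" "null n" "src C n = src C f" "tgt C n = tgt C f" shows "eqv (f \<boxplus> n) f"
proof -
  have "eqv n (zero_mor (src C f) (tgt C f))"
    using assms null_arr[OF assms(2)] unfolding eqv_def by simp
  then show ?thesis
    using eqv_add[OF eqv_refl[OF assms(1)], of n "zero_mor (src C f) (tgt C f)"] assms
      null_arr[OF assms(2)] by simp
qed

lemma eqv_zero_iff:
  assumes "arr C f" "src C f = A" "tgt C f = B" shows "eqv f (zero_mor A B) \<longleftrightarrow> null f"
proof -
  have "A \<in> Ob C" "B \<in> Ob C" using assms by auto
  then show ?thesis using assms unfolding eqv_def by simp
qed

subsection \<open>Classes\<close>

abbreviation cls :: "'m \<Rightarrow> 'm set" where "cls \<equiv> mor_class C \<X>"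
abbreviation D :: "('o, 'm set, 'k) lincat" where "D \<equiv> subfactor C \<A> \<X>"

lemma factoring_eq:
  assumes "A \<in> Ob C" "B \<in> Ob C"
  shows "factoring C \<X> A B = {f. null f \<and> src C f = A \<and> tgt C f = B}"
proof -
  have "(\<exists>u v X. f = v \<bullet> u \<and> X \<in> \<X> \<and> u \<in> Mor C A X \<and> v \<in> Mor C X B) \<longleftrightarrow>
      null f \<and> src C f = A \<and> tgt C f = B" for f
  proof
    assume "\<exists>u v X. f = v \<bullet> u \<and> X \<in> \<X> \<and> u \<in> Mor C A X \<and> v \<in> Mor C X B"
    then obtain u v X where uv: "f = v \<bullet> u" "X \<in> \<X>" "u \<in> Mor C A X" "v \<in> Mor C X B" by blast
    then have "arrow C A X u" "arrow C X B v" using assms by (auto intro: arrowI simp del: arrow_iff)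
    then show "null f \<and> src C f = A \<and> tgt C f = B" using uv(1,2) by (auto intro: nullI)
  next
    assume "null f \<and> src C f = A \<and> tgt C f = B"
    then obtain u v where uv: "arr C u" "arr C v" "tgt C u \<in> \<X>" "src C v = tgt C u" "f = v \<bullet> u"
        "src C f = A" "tgt C f = B"
      unfolding null_def by blast
    then have "src C u = A" "tgt C v = B" by simp_all
    then have "u \<in> Mor C A (tgt C u)" "v \<in> Mor C (tgt C u) B"
      using uv(1-4) assms by (simp_all add: Mor_iff)
    then show "\<exists>u v X. f = v \<bullet> u \<and> X \<in> \<X> \<and> u \<in> Mor C A X \<and> v \<in> Mor C X B" using uv by blast
  qed
  then show ?thesis unfolding factoring_def by blast
qed

lemma coset_eq:
  assumes "arr C f" "src C f = A" "tgt C f = B"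
  shows "factoring C \<X> A B +>\<^bsub>Hom C A B\<^esub> f = {h. eqv h f}"
proof -
  have ob: "A \<in> Ob C" "B \<in> Ob C" using assms by auto
  have "factoring C \<X> A B +>\<^bsub>Hom C A B\<^esub> f = (\<lambda>n. n \<oplus>\<^bsub>Hom C A B\<^esub> f) ` factoring C \<X> A B"
    unfolding a_r_coset_def' by auto
  also have "\<dots> = (\<lambda>n. n \<boxplus> f) ` {n. null n \<and> src C n = A \<and> tgt C n = B}"
    using ob null_arr by (intro image_cong factoring_eq) (auto simp: Mor_iff intro!: add_eq)
  also have "\<dots> = {h. eqv h f}"
  proof (intro Set.set_eqI iffI)
    fix h assume "h \<in> (\<lambda>n. n \<boxplus> f) ` {n. null n \<and> src C n = A \<and> tgt C n = B}"
    then obtain n where n: "null n" "src C n = A" "tgt C n = B" "h = n \<boxplus> f" by blast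
    then show "h \<in> {h. eqv h f}"
      using eqv_of_null_sum[of f n] add_commute[of n f] assms null_arr[OF n(1)] by simp
  next
    fix h assume "h \<in> {h. eqv h f}"
    then have h: "eqv h f" by simp
    note h' = eqvD[OF h]
    have "h = (h \<boxplus> \<boxminus> f) \<boxplus> f" using h'(1-4) by (simp add: add_assoc)
    moreover have "null (h \<boxplus> \<boxminus> f)" "src C (h \<boxplus> \<boxminus> f) = A" "tgt C (h \<boxplus> \<boxminus> f) = B"
      using h' assms by simp_all
    ultimately show "h \<in> (\<lambda>n. n \<boxplus> f) ` {n. null n \<and> src C n = A \<and> tgt C n = B}" by blast
  qed
  finally show ?thesis .
qed

lemma cls_eq: assumes "arr C f" shows "cls f = {h. eqv h f}"
proof -
  have "{factoring C \<X> A B +>\<^bsub>Hom C A B\<^esub> f | A B. A \<in> Ob C \<and> B \<in> Ob C \<and> f \<in> Mor C A B} =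
      {factoring C \<X> (src C f) (tgt C f) +>\<^bsub>Hom C (src C f) (tgt C f)\<^esub> f}"
  proof -
    have "A \<in> Ob C \<and> B \<in> Ob C \<and> f \<in> Mor C A B \<longleftrightarrow> A = src C f \<and> B = tgt C f" for A B
      using assms arrow_of_arr[OF assms, THEN arrow_mem] by (auto simp: Mor_iff)
    then show ?thesis by simp
  qed
  then show ?thesis unfolding mor_class_def using coset_eq[OF assms refl refl] by simp
qed

lemma cls_iff: assumes "arr C f" "arr C g" shows "cls f = cls g \<longleftrightarrow> eqv f g"
  unfolding cls_eq[OF assms(1)] cls_eq[OF assms(2)]
  using eqv_refl assms eqv_sym eqv_trans by blast

lemma cls_cong: "eqv f g \<Longrightarrow> cls f = cls g"
  using cls_iff eqvD(1,2) by blast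

lemma mem_cls: "arr C f \<Longrightarrow> f \<in> cls f"
  by (simp add: cls_eq eqv_refl)

text \<open>The operations of the quotient are unions over representatives. Once all representatives
  give the same value, the union collapses to it.\<close>

lemma Union_cls:
  assumes "arr C f" "\<And>h. eqv h f \<Longrightarrow> \<phi> h = S" shows "(\<Union>h \<in> cls f. \<phi> h) = S"
  using assms eqv_refl by (auto simp: cls_eq)

lemma D_Ob [simp]: "Ob D = \<A>"
  by (simp add: subfactor_def)

lemma D_Mor:
  assumes "A \<in> Ob C" "B \<in> Ob C" shows "Mor D A B = cls ` {f. arrow C A B f}"
  using coset_eq cls_eq assms
  by (auto simp: subfactor_def A_RCOSETS_def' image_iff Mor_iff)

lemma D_comp:
  assumes "arr C f" "arr C g" "src C g = tgt C f" shows "cls g \<cdot>\<^bsub>D\<^esub> cls f = cls (g \<bullet> f)"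
proof -
  have "cls (g' \<bullet> f') = cls (g \<bullet> f)" if "eqv g' g" "eqv f' f" for g' f'
    using that eqv_comp[OF that(2,1)] assms eqvD(3)[OF that(1)] eqvD(4)[OF that(2)]
    by (intro cls_cong) simp
  then show ?thesis
    using assms by (simp add: subfactor_def Union_cls[where S = "cls (g \<bullet> f)"])
qed

lemma D_ident: "ident D A = cls (ident C A)"
  by (simp add: subfactor_def)

lemma D_zero:
  assumes "A \<in> Ob C" "B \<in> Ob C" shows "czero D A B = cls (zero_mor A B)"
proof -
  have "czero D A B = factoring C \<X> A B" by (simp add: subfactor_def)
  then show ?thesis using assms factoring_eq[OF assms] eqv_zero_iff eqvD null_arr
    by (auto simp: cls_eq) (metis eqvD src_zero tgt_zero)+
qed

lemma D_plus:
  assumes "A \<in> Ob C" "B \<in> Ob C" "arrow C A B f" "arrow C A B g"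
  shows "cls f \<oplus>\<^bsub>Hom D A B\<^esub> cls g = cls (f \<boxplus> g)"
proof -
  have "cls f \<oplus>\<^bsub>Hom D A B\<^esub> cls g = (\<Union>h \<in> cls f. \<Union>k \<in> cls g. {h \<oplus>\<^bsub>Hom C A B\<^esub> k})"
    by (simp add: subfactor_def set_add_def')
  also have "\<dots> = {h \<boxplus> k |h k. eqv h f \<and> eqv k g}"
  proof -
    have "h \<oplus>\<^bsub>Hom C A B\<^esub> k = h \<boxplus> k" if "eqv h f" for h k
      using that assms eqvD[OF that] by (intro add_eq) (simp_all add: Mor_iff)
    then show ?thesis using assms by (auto simp: cls_eq)
  qed
  also have "\<dots> = {h. eqv h (f \<boxplus> g)}"
  proof (intro Set.set_eqI iffI)
    fix x assume "x \<in> {h \<boxplus> k |h k. eqv h f \<and> eqv k g}"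
    then obtain h k where hk: "eqv h f" "eqv k g" "x = h \<boxplus> k" by blast
    then show "x \<in> {h. eqv h (f \<boxplus> g)}"
      using eqv_add[OF hk(1,2)] eqvD[OF hk(1)] eqvD[OF hk(2)] assms by simp
  next
    fix x assume "x \<in> {h. eqv h (f \<boxplus> g)}"
    then have x: "eqv x (f \<boxplus> g)" by simp
    have t: "arr C x" "src C x = A" "tgt C x = B" using eqvD[OF x] assms by simp_all
    \<comment> \<open>Any \<open>x\<close> congruent to \<open>f + g\<close> splits as
      \<open>(x - g) + g\<close>. Hence the elementwise sum of two classes is a full class and not
      merely contained in one.\<close>
    have "eqv (x \<boxplus> \<boxminus> g) ((f \<boxplus> g) \<boxplus> \<boxminus> g)"
      using assms t by (intro eqv_add x eqv_refl) simp_all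
    moreover have "(f \<boxplus> g) \<boxplus> \<boxminus> g = f" using assms by (simp add: add_assoc)
    moreover have "x = (x \<boxplus> \<boxminus> g) \<boxplus> g" using assms t by (simp add: add_assoc)
    ultimately show "x \<in> {h \<boxplus> k |h k. eqv h f \<and> eqv k g}" using eqv_refl assms by fastforce
  qed
  also have "\<dots> = cls (f \<boxplus> g)" using assms by (simp add: cls_eq)
  finally show ?thesis .
qed

lemma smult_typed:
  assumes "arrow C A B f" "k \<in> carrier K" shows "arrow C A B (k \<odot>\<^bsub>Hom C A B\<^esub> f)"
proof -
  have ob: "A \<in> Ob C" "B \<in> Ob C" using assms by auto
  interpret module K "Hom C A B" using Hom_module ob by blast
  show ?thesis using ob assms arrow_mem[OF assms(1)] by (intro arrowI) simp_all
qed

lemma smult_neg: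
  assumes "arrow C A B f" "k \<in> carrier K"
  shows "k \<odot>\<^bsub>Hom C A B\<^esub> \<boxminus> f = \<boxminus> (k \<odot>\<^bsub>Hom C A B\<^esub> f)"
proof -
  have ob: "A \<in> Ob C" "B \<in> Ob C" using assms by auto
  interpret module K "Hom C A B" using Hom_module ob by blast
  show ?thesis using smult_r_minus[of k f] assms arrow_mem[OF assms(1)] ob
      arrow_mem[OF smult_typed[OF assms]] by (simp add: neg_eq)
qed

lemma smult_add:
  assumes "arrow C A B f" "arrow C A B g" "k \<in> carrier K"
  shows "k \<odot>\<^bsub>Hom C A B\<^esub> (f \<boxplus> g) = k \<odot>\<^bsub>Hom C A B\<^esub> f \<boxplus> k \<odot>\<^bsub>Hom C A B\<^esub> g"
proof -
  have ob: "A \<in> Ob C" "B \<in> Ob C" using assms by auto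
  interpret module K "Hom C A B" using Hom_module ob by blast
  show ?thesis using smult_r_distr[of k f g] assms(3) arrow_mem[OF assms(1)] arrow_mem[OF assms(2)] ob
      arrow_mem[OF smult_typed[OF assms(1,3)]] by (simp add: add_eq)
qed

lemma null_smult:
  assumes "null f" "arrow C A B f" "k \<in> carrier K" shows "null (k \<odot>\<^bsub>Hom C A B\<^esub> f)"
proof -
  obtain u v where uv: "arr C u" "arr C v" "tgt C u \<in> \<X>" "src C v = tgt C u" "f = v \<bullet> u"
    using assms unfolding null_def by blast
  have st: "src C u = A" "tgt C v = B" using assms uv by auto
  let ?u = "k \<odot>\<^bsub>Hom C A (tgt C u)\<^esub> u"
  have u: "arrow C A (tgt C u) u" using uv st by auto
  have "k \<odot>\<^bsub>Hom C A B\<^esub> f = v \<bullet> ?u"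
    using comp_smult_right[of A "tgt C u" B k u v] assms uv st arrow_of_arr[THEN arrow_mem, of u]
      arrow_of_arr[THEN arrow_mem, of v] by simp
  moreover have "null (v \<bullet> ?u)" using uv smult_typed[OF u assms(3)] by (intro nullI) simp_all
  ultimately show ?thesis by simp
qed

lemma D_smult:
  assumes "arrow C A B f" "k \<in> carrier K"
  shows "k \<odot>\<^bsub>Hom D A B\<^esub> cls f = cls (k \<odot>\<^bsub>Hom C A B\<^esub> f)"
proof -
  have "cls (k \<odot>\<^bsub>Hom C A B\<^esub> h) = cls (k \<odot>\<^bsub>Hom C A B\<^esub> f)" if "eqv h f" for h
  proof -
    note h = eqvD[OF that]
    have hA: "arrow C A B h" using h assms by simp
    have "null (k \<odot>\<^bsub>Hom C A B\<^esub> (h \<boxplus> \<boxminus> f))" using h assms by (intro null_smult) simp_all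
    then have "null (k \<odot>\<^bsub>Hom C A B\<^esub> h \<boxplus> \<boxminus> (k \<odot>\<^bsub>Hom C A B\<^esub> f))"
      using smult_add[OF hA, of "\<boxminus> f" k] smult_neg[OF assms] assms by simp
    then show ?thesis
      using smult_typed[OF hA assms(2)] smult_typed[OF assms] by (intro cls_cong) (simp add: eqv_def)
  qed
  then show ?thesis using assms by (simp add: subfactor_def Union_cls[where S = "cls (k \<odot>\<^bsub>Hom C A B\<^esub> f)"])
qed

lemma D_MorE:
  assumes "F \<in> Mor D A B" "A \<in> Ob C" "B \<in> Ob C" obtains f where "arrow C A B f" "F = cls f"
  using assms D_Mor by blast

lemma D_MorI: "arrow C A B f \<Longrightarrow> cls f \<in> Mor D A B"
  using D_Mor[of A B] by auto

lemma D_Hom_abelian: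
  assumes "A \<in> Ob C" "B \<in> Ob C" shows "abelian_group (Hom D A B)"
proof -
  note pl = D_plus[OF assms]
  have rep: "\<exists>f. arrow C A B f \<and> x = cls f" if "x \<in> Mor D A B" for x
    using that D_MorE assms by metis
  show ?thesis
  proof (rule abelian_groupI)
    fix x y assume "x \<in> Mor D A B" "y \<in> Mor D A B"
    then obtain f g where f: "arrow C A B f" "x = cls f" and g: "arrow C A B g" "y = cls g"
      using rep by metis
    show "x \<oplus>\<^bsub>Hom D A B\<^esub> y \<in> Mor D A B" using f g pl[OF f(1) g(1)] by (auto intro: D_MorI)
    show "x \<oplus>\<^bsub>Hom D A B\<^esub> y = y \<oplus>\<^bsub>Hom D A B\<^esub> x"
      using f g pl[OF f(1) g(1)] pl[OF g(1) f(1)] add_commute[of f g] by simp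
  next
    show "\<zero>\<^bsub>Hom D A B\<^esub> \<in> Mor D A B" using assms by (auto simp: D_zero intro: D_MorI)
  next
    fix x assume "x \<in> Mor D A B"
    then obtain f where f: "arrow C A B f" "x = cls f" using rep by metis
    show "\<zero>\<^bsub>Hom D A B\<^esub> \<oplus>\<^bsub>Hom D A B\<^esub> x = x" using assms f by (simp add: D_zero pl)
    show "\<exists>y \<in> Mor D A B. y \<oplus>\<^bsub>Hom D A B\<^esub> x = \<zero>\<^bsub>Hom D A B\<^esub>"
      using assms f by (intro bexI[of _ "cls (\<boxminus> f)"] D_MorI) (simp_all add: D_zero pl)
  next
    fix x y z assume "x \<in> Mor D A B" "y \<in> Mor D A B" "z \<in> Mor D A B"
    then obtain f g h where "arrow C A B f" "x = cls f" "arrow C A B g" "y = cls g"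
        "arrow C A B h" "z = cls h"
      using rep by metis
    then show "x \<oplus>\<^bsub>Hom D A B\<^esub> y \<oplus>\<^bsub>Hom D A B\<^esub> z = x \<oplus>\<^bsub>Hom D A B\<^esub> (y \<oplus>\<^bsub>Hom D A B\<^esub> z)"
      by (simp add: pl add_assoc)
  qed
qed

lemma D_Hom_module:
  assumes "A \<in> Ob C" "B \<in> Ob C" shows "module K (Hom D A B)"
proof -
  interpret M: module K "Hom C A B" using Hom_module assms by blast
  note pl = D_plus[OF assms] and ob = assms
  show ?thesis
  proof (rule moduleI)
    show "cring K" by (rule module.axioms(1)[OF Hom_module[OF assms]])
    show "abelian_group (Hom D A B)" using D_Hom_abelian assms by blast
  next
    fix a b x assume a: "a \<in> carrier K" and b: "b \<in> carrier K" and "x \<in> Mor D A B"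
    then obtain f where f: "arrow C A B f" "x = cls f" using D_MorE ob by metis
    note sf = smult_typed[OF f(1)]
    show "a \<odot>\<^bsub>Hom D A B\<^esub> x \<in> Mor D A B"
      unfolding f(2) D_smult[OF f(1) a] using sf[OF a] by (rule D_MorI)
    show "(a \<oplus>\<^bsub>K\<^esub> b) \<odot>\<^bsub>Hom D A B\<^esub> x = a \<odot>\<^bsub>Hom D A B\<^esub> x \<oplus>\<^bsub>Hom D A B\<^esub> b \<odot>\<^bsub>Hom D A B\<^esub> x"
      using a b M.smult_l_distr[OF a b arrow_mem[OF f(1)]] add_eq[OF ob arrow_mem[OF sf[OF a]]]
      unfolding f(2) by (simp add: D_smult[OF f(1)] pl[OF sf[OF a] sf[OF b]])
    show "(a \<otimes>\<^bsub>K\<^esub> b) \<odot>\<^bsub>Hom D A B\<^esub> x = a \<odot>\<^bsub>Hom D A B\<^esub> (b \<odot>\<^bsub>Hom D A B\<^esub> x)"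
      using a b M.smult_assoc1[OF a b arrow_mem[OF f(1)]]
      unfolding f(2) by (simp add: D_smult[OF f(1)] D_smult[OF sf[OF b]])
  next
    fix a x y assume a: "a \<in> carrier K" and "x \<in> Mor D A B" "y \<in> Mor D A B"
    then obtain f g where f: "arrow C A B f" "x = cls f" and g: "arrow C A B g" "y = cls g"
      using D_MorE ob by metis
    have fg: "arrow C A B (f \<boxplus> g)" using f g by simp
    show "a \<odot>\<^bsub>Hom D A B\<^esub> (x \<oplus>\<^bsub>Hom D A B\<^esub> y) = a \<odot>\<^bsub>Hom D A B\<^esub> x \<oplus>\<^bsub>Hom D A B\<^esub> a \<odot>\<^bsub>Hom D A B\<^esub> y"
      unfolding f(2) g(2) pl[OF f(1) g(1)] D_smult[OF f(1) a] D_smult[OF g(1) a]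
        pl[OF smult_typed[OF f(1) a] smult_typed[OF g(1) a]] D_smult[OF fg a]
      by (simp only: smult_add[OF f(1) g(1) a])
  next
    fix x assume "x \<in> Mor D A B"
    then obtain f where f: "arrow C A B f" "x = cls f" using D_MorE ob by metis
    show "\<one>\<^bsub>K\<^esub> \<odot>\<^bsub>Hom D A B\<^esub> x = x"
      unfolding f(2) D_smult[OF f(1) M.R.one_closed] M.smult_one[OF arrow_mem[OF f(1)]] ..
  qed
qed

lemma linear_category_D: "linear_category K D"
proof (rule linear_category.intro, goal_cases)
  case 1 show ?case by (rule base_field)
next
  case (2 A B) then show ?case using D_Hom_module by simp
next
  case (3 A B A' B' F)
  then have ob: "A \<in> Ob C" "B \<in> Ob C" "A' \<in> Ob C" "B' \<in> Ob C" by simp_all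
  obtain f where f: "arrow C A B f" "F = cls f" using D_MorE[OF 3(5) ob(1,2)] .
  obtain g where g: "arrow C A' B' g" "F = cls g" using D_MorE[OF 3(6) ob(3,4)] .
  have "eqv f g" using f g cls_iff[of f g] by simp
  then show ?case using eqvD f g by force
next
  case (4 A) then show ?case by (auto simp: D_ident intro: D_MorI)
next
  case (5 A B E F G)
  then obtain f g where f: "arrow C A B f" "F = cls f" and g: "arrow C B E g" "G = cls g"
    by (metis D_MorE D_Ob A_Ob)
  then show ?case by (auto simp: D_comp intro: D_MorI)
next
  case (6 A B F)
  then obtain f where "arrow C A B f" "F = cls f" by (metis D_MorE D_Ob A_Ob)
  then show ?case by (simp add: D_comp D_ident)
next
  case (7 A B F)
  then obtain f where "arrow C A B f" "F = cls f" by (metis D_MorE D_Ob A_Ob)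
  then show ?case by (simp add: D_comp D_ident)
next
  case (8 A B E E' F G H)
  then obtain f g h where "arrow C A B f" "F = cls f" "arrow C B E g" "G = cls g"
     "arrow C E E' h" "H = cls h"
    by (metis D_MorE D_Ob A_Ob)
  then show ?case by (simp add: D_comp)
next
  case (9 A B E F G G')
  then obtain f g g' where "arrow C A B f" "F = cls f" "arrow C B E g" "G = cls g"
     "arrow C B E g'" "G' = cls g'"
    by (metis D_MorE D_Ob A_Ob)
  then show ?case by (simp add: D_comp D_plus)
next
  case (10 A B E F F' G)
  then obtain f f' g where "arrow C A B f" "F = cls f" "arrow C B E g" "G = cls g"
     "arrow C A B f'" "F' = cls f'"
    by (metis D_MorE D_Ob A_Ob)
  then show ?case by (simp add: D_comp D_plus)
next
  case (11 A B E k F G)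
  then have ob: "A \<in> Ob C" "B \<in> Ob C" "E \<in> Ob C" and k: "k \<in> carrier K" by simp_all
  obtain f where f: "arrow C A B f" "F = cls f" using D_MorE[OF 11(5) ob(1,2)] .
  obtain g where g: "arrow C B E g" "G = cls g" using D_MorE[OF 11(6) ob(2,3)] .
  have gf: "arrow C A E (g \<bullet> f)" using f g by simp
  have "(k \<odot>\<^bsub>Hom C B E\<^esub> g) \<bullet> f = k \<odot>\<^bsub>Hom C A E\<^esub> (g \<bullet> f)"
    using comp_smult_left ob k f g arrow_mem by blast
  then show ?case
    unfolding f(2) g(2) D_smult[OF g(1) k] using smult_typed[OF g(1) k] f g D_smult[OF gf k]
    by (simp add: D_comp)
next
  case (12 A B E k F G)
  then have ob: "A \<in> Ob C" "B \<in> Ob C" "E \<in> Ob C" and k: "k \<in> carrier K" by simp_all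
  obtain f where f: "arrow C A B f" "F = cls f" using D_MorE[OF 12(5) ob(1,2)] .
  obtain g where g: "arrow C B E g" "G = cls g" using D_MorE[OF 12(6) ob(2,3)] .
  have gf: "arrow C A E (g \<bullet> f)" using f g by simp
  have "g \<bullet> (k \<odot>\<^bsub>Hom C A B\<^esub> f) = k \<odot>\<^bsub>Hom C A E\<^esub> (g \<bullet> f)"
    using comp_smult_right ob k f g arrow_mem by blast
  then show ?case
    unfolding f(2) g(2) D_smult[OF f(1) k] using smult_typed[OF f(1) k] f g D_smult[OF gf k]
    by (simp add: D_comp)
qed

text \<open>Direct sums are defined by a \<open>finsum\<close> of composites, so taking classes has
  to commute with finite sums before direct sums can be carried over.\<close>

lemma finsum_cls:
  assumes "finite S" "A \<in> Ob C" "B \<in> Ob C" "\<And>j. j \<in> S \<Longrightarrow> arrow C A B (\<phi> j)"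
  shows "finsum (Hom D A B) (\<lambda>j. cls (\<phi> j)) S = cls (finsum (Hom C A B) \<phi> S)"
  using assms(1,4)
proof (induction S)
  case empty
  interpret H: abelian_group "Hom C A B" using Hom_abelian assms(2,3) by blast
  interpret D: abelian_group "Hom D A B" using D_Hom_abelian assms(2,3) by blast
  show ?case using assms(2,3) by (simp add: D_zero)
next
  case (insert x S)
  interpret H: abelian_group "Hom C A B" using Hom_abelian assms(2,3) by blast
  interpret D: abelian_group "Hom D A B" using D_Hom_abelian assms(2,3) by blast
  have m: "\<phi> \<in> S \<rightarrow> Mor C A B" "\<phi> x \<in> Mor C A B" using insert.prems arrow_mem by blast+
  have m': "(\<lambda>j. cls (\<phi> j)) \<in> S \<rightarrow> Mor D A B" "cls (\<phi> x) \<in> Mor D A B"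
    using D_MorI[OF insert.prems] by auto
  have t: "arrow C A B (finsum (Hom C A B) \<phi> S)" using H.finsum_closed[OF m(1)] assms(2,3) by (intro arrowI)
  show ?case
    using insert.hyps insert.IH insert.prems D.finsum_insert[OF insert.hyps m'] assms(2,3) t m
    by (simp add: D_plus add_eq)
qed

text \<open>Being a direct sum is a list of equations between morphisms, and these persist for
  classes. The sum formed in \<open>C\<close> lies in \<open>\<A>\<close> because
  \<open>\<A>\<close> is a subcategory.\<close>

lemma additive_category_D: "additive_category K D"
proof (intro additive_category.intro additive_category_axioms.intro linear_category_D)
  fix n :: nat and B assume B: "\<forall>j<n. B j \<in> Ob D"
  obtain M where M: "direct_sum C n B M" using direct_sums[of n B] B by auto
  then have MA: "M \<in> \<A>"
    using subcategory_direct_sum[OF A_subcategory] B by simp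
  obtain inj proj where *:
    "\<And>j. j < n \<Longrightarrow> inj j \<in> Mor C (B j) M \<and> proj j \<in> Mor C M (B j)"
    "\<And>j. j < n \<Longrightarrow> proj j \<bullet> inj j = ident C (B j)"
    "\<And>i j. i < n \<Longrightarrow> j < n \<Longrightarrow> i \<noteq> j \<Longrightarrow> proj i \<bullet> inj j = zero_mor (B j) (B i)"
    "finsum (Hom C M M) (\<lambda>j. inj j \<bullet> proj j) {..<n} = ident C M"
    using M unfolding direct_sum_def by (elim conjE exE) blast
  have t: "arrow C (B j) M (inj j)" "arrow C M (B j) (proj j)" if "j < n" for j
    using *(1)[OF that] MA B that by (auto intro: arrowI simp del: arrow_iff)
  have "finsum (Hom D M M) (\<lambda>j. cls (inj j) \<cdot>\<^bsub>D\<^esub> cls (proj j)) {..<n} =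
      finsum (Hom D M M) (\<lambda>j. cls (inj j \<bullet> proj j)) {..<n}"
  proof -
    interpret Dm: abelian_group "Hom D M M" using D_Hom_abelian MA by simp
    show ?thesis using t MA by (intro Dm.finsum_cong') (auto simp: D_comp intro!: D_MorI)
  qed
  also have "\<dots> = cls (ident C M)" using t MA *(4) by (subst finsum_cls) auto
  finally have "finsum (Hom D M M) (\<lambda>j. cls (inj j) \<cdot>\<^bsub>D\<^esub> cls (proj j)) {..<n} = ident D M"
    by (simp add: D_ident)
  then have "direct_sum D n B M"
    unfolding direct_sum_def using t MA B *(2,3)
    by (intro conjI exI[of _ "\<lambda>j. cls (inj j)"] exI[of _ "\<lambda>j. cls (proj j)"])
       (auto simp: D_comp D_ident D_zero intro!: D_MorI)
  then show "\<exists>M. direct_sum D n B M" ..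
qed

end

lemma factoring_op: "factoring (op_cat C) \<X> A B = factoring C \<X> B A"
  unfolding factoring_def by auto

lemma mor_class_op: "mor_class (op_cat C) \<X> = mor_class C \<X>"
  unfolding mor_class_def factoring_op op_cat_simps by (intro ext arg_cong[of _ _ Union]) blast

text \<open>The two unions in the composition can be taken in either order, so this is an equality
  of records. Results proved for the opposite category can therefore be rewritten literally into
  results about the quotient itself.\<close>

lemma subfactor_op: "op_cat (subfactor C \<A> \<X>) = subfactor (op_cat C) \<A> \<X>"
proof -
  have "(\<Union>g\<in>G. \<Union>f\<in>F. mor_class C \<X> (g \<cdot>\<^bsub>C\<^esub> f)) = (\<Union>f\<in>F. \<Union>g\<in>G. mor_class C \<X> (g \<cdot>\<^bsub>C\<^esub> f))"
    for G F by blast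
  then show ?thesis
    unfolding subfactor_def op_cat_def[of "lincat.make _ _ _ _"] mor_class_op factoring_op
    by (simp add: op_cat_def[of "\<lparr>Ob = _, Hom = _, ident = _, Comp = _\<rparr>"] fun_eq_iff)
qed

lemma (in ideal_quotient) ideal_quotient_op: "ideal_quotient K (op_cat C) \<A> \<X>"
proof -
  interpret op: additive_category K "op_cat C" by (rule additive_category_op)
  show ?thesis
    by unfold_locales (simp_all add: op_full_subcat subcategory_op A_subcategory X_subcategory)
qed

section \<open>Sextuples up to isomorphism\<close>

text \<open>Unlike the universal property, the equation \<open>ident = 0\<close> is visibly
  preserved by additive functors.\<close>

lemma (in linear_category) zero_object_iff:
  "zero_object C Z \<longleftrightarrow> Z \<in> Ob C \<and> ident C Z = zero_mor Z Z"
proof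
  assume z: "zero_object C Z"
  then have Z: "Z \<in> Ob C" and u: "\<exists>!f. f \<in> Mor C Z Z" unfolding zero_object_def by auto
  have "ident C Z \<in> Mor C Z Z" "zero_mor Z Z \<in> Mor C Z Z" using Z by (simp_all add: Mor_iff)
  then show "Z \<in> Ob C \<and> ident C Z = zero_mor Z Z" using Z u by blast
next
  assume z: "Z \<in> Ob C \<and> ident C Z = zero_mor Z Z"
  have "f = zero_mor Z A" if "arrow C Z A f" for A f
  proof -
    have "f = f \<bullet> ident C Z" using that by simp
    also have "\<dots> = zero_mor Z A" using z that by simp
    finally show ?thesis .
  qed
  moreover have "f = zero_mor A Z" if "arrow C A Z f" for A f
  proof -
    have "f = ident C Z \<bullet> f" using that by simp
    also have "\<dots> = zero_mor A Z" using z that by simp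
    finally show ?thesis .
  qed
  ultimately show "zero_object C Z"
    unfolding zero_object_def using z arrowI arrow_mem[OF zero_typed] by blast
qed

lemma (in linear_category) zero_object_mor:
  assumes "zero_object C Z"
  shows "arrow C Z A f \<Longrightarrow> f = zero_mor Z A" "arrow C A Z f \<Longrightarrow> f = zero_mor A Z"
  using assms arrow_mem zero_typed unfolding zero_object_def by (metis arrow_def)+

lemma (in additive_category) zero_object_ex: obtains Z where "zero_object C Z"
proof -
  obtain Z where Z: "direct_sum C 0 (\<lambda>_. undefined) Z" using direct_sums[of 0] by blast
  then have Zo: "Z \<in> Ob C" unfolding direct_sum_def by blast
  interpret H: abelian_group "Hom C Z Z" using Zo Hom_abelian by blast
  have "ident C Z = zero_mor Z Z" using Z unfolding direct_sum_def by auto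
  then have "zero_object C Z" using Zo by (simp add: zero_object_iff)
  then show thesis by (rule that)
qed

locale endo_category = additive_category K C
  for K :: "'k ring" and C :: "('o, 'm, 'k) lincat" +
  fixes F :: "('o, 'm) endofunctor"
  assumes additive_F: "additive_endofunctor C F"
begin

lemma F_typed: assumes "arr C f" shows "arrow C (Fob F (src C f)) (Fob F (tgt C f)) (Fmor F f)"
  using additive_F arrow_of_arr[OF assms] unfolding additive_endofunctor_def arrow_def by blast

lemma F_arr [simp]: "arr C f \<Longrightarrow> arr C (Fmor F f)"
  and F_src [simp]: "arr C f \<Longrightarrow> src C (Fmor F f) = Fob F (src C f)"
  and F_tgt [simp]: "arr C f \<Longrightarrow> tgt C (Fmor F f) = Fob F (tgt C f)"
  using F_typed by simp_all

lemma F_Ob [simp]: "A \<in> Ob C \<Longrightarrow> Fob F A \<in> Ob C"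
  and F_ident [simp]: "A \<in> Ob C \<Longrightarrow> Fmor F (ident C A) = ident C (Fob F A)"
  using additive_F unfolding additive_endofunctor_def by blast+

lemma F_comp:
  assumes "arr C f" "arr C g" "src C g = tgt C f" shows "Fmor F (g \<bullet> f) = Fmor F g \<bullet> Fmor F f"
  using additive_F arrow_of_arr[OF assms(1)] arrow_of_arr[OF assms(2)] assms(3)
  unfolding additive_endofunctor_def arrow_def by metis

lemma F_add:
  assumes "arr C f" "arr C g" "src C g = src C f" "tgt C g = tgt C f"
  shows "Fmor F (f \<boxplus> g) = Fmor F f \<boxplus> Fmor F g"
proof -
  have "f \<in> Mor C (src C f) (tgt C f)" "g \<in> Mor C (src C f) (tgt C f)"
    using arrow_of_arr[OF assms(1)] arrow_of_arr[OF assms(2)] assms(3,4) unfolding arrow_def by simp_all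
  then show ?thesis
    using additive_F assms unfolding additive_endofunctor_def cadd_def by simp
qed

lemma F_zero [simp]:
  assumes "A \<in> Ob C" "B \<in> Ob C" shows "Fmor F (zero_mor A B) = zero_mor (Fob F A) (Fob F B)"
  using add_self_zero[of "Fmor F (zero_mor A B)"] F_add[of "zero_mor A B" "zero_mor A B"] assms by simp

lemma F_neg: assumes "arr C f" shows "Fmor F (\<boxminus> f) = \<boxminus> Fmor F f"
  using add_eq_zero[of "Fmor F f" "Fmor F (\<boxminus> f)"] F_add[of f "\<boxminus> f"] assms by simp

lemma F_square:
  assumes "b \<bullet> f = f' \<bullet> a" "arr C f" "arr C a" "arr C f'" "arr C b" "src C b = tgt C f" "src C f' = tgt C a"
  shows "Fmor F b \<bullet> Fmor F f = Fmor F f' \<bullet> Fmor F a"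
  using arg_cong[OF assms(1), of "Fmor F"] assms(2-) by (simp add: F_comp)

lemma is_sextuple_iff:
  "is_sextuple C F (Sext A B D f g h) \<longleftrightarrow> arrow C A B f \<and> arrow C B D g \<and> arrow C D (Fob F A) h"
  unfolding is_sextuple_def arrow_def by auto

lemma sext_morphism_iff:
  assumes "is_sextuple C F (Sext A B D f g h)" "is_sextuple C F (Sext A' B' D' f' g' h')"
  shows "sext_morphism C F (Sext A B D f g h) (Sext A' B' D' f' g' h') a b c \<longleftrightarrow>
    arrow C A A' a \<and> arrow C B B' b \<and> arrow C D D' c \<and>
    b \<bullet> f = f' \<bullet> a \<and> c \<bullet> g = g' \<bullet> b \<and> Fmor F a \<bullet> h = h' \<bullet> c"
  using assms unfolding sext_morphism_def is_sextuple_def arrow_def by simp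

text \<open>Compose the square with \<open>b'\<close> on the left and \<open>a'\<close> on the
  right.\<close>

lemma square_inverse:
  assumes "b \<bullet> f = f' \<bullet> a" "a \<bullet> a' = ident C (src C a')" "b' \<bullet> b = ident C (src C b)"
    "arr C f" "arr C f'" "arr C a" "arr C a'" "arr C b" "arr C b'"
    "src C b = tgt C f" "src C a = src C f" "src C f' = tgt C a" "tgt C b = tgt C f'"
    "src C a' = tgt C a" "tgt C a' = src C a" "src C b' = tgt C b" "tgt C b' = src C b"
  shows "f \<bullet> a' = b' \<bullet> f'"
proof -
  have "f \<bullet> a' = (b' \<bullet> b) \<bullet> f \<bullet> a'" unfolding assms(3) using assms(4-) by simp
  also have "\<dots> = b' \<bullet> (b \<bullet> f) \<bullet> a'" using assms(4-) by simp
  also have "\<dots> = b' \<bullet> f' \<bullet> (a \<bullet> a')" unfolding assms(1) using assms(4-) by simp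
  also have "\<dots> = b' \<bullet> f'" unfolding assms(2) using assms(4-) by simp
  finally show ?thesis .
qed

lemma sext_isomorphicI:
  assumes "is_sextuple C F (Sext A B D f g h)" "is_sextuple C F (Sext A' B' D' f' g' h')"
    "is_iso C A A' a" "is_iso C B B' b" "is_iso C D D' c"
    "b \<bullet> f = f' \<bullet> a" "c \<bullet> g = g' \<bullet> b" "Fmor F a \<bullet> h = h' \<bullet> c"
  shows "sext_isomorphic C F (Sext A B D f g h) (Sext A' B' D' f' g' h')"
proof -
  have "sext_morphism C F (Sext A B D f g h) (Sext A' B' D' f' g' h') a b c"
    using assms unfolding sext_morphism_iff[OF assms(1,2)] is_sextuple_def
    by (simp add: is_iso_iff del: arrow_iff)
  then show ?thesis using assms unfolding sext_isomorphic_def by auto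
qed

lemma sext_isomorphicE:
  assumes "sext_isomorphic C F (Sext A B D f g h) (Sext A' B' D' f' g' h')"
  obtains a b c a' b' c' where
    "is_sextuple C F (Sext A B D f g h)" "is_sextuple C F (Sext A' B' D' f' g' h')"
    "arrow C A A' a" "arrow C A' A a'" "a' \<bullet> a = ident C A" "a \<bullet> a' = ident C A'"
    "arrow C B B' b" "arrow C B' B b'" "b' \<bullet> b = ident C B" "b \<bullet> b' = ident C B'"
    "arrow C D D' c" "arrow C D' D c'" "c' \<bullet> c = ident C D" "c \<bullet> c' = ident C D'"
    "b \<bullet> f = f' \<bullet> a" "c \<bullet> g = g' \<bullet> b" "Fmor F a \<bullet> h = h' \<bullet> c"
    "f \<bullet> a' = b' \<bullet> f'" "g \<bullet> b' = c' \<bullet> g'" "h \<bullet> c' = Fmor F a' \<bullet> h'"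
proof -
  have s: "is_sextuple C F (Sext A B D f g h)" "is_sextuple C F (Sext A' B' D' f' g' h')"
    using assms unfolding sext_isomorphic_def by simp_all
  then have ob: "A \<in> Ob C" "B \<in> Ob C" "D \<in> Ob C" "A' \<in> Ob C" "B' \<in> Ob C" "D' \<in> Ob C"
    by (simp_all add: is_sextuple_iff)
  obtain a b c where i: "is_iso C A A' a" "is_iso C B B' b" "is_iso C D D' c"
    and m: "sext_morphism C F (Sext A B D f g h) (Sext A' B' D' f' g' h') a b c"
    using assms unfolding sext_isomorphic_def by auto
  obtain a' where a: "arrow C A A' a" "arrow C A' A a'" "a' \<bullet> a = ident C A" "a \<bullet> a' = ident C A'"
    using is_isoE[OF i(1) ob(1,4)] by blast
  obtain b' where b: "arrow C B B' b" "arrow C B' B b'" "b' \<bullet> b = ident C B" "b \<bullet> b' = ident C B'"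
    using is_isoE[OF i(2) ob(2,5)] by blast
  obtain c' where c: "arrow C D D' c" "arrow C D' D c'" "c' \<bullet> c = ident C D" "c \<bullet> c' = ident C D'"
    using is_isoE[OF i(3) ob(3,6)] by blast
  have e: "b \<bullet> f = f' \<bullet> a" "c \<bullet> g = g' \<bullet> b" "Fmor F a \<bullet> h = h' \<bullet> c"
    using m unfolding sext_morphism_iff[OF s] by simp_all
  have Fa: "Fmor F a' \<bullet> Fmor F a = ident C (Fob F A)"
    using arg_cong[OF a(3), of "Fmor F"] a(1,2) ob by (simp add: F_comp)
  have e': "f \<bullet> a' = b' \<bullet> f'" "g \<bullet> b' = c' \<bullet> g'"
    using square_inverse[OF e(1)] square_inverse[OF e(2)] a b c s by (simp_all add: is_sextuple_iff)
  have "h \<bullet> c' = Fmor F a' \<bullet> h'"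
    using square_inverse[OF e(3), of c' "Fmor F a'"] a(1,2) c s Fa by (simp add: is_sextuple_iff)
  then show thesis using that[OF s a b c e e'] by blast
qed

lemma sext_isomorphic_refl: "is_sextuple C F s \<Longrightarrow> sext_isomorphic C F s s"
  by (cases s) (auto intro!: sext_isomorphicI is_iso_ident simp: is_sextuple_iff)

lemma sext_isomorphic_sym:
  assumes "sext_isomorphic C F s t" shows "sext_isomorphic C F t s"
proof (cases s, cases t)
  fix A B D f g h A' B' D' f' g' h'
  assume st: "s = Sext A B D f g h" "t = Sext A' B' D' f' g' h'"
  show ?thesis
    using assms unfolding st
    by (elim sext_isomorphicE, intro sext_isomorphicI) (assumption | rule is_isoI | simp)+
qed

lemma is_iso_comp:
  assumes "is_iso C A B f" "is_iso C B E g" "A \<in> Ob C" "B \<in> Ob C" "E \<in> Ob C"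
  shows "is_iso C A E (g \<bullet> f)"
proof -
  obtain f' where f: "arrow C A B f" "arrow C B A f'" "f' \<bullet> f = ident C A" "f \<bullet> f' = ident C B"
    using is_isoE[OF assms(1,3,4)] by blast
  obtain g' where g: "arrow C B E g" "arrow C E B g'" "g' \<bullet> g = ident C B" "g \<bullet> g' = ident C E"
    using is_isoE[OF assms(2,4,5)] by blast
  show ?thesis
    by (rule is_isoI[of _ _ _ "f' \<bullet> g'"])
       (use f g comp_reassoc[OF g(3)] comp_reassoc[OF f(4)] in auto)
qed

lemma sext_isomorphic_trans:
  assumes "sext_isomorphic C F s t" "sext_isomorphic C F t u" shows "sext_isomorphic C F s u"
proof (cases s, cases t, cases u)
  fix A B D f g h A' B' D' f' g' h' A'' B'' D'' f'' g'' h''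
  assume st: "s = Sext A B D f g h" "t = Sext A' B' D' f' g' h'" "u = Sext A'' B'' D'' f'' g'' h''"
  obtain a b c where 1: "is_sextuple C F s" "is_sextuple C F t"
    "is_iso C A A' a" "is_iso C B B' b" "is_iso C D D' c" "sext_morphism C F s t a b c"
    using assms(1) unfolding sext_isomorphic_def st by auto
  obtain a1 b1 c1 where 2: "is_sextuple C F u"
    "is_iso C A' A'' a1" "is_iso C B' B'' b1" "is_iso C D' D'' c1" "sext_morphism C F t u a1 b1 c1"
    using assms(2) unfolding sext_isomorphic_def st by auto
  note s = 1(1)[unfolded st(1)] and t = 1(2)[unfolded st(2)] and u = 2(1)[unfolded st(3)]
  note m1 = 1(6)[unfolded st sext_morphism_iff[OF s t]] and m2 = 2(5)[unfolded st sext_morphism_iff[OF t u]]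
  have ob: "A \<in> Ob C" "B \<in> Ob C" "D \<in> Ob C" "A' \<in> Ob C" "B' \<in> Ob C" "D' \<in> Ob C"
     "A'' \<in> Ob C" "B'' \<in> Ob C" "D'' \<in> Ob C"
    using s t u by (simp_all add: is_sextuple_iff)
  note e = m1[THEN conjunct2, THEN conjunct2, THEN conjunct2]
    m2[THEN conjunct2, THEN conjunct2, THEN conjunct2]
  show ?thesis
    unfolding st
  proof (rule sext_isomorphicI[OF s u is_iso_comp[OF 1(3) 2(2)] is_iso_comp[OF 1(4) 2(3)]
        is_iso_comp[OF 1(5) 2(4)]])
    have r: "b1 \<bullet> f' \<bullet> a = f'' \<bullet> a1 \<bullet> a" "c1 \<bullet> g' \<bullet> b = g'' \<bullet> b1 \<bullet> b"
      "Fmor F a1 \<bullet> h' \<bullet> c = h'' \<bullet> c1 \<bullet> c"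
      using m1 m2 s t u
        comp_reassoc[of b1 f' "f'' \<bullet> a1" a] comp_reassoc[of c1 g' "g'' \<bullet> b1" b]
        comp_reassoc[of "Fmor F a1" h' "h'' \<bullet> c1" c]
      by (simp_all add: is_sextuple_iff)
    show "(b1 \<bullet> b) \<bullet> f = f'' \<bullet> a1 \<bullet> a" "(c1 \<bullet> c) \<bullet> g = g'' \<bullet> b1 \<bullet> b"
      "Fmor F (a1 \<bullet> a) \<bullet> h = h'' \<bullet> c1 \<bullet> c"
      using m1 m2 s t u r by (simp_all add: is_sextuple_iff F_comp)
  qed (use ob in simp_all)
qed

end

section \<open>Right triangulations generated by a class of sextuples\<close>

definition iso_closure ::
    "('o, 'm, 'k) lincat \<Rightarrow> ('o, 'm) endofunctor \<Rightarrow> ('o, 'm) sextuple set \<Rightarrow> ('o, 'm) sextuple set" where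
  "iso_closure C F G = {t. \<exists>s \<in> G. sext_isomorphic C F s t}"

text \<open>
  The octahedral axiom is only required for one representative of each composable pair of
  morphisms up to isomorphism; the five lemma then transports it to all triangles.
\<close>

locale triangle_base = endo_category K C F
  for K :: "'k ring" and C :: "('o, 'm, 'k) lincat" and F +
  fixes G :: "('o, 'm) sextuple set"
  assumes base_sextuple: "s \<in> G \<Longrightarrow> is_sextuple C F s"
    and base_embed: "arrow C A B f \<Longrightarrow> \<exists>D g h. Sext A B D f g h \<in> iso_closure C F G"
    and base_rotate: "Sext A B D f g h \<in> G \<Longrightarrow>
      Sext B D (Fob F A) g h (\<boxminus> Fmor F f) \<in> iso_closure C F G"
    and base_complete: "\<lbrakk>Sext A B D f g h \<in> G; Sext A' B' D' f' g' h' \<in> G;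
        arrow C A A' a; arrow C B B' b; b \<bullet> f = f' \<bullet> a\<rbrakk>
        \<Longrightarrow> \<exists>c. arrow C D D' c \<and> c \<bullet> g = g' \<bullet> b \<and> Fmor F a \<bullet> h = h' \<bullet> c"
    and base_zero: "\<lbrakk>A \<in> Ob C; zero_object C Z\<rbrakk>
        \<Longrightarrow> Sext Z A A (zero_mor Z A) (ident C A) (zero_mor A (Fob F Z)) \<in> iso_closure C F G"
    and base_octahedral: "\<lbrakk>arrow C A B f; arrow C B X a\<rbrakk> \<Longrightarrow>
        \<exists>B' X' i j a' D g h Y b c Z d e s t.
          is_iso C B B' i \<and> is_iso C X X' j \<and> B' \<in> Ob C \<and> X' \<in> Ob C \<and> arrow C B' X' a' \<and>
          a' \<bullet> i = j \<bullet> a \<and>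
          Sext A B' D (i \<bullet> f) g h \<in> iso_closure C F G \<and>
          Sext B' X' Y a' b c \<in> iso_closure C F G \<and>
          Sext A X' Z (a' \<bullet> i \<bullet> f) d e \<in> iso_closure C F G \<and>
          arrow C D Z s \<and> arrow C Z Y t \<and>
          s \<bullet> g = d \<bullet> a' \<and> e \<bullet> s = h \<and> t \<bullet> d = b \<and> c \<bullet> t = Fmor F (i \<bullet> f) \<bullet> e \<and>
          Sext D Z Y s t (Fmor F g \<bullet> c) \<in> iso_closure C F G"
begin

abbreviation N where "N \<equiv> iso_closure C F G"

lemma N_sextuple: "s \<in> N \<Longrightarrow> is_sextuple C F s"
  unfolding iso_closure_def sext_isomorphic_def by blast

lemma N_iso_closed: "\<lbrakk>s \<in> N; sext_isomorphic C F s t\<rbrakk> \<Longrightarrow> t \<in> N"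
  unfolding iso_closure_def using sext_isomorphic_trans by blast

lemma N_baseE:
  assumes "Sext A B D f g h \<in> N"
  obtains A0 B0 D0 f0 g0 h0 where "Sext A0 B0 D0 f0 g0 h0 \<in> G"
    "sext_isomorphic C F (Sext A0 B0 D0 f0 g0 h0) (Sext A B D f g h)"
proof -
  obtain s where "s \<in> G" "sext_isomorphic C F s (Sext A B D f g h)"
    using assms unfolding iso_closure_def by blast
  then show thesis by (cases s) (auto intro: that)
qed

lemma N_rotate:
  assumes "Sext A B D f g h \<in> N"
  shows "Sext B D (Fob F A) g h (\<boxminus> Fmor F f) \<in> N"
proof -
  obtain A0 B0 D0 f0 g0 h0 where G: "Sext A0 B0 D0 f0 g0 h0 \<in> G"
    and iso: "sext_isomorphic C F (Sext A0 B0 D0 f0 g0 h0) (Sext A B D f g h)"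
    using N_baseE[OF assms] .
  obtain a b c a' b' c' where *:
    "is_sextuple C F (Sext A0 B0 D0 f0 g0 h0)" "is_sextuple C F (Sext A B D f g h)"
    "arrow C A0 A a" "arrow C A A0 a'" "a' \<bullet> a = ident C A0" "a \<bullet> a' = ident C A"
    "arrow C B0 B b" "arrow C B B0 b'" "b' \<bullet> b = ident C B0" "b \<bullet> b' = ident C B"
    "arrow C D0 D c" "arrow C D D0 c'" "c' \<bullet> c = ident C D0" "c \<bullet> c' = ident C D"
    "b \<bullet> f0 = f \<bullet> a" "c \<bullet> g0 = g \<bullet> b" "Fmor F a \<bullet> h0 = h \<bullet> c"
    using iso by (rule sext_isomorphicE)
  have iF: "is_iso C (Fob F A0) (Fob F A) (Fmor F a)"
    using * F_comp[of a a'] F_comp[of a' a] by (intro is_isoI[of _ _ _ "Fmor F a'"]) simp_all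
  have iB: "is_iso C B0 B b" and iD: "is_iso C D0 D c"
    using * by (auto intro: is_isoI[of _ _ _ b'] is_isoI[of _ _ _ c'] simp del: arrow_iff)
  have "Fmor F b \<bullet> \<boxminus> Fmor F f0 = (\<boxminus> Fmor F f) \<bullet> Fmor F a"
    using F_square[OF *(15)] * by (simp add: is_sextuple_iff)
  then have "sext_isomorphic C F (Sext B0 D0 (Fob F A0) g0 h0 (\<boxminus> Fmor F f0))
      (Sext B D (Fob F A) g h (\<boxminus> Fmor F f))"
    using * by (intro sext_isomorphicI[OF _ _ iB iD iF]) (simp_all add: is_sextuple_iff)
  then show ?thesis using base_rotate[OF G] N_iso_closed by blast
qed

text \<open>Conjugate the given square by the isomorphisms to triangles of \<open>G\<close>,
  complete it there, and carry the third component back.\<close>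

lemma N_complete:
  assumes "Sext A B D f g h \<in> N" "Sext A' B' D' f' g' h' \<in> N"
    "arrow C A A' \<alpha>" "arrow C B B' \<beta>" "\<beta> \<bullet> f = f' \<bullet> \<alpha>"
  obtains \<gamma> where "arrow C D D' \<gamma>" "\<gamma> \<bullet> g = g' \<bullet> \<beta>" "Fmor F \<alpha> \<bullet> h = h' \<bullet> \<gamma>"
proof -
  obtain A0 B0 D0 f0 g0 h0 where G0: "Sext A0 B0 D0 f0 g0 h0 \<in> G"
    and iso0: "sext_isomorphic C F (Sext A0 B0 D0 f0 g0 h0) (Sext A B D f g h)"
    using N_baseE[OF assms(1)] .
  obtain A1 B1 D1 f1 g1 h1 where G1: "Sext A1 B1 D1 f1 g1 h1 \<in> G"
    and iso1: "sext_isomorphic C F (Sext A1 B1 D1 f1 g1 h1) (Sext A' B' D' f' g' h')"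
    using N_baseE[OF assms(2)] .
  obtain a b c a' b' c' where s0:
    "is_sextuple C F (Sext A0 B0 D0 f0 g0 h0)" "is_sextuple C F (Sext A B D f g h)"
    and t0: "arrow C A0 A a" "arrow C A A0 a'" and a0: "a' \<bullet> a = ident C A0" "a \<bullet> a' = ident C A"
    and u0: "arrow C B0 B b" "arrow C B B0 b'" and b0: "b' \<bullet> b = ident C B0" "b \<bullet> b' = ident C B"
    and v0: "arrow C D0 D c" "arrow C D D0 c'" and c0: "c' \<bullet> c = ident C D0" "c \<bullet> c' = ident C D"
    and e0: "b \<bullet> f0 = f \<bullet> a" "c \<bullet> g0 = g \<bullet> b" "Fmor F a \<bullet> h0 = h \<bullet> c"
    "f0 \<bullet> a' = b' \<bullet> f" "g0 \<bullet> b' = c' \<bullet> g" "h0 \<bullet> c' = Fmor F a' \<bullet> h"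
    using iso0 by (rule sext_isomorphicE)
  obtain a1 b1 c1 a1' b1' c1' where s1:
    "is_sextuple C F (Sext A1 B1 D1 f1 g1 h1)" "is_sextuple C F (Sext A' B' D' f' g' h')"
    and t1: "arrow C A1 A' a1" "arrow C A' A1 a1'" and a1: "a1' \<bullet> a1 = ident C A1" "a1 \<bullet> a1' = ident C A'"
    and u1: "arrow C B1 B' b1" "arrow C B' B1 b1'" and b1: "b1' \<bullet> b1 = ident C B1" "b1 \<bullet> b1' = ident C B'"
    and v1: "arrow C D1 D' c1" "arrow C D' D1 c1'" and c1: "c1' \<bullet> c1 = ident C D1" "c1 \<bullet> c1' = ident C D'"
    and e1: "b1 \<bullet> f1 = f' \<bullet> a1" "c1 \<bullet> g1 = g' \<bullet> b1" "Fmor F a1 \<bullet> h1 = h' \<bullet> c1"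
    "f1 \<bullet> a1' = b1' \<bullet> f'" "g1 \<bullet> b1' = c1' \<bullet> g'" "h1 \<bullet> c1' = Fmor F a1' \<bullet> h'"
    using iso1 by (rule sext_isomorphicE)
  note T = s0[unfolded is_sextuple_iff] s1[unfolded is_sextuple_iff] t0 u0 v0 t1 u1 v1 assms(3,4)
  have "(b1' \<bullet> \<beta> \<bullet> b) \<bullet> f0 = f1 \<bullet> (a1' \<bullet> \<alpha> \<bullet> a)"
    using T by (simp add: e0(1) assms(5)[THEN comp_reassoc] e1(4)[THEN comp_reassoc])
  moreover have "arrow C A0 A1 (a1' \<bullet> \<alpha> \<bullet> a)" "arrow C B0 B1 (b1' \<bullet> \<beta> \<bullet> b)" using T by simp_all
  ultimately obtain \<gamma>0 where g0: "arrow C D0 D1 \<gamma>0" "\<gamma>0 \<bullet> g0 = g1 \<bullet> (b1' \<bullet> \<beta> \<bullet> b)"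
    "Fmor F (a1' \<bullet> \<alpha> \<bullet> a) \<bullet> h0 = h1 \<bullet> \<gamma>0"
    using base_complete[OF G0 G1] by blast
  have "arrow C D D' (c1 \<bullet> \<gamma>0 \<bullet> c')" using T g0(1) by simp
  moreover have "(c1 \<bullet> \<gamma>0 \<bullet> c') \<bullet> g = g' \<bullet> \<beta>"
  proof -
    have "(c1 \<bullet> \<gamma>0 \<bullet> c') \<bullet> g = c1 \<bullet> (\<gamma>0 \<bullet> g0) \<bullet> b'" using T g0(1) by (simp add: e0(5))
    also have "\<dots> = g' \<bullet> \<beta>" unfolding g0(2)
      using T by (simp add: b0 e1(5)[THEN comp_reassoc] c1[THEN comp_reassoc])
    finally show ?thesis .
  qed
  moreover have "Fmor F \<alpha> \<bullet> h = h' \<bullet> (c1 \<bullet> \<gamma>0 \<bullet> c')"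
  proof -
    have "h' \<bullet> (c1 \<bullet> \<gamma>0 \<bullet> c') = (Fmor F a1 \<bullet> h1) \<bullet> \<gamma>0 \<bullet> c'"
      unfolding e1(3) using T g0(1) by simp
    also have "\<dots> = Fmor F a1 \<bullet> (h1 \<bullet> \<gamma>0) \<bullet> c'" using T g0(1) by simp
    also have "\<dots> = Fmor F a1 \<bullet> Fmor F (a1' \<bullet> \<alpha> \<bullet> a) \<bullet> Fmor F a' \<bullet> h"
      unfolding g0(3)[symmetric] using T by (simp add: e0(6))
    also have "\<dots> = Fmor F (a1 \<bullet> (a1' \<bullet> \<alpha> \<bullet> a) \<bullet> a') \<bullet> h"
      using T by (simp add: F_comp)
    also have "\<dots> = Fmor F \<alpha> \<bullet> h" using T by (simp add: a0 a1[THEN comp_reassoc])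
    finally show ?thesis ..
  qed
  ultimately show thesis by (rule that)
qed

text \<open>The pair \<open>(0, n)\<close> maps the rotated triangle \<open>B -> D -> F A\<close> to
  the trivial triangle \<open>Z -> W -> W\<close>; the third component of a completion is the
  required \<open>l\<close>.\<close>

lemma N_weak_cokernel:
  assumes "Sext A B D f g h \<in> N" "arrow C D W n" "n \<bullet> g = zero_mor B W"
  obtains l where "arrow C (Fob F A) W l" "n = l \<bullet> h"
proof -
  obtain Z where Z: "zero_object C Z" using zero_object_ex .
  have W: "W \<in> Ob C" using assms by simp
  have t: "arrow C B Z (zero_mor B Z)" "Z \<in> Ob C"
    using N_sextuple[OF assms(1)] Z by (simp_all add: is_sextuple_iff zero_object_iff)
  have "n \<bullet> g = zero_mor Z W \<bullet> zero_mor B Z" using assms t W by simp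
  then obtain l where "arrow C (Fob F A) W l" "l \<bullet> h = ident C W \<bullet> n"
    using N_complete[OF N_rotate[OF assms(1)] base_zero[OF W Z] t(1) assms(2)] by metis
  then show thesis using that[of l] assms by simp
qed

text \<open>Put \<open>n = c - 1\<close>. Since \<open>n g = 0\<close>, it has the form
  \<open>l h\<close>, and since \<open>h n = 0\<close>, its square \<open>l h n\<close>
  vanishes.\<close>

lemma N_endo_iso:
  assumes "Sext A B D f g h \<in> N" "arrow C D D c" "c \<bullet> g = g" "h \<bullet> c = h"
  shows "is_iso C D D c"
proof -
  let ?n = "c \<boxplus> \<boxminus> ident C D"
  note s = N_sextuple[OF assms(1), unfolded is_sextuple_iff]
  have "?n \<bullet> g = zero_mor B D" using s assms by simp
  moreover have n: "arrow C D D ?n" using assms by simp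
  ultimately obtain l where l: "arrow C (Fob F A) D l" "?n = l \<bullet> h"
    using N_weak_cokernel[OF assms(1)] by blast
  have "h \<bullet> ?n = zero_mor D (Fob F A)" using s assms by simp
  then have "(l \<bullet> h) \<bullet> ?n = zero_mor D D" using l(1) s n by (simp del: comp_add)
  then show ?thesis using is_iso_unipotent[OF assms(2) refl] l(2) by simp
qed

text \<open>Complete the square of inverses to some \<open>\<gamma>'\<close>. Both composites of
  \<open>\<gamma>\<close> and \<open>\<gamma>'\<close> fix the second and third arrows of their
  triangle, so \<open>N_endo_iso\<close> applies to them.\<close>

lemma N_five:
  assumes "Sext A B D f g h \<in> N" "Sext A' B' D' f' g' h' \<in> N"
    "is_iso C A A' \<alpha>" "is_iso C B B' \<beta>" "arrow C D D' \<gamma>"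
    "\<beta> \<bullet> f = f' \<bullet> \<alpha>" "\<gamma> \<bullet> g = g' \<bullet> \<beta>" "Fmor F \<alpha> \<bullet> h = h' \<bullet> \<gamma>"
  shows "is_iso C D D' \<gamma>"
proof -
  note s = N_sextuple[OF assms(1), unfolded is_sextuple_iff]
    N_sextuple[OF assms(2), unfolded is_sextuple_iff]
  have ob: "A \<in> Ob C" "B \<in> Ob C" "A' \<in> Ob C" "B' \<in> Ob C" using s by simp_all
  obtain \<alpha>' where a: "arrow C A A' \<alpha>" "arrow C A' A \<alpha>'" "\<alpha>' \<bullet> \<alpha> = ident C A" "\<alpha> \<bullet> \<alpha>' = ident C A'"
    using is_isoE[OF assms(3) ob(1,3)] by blast
  obtain \<beta>' where b: "arrow C B B' \<beta>" "arrow C B' B \<beta>'" "\<beta>' \<bullet> \<beta> = ident C B" "\<beta> \<bullet> \<beta>' = ident C B'"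
    using is_isoE[OF assms(4) ob(2,4)] by blast
  have "f \<bullet> \<alpha>' = \<beta>' \<bullet> f'" using square_inverse[OF assms(6)] a b s by simp
  then obtain \<gamma>' where c: "arrow C D' D \<gamma>'" "\<gamma>' \<bullet> g' = g \<bullet> \<beta>'" "Fmor F \<alpha>' \<bullet> h' = h \<bullet> \<gamma>'"
    using N_complete[OF assms(2,1) a(2) b(2)] by metis
  note T = s a(1,2) b(1,2) c(1) assms(5)
  have Fa: "Fmor F \<alpha>' \<bullet> Fmor F \<alpha> = ident C (Fob F A)" "Fmor F \<alpha> \<bullet> Fmor F \<alpha>' = ident C (Fob F A')"
    using F_comp[of \<alpha> \<alpha>'] F_comp[of \<alpha>' \<alpha>] a by simp_all
  have 1: "(\<gamma>' \<bullet> \<gamma>) \<bullet> g = g" "h \<bullet> \<gamma>' \<bullet> \<gamma> = h"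
    using T by (simp_all add: assms(7) c(2)[THEN comp_reassoc] b(3) c(3)[symmetric, THEN comp_reassoc]
        assms(8)[symmetric] Fa[THEN comp_reassoc])
  have 2: "(\<gamma> \<bullet> \<gamma>') \<bullet> g' = g'" "h' \<bullet> \<gamma> \<bullet> \<gamma>' = h'"
    using T by (simp_all add: c(2) assms(7)[THEN comp_reassoc] b(4) assms(8)[symmetric, THEN comp_reassoc]
        c(3)[symmetric] Fa[THEN comp_reassoc])
  have "is_iso C D D (\<gamma>' \<bullet> \<gamma>)" "is_iso C D' D' (\<gamma> \<bullet> \<gamma>')"
    using N_endo_iso[OF assms(1) _ 1] N_endo_iso[OF assms(2) _ 2] T by simp_all
  then show ?thesis using is_iso_of_iso_comps T by blast
qed

text \<open>The three given triangles map to those supplied by \<open>base_octahedral\<close>. By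
  the five lemma the third components \<open>u\<close>, \<open>v\<close>, \<open>w\<close> are
  invertible, and the arrows sought are \<open>s'\<close> and \<open>t'\<close> conjugated by
  them.\<close>

lemma N_octahedral:
  assumes N1: "Sext A B D f g h \<in> N" and N2: "Sext B X Y a b c \<in> N" and N3: "Sext A X Z (a \<bullet> f) d e \<in> N"
  shows "\<exists>s t. arrow C D Z s \<and> arrow C Z Y t \<and>
    s \<bullet> g = d \<bullet> a \<and> e \<bullet> s = h \<and> t \<bullet> d = b \<and> c \<bullet> t = Fmor F f \<bullet> e \<and>
    Sext D Z Y s t (Fmor F g \<bullet> c) \<in> N"
proof -
  note t1 = N_sextuple[OF N1, unfolded is_sextuple_iff] and t2 = N_sextuple[OF N2, unfolded is_sextuple_iff]
    and t3 = N_sextuple[OF N3, unfolded is_sextuple_iff]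
  have ob: "A \<in> Ob C" "B \<in> Ob C" "X \<in> Ob C" "D \<in> Ob C" "Y \<in> Ob C" "Z \<in> Ob C"
    using t1 t2 t3 by simp_all
  obtain B' X' i j a' D' g' h' Y' b' c' Z' d' e' s' t' where
    i: "is_iso C B B' i" and j: "is_iso C X X' j" and ob': "B' \<in> Ob C" "X' \<in> Ob C"
    and a': "arrow C B' X' a'" "a' \<bullet> i = j \<bullet> a"
    and N': "Sext A B' D' (i \<bullet> f) g' h' \<in> N" "Sext B' X' Y' a' b' c' \<in> N"
      "Sext A X' Z' (a' \<bullet> i \<bullet> f) d' e' \<in> N"
    and st: "arrow C D' Z' s'" "arrow C Z' Y' t'" "s' \<bullet> g' = d' \<bullet> a'" "e' \<bullet> s' = h'" "t' \<bullet> d' = b'"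
      "c' \<bullet> t' = Fmor F (i \<bullet> f) \<bullet> e'" "Sext D' Z' Y' s' t' (Fmor F g' \<bullet> c') \<in> N"
    using base_octahedral[of A B f X a] t1 t2 by (elim exE conjE) (simp, blast)
  note t' = N'[THEN N_sextuple, unfolded is_sextuple_iff]
  have ia: "arrow C B B' i" "arrow C X X' j" using i j is_iso_iff ob ob' by blast+
  note T = t1 t2 t3 t' ia a'(1) st(1,2)
  have fi: "i \<bullet> f = (i \<bullet> f) \<bullet> ident C A" using T by simp
  obtain u where u: "arrow C D D' u" "u \<bullet> g = g' \<bullet> i" "Fmor F (ident C A) \<bullet> h = h' \<bullet> u"
    using N_complete[OF N1 N'(1) ident_typed[OF ob(1)] ia(1) fi] by blast
  obtain v where v: "arrow C Y Y' v" "v \<bullet> b = b' \<bullet> j" "Fmor F i \<bullet> c = c' \<bullet> v"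
    using N_complete[OF N2 N'(2) ia a'(2)[symmetric]] by blast
  have af: "j \<bullet> a \<bullet> f = (a' \<bullet> i \<bullet> f) \<bullet> ident C A"
    using T by (simp add: a'(2)[THEN comp_reassoc])
  obtain w where w: "arrow C Z Z' w" "w \<bullet> d = d' \<bullet> j" "Fmor F (ident C A) \<bullet> e = e' \<bullet> w"
    using N_complete[OF N3 N'(3) ident_typed[OF ob(1)] ia(2)] af T by simp blast
  have iso: "is_iso C D D' u" "is_iso C Y Y' v" "is_iso C Z Z' w"
    using N_five[OF N1 N'(1) is_iso_ident i u(1) _ u(2,3)] N_five[OF N2 N'(2) i j v(1) _ v(2,3)]
      N_five[OF N3 N'(3) is_iso_ident j w(1) af w(2,3)] T ob a'(2) by simp_all
  have ob3: "D' \<in> Ob C" "Y' \<in> Ob C" "Z' \<in> Ob C" using T by simp_all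
  obtain v' where v': "arrow C Y' Y v'" "v' \<bullet> v = ident C Y" "v \<bullet> v' = ident C Y'"
    using is_isoE[OF iso(2) ob(5) ob3(2)] by blast
  obtain w' where w': "arrow C Z' Z w'" "w' \<bullet> w = ident C Z" "w \<bullet> w' = ident C Z'"
    using is_isoE[OF iso(3) ob(6) ob3(3)] by blast
  have hu: "h = h' \<bullet> u" and ew: "e = e' \<bullet> w" using u(3) w(3) T by simp_all
  have e'w': "e \<bullet> w' = e'" using T w(1) w' unfolding ew by simp
  obtain i' where i': "arrow C B' B i'" "i' \<bullet> i = ident C B" using is_isoE[OF i ob(2) ob'(1)] by blast
  have Fi: "Fmor F i' \<bullet> Fmor F i = ident C (Fob F B)" using F_comp[of i i'] i' ia ob by simp
  let ?s = "w' \<bullet> s' \<bullet> u" and ?t = "v' \<bullet> t' \<bullet> w"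
  note T = T u(1) v(1) w(1) v'(1) w'(1) i'(1)
  have ty: "arrow C D Z ?s" "arrow C Z Y ?t" using T by simp_all
  have 1: "?s \<bullet> g = d \<bullet> a"
  proof -
    have "?s \<bullet> g = w' \<bullet> (s' \<bullet> g') \<bullet> i" using T u(2) by simp
    also have "\<dots> = w' \<bullet> d' \<bullet> a' \<bullet> i" using T st(3) by simp
    also have "\<dots> = w' \<bullet> (d' \<bullet> j) \<bullet> a" using T a'(2) by simp
    also have "\<dots> = (w' \<bullet> w) \<bullet> d \<bullet> a" unfolding w(2)[symmetric] using T by simp
    also have "\<dots> = d \<bullet> a" unfolding w'(2) using T by simp
    finally show ?thesis .
  qed
  have 2: "e \<bullet> ?s = h"
    using T by (simp add: e'w'[THEN comp_reassoc] st(4)[THEN comp_reassoc] hu)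
  have 3: "?t \<bullet> d = b"
  proof -
    have "?t \<bullet> d = v' \<bullet> (t' \<bullet> d') \<bullet> j" using T w(2) by simp
    also have "\<dots> = v' \<bullet> (v \<bullet> b)" unfolding st(5) v(2) by simp
    also have "\<dots> = (v' \<bullet> v) \<bullet> b" using T by simp
    also have "\<dots> = b" unfolding v'(2) using T by simp
    finally show ?thesis .
  qed
  have 4: "c \<bullet> ?t = Fmor F f \<bullet> e"
  proof -
    have cv: "c \<bullet> v' = Fmor F i' \<bullet> c'"
      using square_inverse[OF v(3), of v' "Fmor F i'"] T v' Fi by simp
    then have "c \<bullet> ?t = Fmor F i' \<bullet> (c' \<bullet> t') \<bullet> w"
      using T by (simp add: cv[THEN comp_reassoc])
    also have "\<dots> = (Fmor F i' \<bullet> Fmor F i) \<bullet> Fmor F f \<bullet> e' \<bullet> w"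
      unfolding st(6) using T by (simp add: F_comp)
    also have "\<dots> = Fmor F f \<bullet> e" unfolding Fi ew using T by simp
    finally show ?thesis .
  qed
  have Fu: "Fmor F u \<bullet> Fmor F g = Fmor F g' \<bullet> Fmor F i" using F_square[OF u(2)] T by simp
  have "sext_isomorphic C F (Sext D Z Y ?s ?t (Fmor F g \<bullet> c)) (Sext D' Z' Y' s' t' (Fmor F g' \<bullet> c'))"
  proof (rule sext_isomorphicI[OF _ _ iso(1,3,2)])
    show "w \<bullet> ?s = s' \<bullet> u" using T by (simp add: w'(3)[THEN comp_reassoc])
    show "v \<bullet> ?t = t' \<bullet> w" using T by (simp add: v'(3)[THEN comp_reassoc])
    show "Fmor F u \<bullet> Fmor F g \<bullet> c = (Fmor F g' \<bullet> c') \<bullet> v"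
      using T by (simp add: Fu[THEN comp_reassoc] v(3))
  qed (use T in \<open>simp_all add: is_sextuple_iff\<close>)
  then have "Sext D Z Y ?s ?t (Fmor F g \<bullet> c) \<in> N"
    using N_iso_closed[OF st(7)] sext_isomorphic_sym by blast
  then show ?thesis using ty 1 2 3 4 by blast
qed

theorem right_triangulated_closure: "right_triangulated K C F N"
proof unfold_locales
  show "additive_endofunctor C F" by (rule additive_F)
next
  fix s assume "s \<in> N" then show "is_sextuple C F s" by (rule N_sextuple)
next
  fix s t assume "s \<in> N" "sext_isomorphic C F s t" then show "t \<in> N" by (rule N_iso_closed)
next
  fix A B f assume "A \<in> Ob C" "B \<in> Ob C" "f \<in> Mor C A B"
  then show "\<exists>D g h. Sext A B D f g h \<in> N" using base_embed arrowI by blast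
next
  fix A B D f g h assume *: "Sext A B D f g h \<in> N"
  note s = N_sextuple[OF *, unfolded is_sextuple_iff]
  have "\<ominus>\<^bsub>Hom C (Fob F A) (Fob F B)\<^esub> Fmor F f = \<boxminus> Fmor F f"
    using s by (intro neg_eq) (simp_all add: Mor_iff)
  then show "Sext B D (Fob F A) g h (\<ominus>\<^bsub>Hom C (Fob F A) (Fob F B)\<^esub> Fmor F f) \<in> N"
    using N_rotate[OF *] by simp
next
  fix A B D f g h A' B' D' f' g' h' \<alpha> \<beta>
  assume *: "Sext A B D f g h \<in> N" "Sext A' B' D' f' g' h' \<in> N"
    "\<alpha> \<in> Mor C A A'" "\<beta> \<in> Mor C B B'" "\<beta> \<bullet> f = f' \<bullet> \<alpha>"
  note s = *(1,2)[THEN N_sextuple]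
  have "arrow C A A' \<alpha>" "arrow C B B' \<beta>" using s * unfolding is_sextuple_def arrow_def by simp_all
  then obtain \<gamma> where "arrow C D D' \<gamma>" "\<gamma> \<bullet> g = g' \<bullet> \<beta>" "Fmor F \<alpha> \<bullet> h = h' \<bullet> \<gamma>"
    using N_complete[OF *(1,2) _ _ *(5)] by blast
  then show "\<exists>\<gamma>. sext_morphism C F (Sext A B D f g h) (Sext A' B' D' f' g' h') \<alpha> \<beta> \<gamma>"
    using \<open>arrow C A A' \<alpha>\<close> \<open>arrow C B B' \<beta>\<close> * by (auto simp: sext_morphism_iff[OF s])
next
  fix A B D f g h X Y a b c Z d e
  assume *: "Sext A B D f g h \<in> N" "Sext B X Y a b c \<in> N" "Sext A X Z (a \<bullet> f) d e \<in> N"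
  obtain s t where "arrow C D Z s" "arrow C Z Y t"
    "s \<bullet> g = d \<bullet> a" "e \<bullet> s = h" "t \<bullet> d = b" "c \<bullet> t = Fmor F f \<bullet> e"
    "Sext D Z Y s t (Fmor F g \<bullet> c) \<in> N"
    using N_octahedral[OF *] by blast
  then show "\<exists>s \<in> Mor C D Z. \<exists>t \<in> Mor C Z Y.
      s \<bullet> g = d \<bullet> a \<and> e \<bullet> s = h \<and> t \<bullet> d = b \<and> c \<bullet> t = Fmor F f \<bullet> e \<and>
      Sext D Z Y s t (Fmor F g \<bullet> c) \<in> N"
    using arrow_mem by blast
next
  fix A Z assume "A \<in> Ob C" "zero_object C Z"
  then show "Sext Z A A (zero_mor Z A) (ident C A) (zero_mor A (Fob F Z)) \<in> N" by (rule base_zero)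
qed

end

section \<open>Calculation with classes in the quotient\<close>

context ideal_quotient
begin

sublocale Q: additive_category K D
  by (rule additive_category_D)

abbreviation qcmp (infixr "\<diamondop>" 70) where "G \<diamondop> F \<equiv> G \<cdot>\<^bsub>D\<^esub> F"

lemma cls_typed: assumes "arrow C A B f" "A \<in> \<A>" "B \<in> \<A>" shows "arrow D A B (cls f)"
  using D_MorI[OF assms(1)] assms by (intro Q.arrowI) simp_all

lemma arr_cls [simp]: "\<lbrakk>arr C f; src C f \<in> \<A>; tgt C f \<in> \<A>\<rbrakk> \<Longrightarrow> arr D (cls f)"
  and src_cls [simp]: "\<lbrakk>arr C f; src C f \<in> \<A>; tgt C f \<in> \<A>\<rbrakk> \<Longrightarrow> src D (cls f) = src C f"
  and tgt_cls [simp]: "\<lbrakk>arr C f; src C f \<in> \<A>; tgt C f \<in> \<A>\<rbrakk> \<Longrightarrow> tgt D (cls f) = tgt C f"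
  using cls_typed[of "src C f" "tgt C f" f] by simp_all

lemma arrow_D_E:
  assumes "arrow D A B F" obtains f where "arrow C A B f" "F = cls f" "A \<in> \<A>" "B \<in> \<A>"
proof -
  have "A \<in> \<A>" "B \<in> \<A>" "F \<in> Mor D A B" using assms Q.arrow_mem[OF assms] by simp_all
  then show thesis using D_MorE[of F A B] that by auto
qed

lemmas cls_comp = D_comp

lemma cls_add:
  assumes "arr C f" "arr C g" "src C g = src C f" "tgt C g = tgt C f" "src C f \<in> \<A>" "tgt C f \<in> \<A>"
  shows "cls f \<uplus>\<^bsub>D\<^esub> cls g = cls (f \<boxplus> g)"
  using D_plus[of "src C f" "tgt C f" f g] assms unfolding cadd_def[of D] by simp

lemma cls_zero: "\<lbrakk>A \<in> \<A>; B \<in> \<A>\<rbrakk> \<Longrightarrow> czero D A B = cls (zero_mor A B)"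
  by (simp add: D_zero)

lemma cls_neg:
  assumes "arr C f" "src C f \<in> \<A>" "tgt C f \<in> \<A>" shows "\<sim>\<^bsub>D\<^esub> cls f = cls (\<boxminus> f)"
proof (rule Q.add_eq_zero[symmetric])
  show "cls f \<uplus>\<^bsub>D\<^esub> cls (\<boxminus> f) = czero D (src D (cls f)) (tgt D (cls f))"
    using assms cls_add[of f "\<boxminus> f"] by (simp add: cls_zero)
qed (use assms in simp_all)

lemma cls_is_isoI:
  assumes "arrow C A B f" "arrow C B A g" "A \<in> \<A>" "B \<in> \<A>"
    "eqv (g \<bullet> f) (ident C A)" "eqv (f \<bullet> g) (ident C B)"
  shows "is_iso D A B (cls f)"
  by (rule Q.is_isoI[of _ _ _ "cls g"])
     (use assms cls_cong[OF assms(5)] cls_cong[OF assms(6)] in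
       \<open>simp_all add: cls_comp D_ident\<close>)

lemma cls_is_iso_of_iso:
  assumes "is_iso C A B f" "A \<in> \<A>" "B \<in> \<A>" shows "is_iso D A B (cls f)"
proof -
  obtain g where "arrow C A B f" "arrow C B A g" "g \<bullet> f = ident C A" "f \<bullet> g = ident C B"
    using is_isoE[OF assms(1)] assms by auto
  then show ?thesis using assms by (intro cls_is_isoI[of _ _ _ g]) (simp_all add: eqv_refl)
qed

end

section \<open>Categories with extensions and triangles\<close>

text \<open>
  In a triangulated category with shift \<open>S\<close> put \<open>Ex D A = Hom(D, S A)\<close>, \<open>push f \<delta> = S f \<delta>\<close>,
  \<open>pull h \<delta> = \<delta> h\<close>, and let \<open>tri A B D f g \<delta>\<close> say that \<open>A \<rightarrow> B \<rightarrow> D \<rightarrow> S A\<close> is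
  distinguished. Stated in this way the axioms are self-dual, although the shift is only an
  autoequivalence: nothing has to be said about its quasi-inverse.
\<close>

locale ext_category = additive_category K C
  for K :: "'k ring" and C :: "('o, 'm, 'k) lincat" +
  fixes Ex :: "'o \<Rightarrow> 'o \<Rightarrow> 'm set"
    and push pull :: "'m \<Rightarrow> 'm \<Rightarrow> 'm"
    and tri :: "'o \<Rightarrow> 'o \<Rightarrow> 'o \<Rightarrow> 'm \<Rightarrow> 'm \<Rightarrow> 'm \<Rightarrow> bool"
  assumes push_mem: "\<lbrakk>\<delta> \<in> Ex D A; D \<in> Ob C; arrow C A A' f\<rbrakk> \<Longrightarrow> push f \<delta> \<in> Ex D A'"
    and pull_mem: "\<lbrakk>\<delta> \<in> Ex D A; A \<in> Ob C; arrow C D' D h\<rbrakk> \<Longrightarrow> pull h \<delta> \<in> Ex D' A"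
    and push_push: "\<lbrakk>\<delta> \<in> Ex D A; D \<in> Ob C; arrow C A A' f; arrow C A' A'' g\<rbrakk>
      \<Longrightarrow> push g (push f \<delta>) = push (g \<cdot>\<^bsub>C\<^esub> f) \<delta>"
    and pull_pull: "\<lbrakk>\<delta> \<in> Ex D A; A \<in> Ob C; arrow C D' D h; arrow C D'' D' k\<rbrakk>
      \<Longrightarrow> pull k (pull h \<delta>) = pull (h \<cdot>\<^bsub>C\<^esub> k) \<delta>"
    and push_pull: "\<lbrakk>\<delta> \<in> Ex D A; arrow C A A' f; arrow C D' D h\<rbrakk>
      \<Longrightarrow> push f (pull h \<delta>) = pull h (push f \<delta>)"
    and push_ident: "\<lbrakk>\<delta> \<in> Ex D A; A \<in> Ob C; D \<in> Ob C\<rbrakk> \<Longrightarrow> push (ident C A) \<delta> = \<delta>"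
    and pull_ident: "\<lbrakk>\<delta> \<in> Ex D A; A \<in> Ob C; D \<in> Ob C\<rbrakk> \<Longrightarrow> pull (ident C D) \<delta> = \<delta>"
    and push_pull_zero: "\<lbrakk>\<delta> \<in> Ex D A; \<delta>' \<in> Ex D' A'; A \<in> Ob C; D \<in> Ob C; A' \<in> Ob C; D' \<in> Ob C\<rbrakk>
      \<Longrightarrow> push (czero C A A') \<delta> = pull (czero C D D') \<delta>'"
    and push_pull_neg: "\<lbrakk>\<delta> \<in> Ex D A; \<delta>' \<in> Ex D' A'; arrow C A A' f; arrow C D D' h;
        push f \<delta> = pull h \<delta>'\<rbrakk> \<Longrightarrow> push (\<sim>\<^bsub>C\<^esub> f) \<delta> = pull (\<sim>\<^bsub>C\<^esub> h) \<delta>'"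
    and push_pull_add: "\<lbrakk>\<delta> \<in> Ex D A; \<delta>' \<in> Ex D' A'; arrow C A A' f; arrow C A A' f';
        arrow C D D' h; arrow C D D' h'; push f \<delta> = pull h \<delta>'; push f' \<delta> = pull h' \<delta>'\<rbrakk>
      \<Longrightarrow> push (f \<uplus>\<^bsub>C\<^esub> f') \<delta> = pull (h \<uplus>\<^bsub>C\<^esub> h') \<delta>'"
    and tri_typed: "tri A B D f g \<delta> \<Longrightarrow> arrow C A B f \<and> arrow C B D g \<and> \<delta> \<in> Ex D A"
    and embed_first: "arrow C A B f \<Longrightarrow> \<exists>D g \<delta>. tri A B D f g \<delta>"
    and embed_second: "arrow C B D g \<Longrightarrow> \<exists>A f \<delta>. tri A B D f g \<delta>"
    and fill_third: "\<lbrakk>tri A B D f g \<delta>; tri A' B' D' f' g' \<delta>'; arrow C A A' a; arrow C B B' b;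
        b \<cdot>\<^bsub>C\<^esub> f = f' \<cdot>\<^bsub>C\<^esub> a\<rbrakk>
      \<Longrightarrow> \<exists>c. arrow C D D' c \<and> c \<cdot>\<^bsub>C\<^esub> g = g' \<cdot>\<^bsub>C\<^esub> b \<and> push a \<delta> = pull c \<delta>'"
    and fill_first: "\<lbrakk>tri A B D f g \<delta>; tri A' B' D' f' g' \<delta>'; arrow C D D' c; arrow C B B' b;
        c \<cdot>\<^bsub>C\<^esub> g = g' \<cdot>\<^bsub>C\<^esub> b\<rbrakk>
      \<Longrightarrow> \<exists>a. arrow C A A' a \<and> b \<cdot>\<^bsub>C\<^esub> f = f' \<cdot>\<^bsub>C\<^esub> a \<and> push a \<delta> = pull c \<delta>'"
    and fill_middle: "\<lbrakk>tri A B D f g \<delta>; tri A' B' D' f' g' \<delta>'; arrow C A A' a; arrow C D D' c;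
        push a \<delta> = pull c \<delta>'\<rbrakk>
      \<Longrightarrow> \<exists>b. arrow C B B' b \<and> b \<cdot>\<^bsub>C\<^esub> f = f' \<cdot>\<^bsub>C\<^esub> a \<and> c \<cdot>\<^bsub>C\<^esub> g = g' \<cdot>\<^bsub>C\<^esub> b"
    and tri_comp: "tri A B D f g \<delta> \<Longrightarrow> g \<cdot>\<^bsub>C\<^esub> f = czero C A D"
    and weak_cokernel: "\<lbrakk>tri A B D f g \<delta>; arrow C B W \<phi>; \<phi> \<cdot>\<^bsub>C\<^esub> f = czero C A W\<rbrakk>
      \<Longrightarrow> \<exists>\<psi>. arrow C D W \<psi> \<and> \<phi> = \<psi> \<cdot>\<^bsub>C\<^esub> g"
    and weak_kernel: "\<lbrakk>tri A B D f g \<delta>; arrow C W B \<phi>; g \<cdot>\<^bsub>C\<^esub> \<phi> = czero C W D\<rbrakk>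
      \<Longrightarrow> \<exists>\<psi>. arrow C W A \<psi> \<and> \<phi> = f \<cdot>\<^bsub>C\<^esub> \<psi>"
    and push_eq_iff: "\<lbrakk>tri A B D f g \<delta>; arrow C A W \<phi>; arrow C A W \<phi>'\<rbrakk>
      \<Longrightarrow> push \<phi> \<delta> = push \<phi>' \<delta> \<longleftrightarrow> (\<exists>\<psi>. arrow C B W \<psi> \<and> \<phi> = \<phi>' \<uplus>\<^bsub>C\<^esub> \<psi> \<cdot>\<^bsub>C\<^esub> f)"
    and pull_eq_iff: "\<lbrakk>tri A B D f g \<delta>; arrow C W D \<phi>; arrow C W D \<phi>'\<rbrakk>
      \<Longrightarrow> pull \<phi> \<delta> = pull \<phi>' \<delta> \<longleftrightarrow> (\<exists>\<psi>. arrow C W B \<psi> \<and> \<phi> = \<phi>' \<uplus>\<^bsub>C\<^esub> g \<cdot>\<^bsub>C\<^esub> \<psi>)"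
    and octahedron: "\<lbrakk>tri A B D f g \<delta>; tri B X Y a b \<epsilon>; tri A X Z (a \<cdot>\<^bsub>C\<^esub> f) d \<zeta>\<rbrakk>
      \<Longrightarrow> \<exists>s t. arrow C D Z s \<and> arrow C Z Y t \<and> s \<cdot>\<^bsub>C\<^esub> g = d \<cdot>\<^bsub>C\<^esub> a \<and> pull s \<zeta> = \<delta> \<and>
            t \<cdot>\<^bsub>C\<^esub> d = b \<and> pull t \<epsilon> = push f \<zeta> \<and> tri D Z Y s t (push g \<epsilon>)"
    and octahedron_op: "\<lbrakk>tri D B A g f \<delta>; tri Y X B b a \<epsilon>; tri Z X A d (f \<cdot>\<^bsub>C\<^esub> a) \<zeta>\<rbrakk>
      \<Longrightarrow> \<exists>s t. arrow C Z D s \<and> arrow C Y Z t \<and> g \<cdot>\<^bsub>C\<^esub> s = a \<cdot>\<^bsub>C\<^esub> d \<and> push s \<zeta> = \<delta> \<and>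
            d \<cdot>\<^bsub>C\<^esub> t = b \<and> push t \<epsilon> = pull f \<zeta> \<and> tri Y Z D t s (pull g \<epsilon>)"
    and pushout: "\<lbrakk>tri A X D \<alpha> \<beta> \<gamma>; arrow C A B f; biproduct C M B X i p j q;
        tri A M Z (i \<cdot>\<^bsub>C\<^esub> f \<uplus>\<^bsub>C\<^esub> j \<cdot>\<^bsub>C\<^esub> \<alpha>) v \<delta>\<rbrakk>
      \<Longrightarrow> \<exists>s. arrow C Z D s \<and> s \<cdot>\<^bsub>C\<^esub> v = \<sim>\<^bsub>C\<^esub> (\<beta> \<cdot>\<^bsub>C\<^esub> q) \<and> pull (\<sim>\<^bsub>C\<^esub> s) \<gamma> = \<delta> \<and>
            tri B Z D (v \<cdot>\<^bsub>C\<^esub> i) s (push f \<gamma>)"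
    and pullback: "\<lbrakk>tri D X A \<beta> \<alpha> \<gamma>; arrow C B A f; biproduct C M B X i p j q;
        tri Z M A v (f \<cdot>\<^bsub>C\<^esub> p \<uplus>\<^bsub>C\<^esub> \<alpha> \<cdot>\<^bsub>C\<^esub> q) \<delta>\<rbrakk>
      \<Longrightarrow> \<exists>s. arrow C D Z s \<and> v \<cdot>\<^bsub>C\<^esub> s = \<sim>\<^bsub>C\<^esub> (j \<cdot>\<^bsub>C\<^esub> \<beta>) \<and> push (\<sim>\<^bsub>C\<^esub> s) \<gamma> = \<delta> \<and>
            tri D Z B s (p \<cdot>\<^bsub>C\<^esub> v) (pull f \<gamma>)"
begin

text \<open>The axioms come in dual pairs, such as \<open>embed_first\<close> and
  \<open>embed_second\<close>, or \<open>pushout\<close> and \<open>pullback\<close>;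
  \<open>fill_middle\<close> and the mixed rules for \<open>push\<close> and \<open>pull\<close> are
  their own duals.\<close>

lemma ext_category_op: "ext_category K (op_cat C) (\<lambda>A B. Ex B A) pull push (\<lambda>A B D f g \<delta>. tri D B A g f \<delta>)"
proof -
  interpret op: additive_category K "op_cat C" by (rule additive_category_op)
  show ?thesis
  proof (unfold_locales, unfold op_cat_typing op_cat_simps op_cat_add biproduct_op, goal_cases)
    case (1 \<delta> D A A' f) then show ?case by (rule pull_mem)
  next
    case (2 \<delta> D A D' h) then show ?case by (rule push_mem)
  next
    case (3 \<delta> D A A' f A'' g) then show ?case by (rule pull_pull)
  next
    case (4 \<delta> D A D' h D'' k) then show ?case by (rule push_push)
  next
    case (5 \<delta> D A A' f D' h) then show ?case by (intro push_pull[symmetric])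
  next
    case (6 \<delta> D A) then show ?case by (intro pull_ident)
  next
    case (7 \<delta> D A) then show ?case by (intro push_ident)
  next
    case (8 \<delta> D A \<delta>' D' A') then show ?case by (intro push_pull_zero[symmetric])
  next
    case (9 \<delta> D A \<delta>' D' A' f h)
    show ?case by (rule push_pull_neg[symmetric, OF 9(2,1,4,3) 9(5)[symmetric]])
  next
    case (10 \<delta> D A \<delta>' D' A' f f' h h')
    show ?case
      by (rule push_pull_add[symmetric, OF 10(2,1,5,6,3,4) 10(7)[symmetric] 10(8)[symmetric]])
  next
    case (11 A B D f g \<delta>) then show ?case using tri_typed by blast
  next
    case (12 A B f) then show ?case using embed_second by blast
  next
    case (13 B D g) then show ?case using embed_first by blast
  next
    case (14 A B D f g \<delta> A' B' D' f' g' \<delta>' a b)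
    show ?case using fill_first[OF 14(2,1,3,4) 14(5)[symmetric]] by metis
  next
    case (15 A B D f g \<delta> A' B' D' f' g' \<delta>' c b)
    show ?case using fill_third[OF 15(2,1,3,4) 15(5)[symmetric]] by metis
  next
    case (16 A B D f g \<delta> A' B' D' f' g' \<delta>' a c)
    show ?case using fill_middle[OF 16(2,1,4,3) 16(5)[symmetric]] by metis
  next
    case (17 A B D f g \<delta>) then show ?case by (rule tri_comp)
  next
    case (18 A B D f g \<delta> W \<phi>) then show ?case by (rule weak_kernel)
  next
    case (19 A B D f g \<delta> W \<phi>) then show ?case by (rule weak_cokernel)
  next
    case (20 A B D f g \<delta> W \<phi> \<phi>') then show ?case by (rule pull_eq_iff)
  next
    case (21 A B D f g \<delta> W \<phi> \<phi>') then show ?case by (rule push_eq_iff)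
  next
    case (22 A B D f g \<delta> X Y a b \<epsilon> Z d \<zeta>) then show ?case by (rule octahedron_op)
  next
    case (23 D B A g f \<delta> Y X b a \<epsilon> Z d \<zeta>) then show ?case by (rule octahedron)
  next
    case (24 A X D \<alpha> \<beta> \<gamma> B f M i p j q Z v \<delta>) then show ?case by (rule pullback)
  next
    case (25 D X A \<beta> \<alpha> \<gamma> B f M i p j q Z v \<delta>) then show ?case by (rule pushout)
  qed
qed

lemma tri_Ob: "tri A B D f g \<delta> \<Longrightarrow> A \<in> Ob C" "tri A B D f g \<delta> \<Longrightarrow> B \<in> Ob C"
    "tri A B D f g \<delta> \<Longrightarrow> D \<in> Ob C" "tri A B D f g \<delta> \<Longrightarrow> \<delta> \<in> Ex D A"
  and tri_arrows: "tri A B D f g \<delta> \<Longrightarrow> arrow C A B f" "tri A B D f g \<delta> \<Longrightarrow> arrow C B D g"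
  using tri_typed by (metis arrow_iff)+

text \<open>The difference \<open>b - 1\<close> vanishes on \<open>f\<close>, hence equals some
  \<open>\<psi> g\<close>, and \<open>g (b - 1) = 0\<close>. It therefore squares to zero.\<close>

lemma iso_middle:
  assumes "tri A B D f g \<delta>" "arrow C B B b" "b \<bullet> f = f" "g \<bullet> b = g" shows "is_iso C B B b"
proof -
  let ?n = "b \<boxplus> \<boxminus> ident C B"
  note t = tri_arrows[OF assms(1)]
  have n: "arrow C B B ?n" using assms by simp
  have "?n \<bullet> f = zero_mor A B" using t assms by simp
  then obtain \<psi> where p: "arrow C D B \<psi>" "?n = \<psi> \<bullet> g" using weak_cokernel[OF assms(1) n] by blast
  have "g \<bullet> ?n = zero_mor B D" using t assms by simp
  then have "(\<psi> \<bullet> g) \<bullet> ?n = zero_mor B B" using t p(1) n by (simp del: comp_add)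
  then show ?thesis using is_iso_unipotent[OF assms(2) refl] p(2) by simp
qed

text \<open>Equality of the pull-backs gives \<open>c - 1 = g \<psi>\<close>, and
  \<open>(c - 1) g = 0\<close>; again the square is zero.\<close>

lemma iso_third:
  assumes "tri A B D f g \<delta>" "arrow C D D c" "c \<bullet> g = g" "pull c \<delta> = \<delta>" shows "is_iso C D D c"
proof -
  note t = tri_arrows[OF assms(1)] tri_Ob[OF assms(1)]
  have "pull c \<delta> = pull (ident C D) \<delta>" using assms(4) pull_ident t by simp
  then obtain \<psi> where p: "arrow C D B \<psi>" "c = ident C D \<boxplus> g \<bullet> \<psi>"
    using pull_eq_iff[OF assms(1,2), of "ident C D"] t by auto
  let ?n = "c \<boxplus> \<boxminus> ident C D"
  have n: "?n = g \<bullet> \<psi>" using t p add_commute[of "ident C D" "g \<bullet> \<psi>"] by (simp add: add_assoc)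
  have "?n \<bullet> g \<bullet> \<psi> = (?n \<bullet> g) \<bullet> \<psi>" using t p(1) assms(2) by (simp del: add_comp)
  also have "?n \<bullet> g = zero_mor B D" using t assms by simp
  finally have "?n \<bullet> ?n = zero_mor D D" unfolding n using t p(1) by simp
  then show ?thesis using is_iso_unipotent[OF assms(2) refl] by simp
qed

end

text \<open>This says that \<open>(f, _, h)\<close> extends to a morphism between the chosen
  triangles, with the middle component eliminated by \<open>fill_middle\<close>. In this form the
  loop functor is the same construction in the opposite category.\<close>

definition suspension_rel ::
    "('o, 'm, 'k) lincat \<Rightarrow> ('m \<Rightarrow> 'm \<Rightarrow> 'm) \<Rightarrow> ('m \<Rightarrow> 'm \<Rightarrow> 'm) \<Rightarrow> 'o set
      \<Rightarrow> ('o \<Rightarrow> ('o, 'm) sextuple) \<Rightarrow> 'm \<Rightarrow> 'm \<Rightarrow> bool" where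
  "suspension_rel C push pull \<A> P f h \<longleftrightarrow> (\<exists>A \<in> \<A>. \<exists>A' \<in> \<A>. arrow C A A' f \<and>
     arrow C (ob3 (P A)) (ob3 (P A')) h \<and> push f (ar3 (P A)) = pull h (ar3 (P A')))"

definition ext_suspension ::
    "('o, 'm, 'k) lincat \<Rightarrow> ('m \<Rightarrow> 'm \<Rightarrow> 'm) \<Rightarrow> ('m \<Rightarrow> 'm \<Rightarrow> 'm) \<Rightarrow> 'o set \<Rightarrow> 'o set
      \<Rightarrow> ('o \<Rightarrow> ('o, 'm) sextuple) \<Rightarrow> ('o, 'm set) endofunctor" where
  "ext_suspension C push pull \<A> \<X> P = \<lparr>Fob = (\<lambda>A. ob3 (P A)),
     Fmor = (\<lambda>F. \<Union>{mor_class C \<X> h | f h. f \<in> F \<and> suspension_rel C push pull \<A> P f h})\<rparr>"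

text \<open>The generators of the right triangles, before closure under isomorphism.\<close>

definition standard_triangles ::
    "('o, 'm, 'k) lincat \<Rightarrow> ('m \<Rightarrow> 'm \<Rightarrow> 'm)
      \<Rightarrow> ('o \<Rightarrow> 'o \<Rightarrow> 'o \<Rightarrow> 'm \<Rightarrow> 'm \<Rightarrow> 'm \<Rightarrow> bool) \<Rightarrow> 'o set \<Rightarrow> 'o set
      \<Rightarrow> ('o \<Rightarrow> ('o, 'm) sextuple) \<Rightarrow> ('o, 'm set) sextuple set" where
  "standard_triangles C push tri \<A> \<X> P =
     {Sext A B E (mor_class C \<X> f) (mor_class C \<X> g) (mor_class C \<X> h) | A B E f g h.
        A \<in> \<A> \<and> B \<in> \<A> \<and> E \<in> \<A> \<and> arrow C A B f \<and>
        tri B E (ob3 (P A)) g h (push f (ar3 (P A)))}"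

section \<open>The right triangulated structure\<close>

text \<open>One half of the hypotheses: left approximations and cones. The other half is this locale
  over the opposite category.\<close>

locale suspended = ext_category K C Ex push pull tri + ideal_quotient K C \<A> \<X>
  for K :: "'k ring" and C :: "('o, 'm, 'k) lincat"
    and Ex :: "'o \<Rightarrow> 'o \<Rightarrow> 'm set" and push pull :: "'m \<Rightarrow> 'm \<Rightarrow> 'm"
    and tri :: "'o \<Rightarrow> 'o \<Rightarrow> 'o \<Rightarrow> 'm \<Rightarrow> 'm \<Rightarrow> 'm \<Rightarrow> bool" and \<A> \<X> :: "'o set" +
  fixes P :: "'o \<Rightarrow> ('o, 'm) sextuple"
  assumes cone_mem: "\<lbrakk>tri A B E f g \<delta>; A \<in> \<A>; B \<in> \<A>; monic_rel C \<X> A B f\<rbrakk> \<Longrightarrow> E \<in> \<A>"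
    and P_tri: "A \<in> \<A> \<Longrightarrow> tri A (ob2 (P A)) (ob3 (P A)) (ar1 (P A)) (ar2 (P A)) (ar3 (P A))"
    and P_approx: "A \<in> \<A> \<Longrightarrow> left_approximation C \<X> A (ob2 (P A)) (ar1 (P A))"
begin

abbreviation XX where "XX A \<equiv> ob2 (P A)"
abbreviation Sg where "Sg A \<equiv> ob3 (P A)"
abbreviation al where "al A \<equiv> ar1 (P A)"
abbreviation be where "be A \<equiv> ar2 (P A)"
abbreviation ga where "ga A \<equiv> ar3 (P A)"
abbreviation sus where "sus \<equiv> suspension_rel C push pull \<A> P"
abbreviation Susp where "Susp \<equiv> ext_suspension C push pull \<A> \<X> P"
abbreviation std where "std \<equiv> standard_triangles C push tri \<A> \<X> P"

text \<open>\<open>monic_rel\<close> with surjectivity spelled out as an extension property, which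
  is how it is used.\<close>

definition monic :: "'o \<Rightarrow> 'o \<Rightarrow> 'm \<Rightarrow> bool" where
  "monic A B u \<longleftrightarrow> arrow C A B u \<and>
     (\<forall>Y \<in> \<X>. \<forall>\<phi>. arrow C A Y \<phi> \<longrightarrow> (\<exists>w. arrow C B Y w \<and> \<phi> = w \<bullet> u))"

lemma monic_rel_of_monic: assumes "monic A B u" shows "monic_rel C \<X> A B u"
proof -
  have u: "arrow C A B u" using assms unfolding monic_def by simp
  have "(\<lambda>w. w \<bullet> u) ` Mor C B Y = Mor C A Y" if Y: "Y \<in> \<X>" for Y
  proof (intro subset_antisym subsetI)
    fix \<phi> assume "\<phi> \<in> (\<lambda>w. w \<bullet> u) ` Mor C B Y"
    then show "\<phi> \<in> Mor C A Y" using u Y by (auto simp: Mor_iff)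
  next
    fix \<phi> assume "\<phi> \<in> Mor C A Y"
    then have "arrow C A Y \<phi>" using u Y by (intro arrowI) simp_all
    then obtain w where "arrow C B Y w" "\<phi> = w \<bullet> u" using assms Y unfolding monic_def by blast
    then show "\<phi> \<in> (\<lambda>w. w \<bullet> u) ` Mor C B Y" using arrow_mem by blast
  qed
  then show ?thesis unfolding monic_rel_def using arrow_mem[OF u] by blast
qed

lemma XX_X: "A \<in> \<A> \<Longrightarrow> XX A \<in> \<X>"
  using P_approx unfolding left_approximation_def by blast

lemma al_arrow: "A \<in> \<A> \<Longrightarrow> arrow C A (XX A) (al A)"
  and be_arrow: "A \<in> \<A> \<Longrightarrow> arrow C (XX A) (Sg A) (be A)"
  and ga_mem [simp]: "A \<in> \<A> \<Longrightarrow> ga A \<in> Ex (Sg A) A"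
  using tri_typed[OF P_tri] by blast+

lemma al_monic: "A \<in> \<A> \<Longrightarrow> monic A (XX A) (al A)"
  unfolding monic_def using al_arrow XX_X P_approx[of A] unfolding left_approximation_def
  by (metis A_Ob X_A arrowI arrow_mem)

text \<open>A left approximation is X-monic, so its cone stays in \<open>\<A>\<close>.\<close>

lemma Sg_A [simp]: "A \<in> \<A> \<Longrightarrow> Sg A \<in> \<A>"
  using cone_mem[OF P_tri _ _ monic_rel_of_monic[OF al_monic]] XX_X by simp

lemma P_simps [simp]:
  assumes "A \<in> \<A>"
  shows "arr C (al A)" "src C (al A) = A" "tgt C (al A) = XX A" "XX A \<in> \<X>"
    "arr C (be A)" "src C (be A) = XX A" "tgt C (be A) = Sg A"
  using al_arrow be_arrow XX_X assms by simp_all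

lemma monicD:
  assumes "monic A B u" "Y \<in> \<X>" "arrow C A Y \<phi>" obtains w where "arrow C B Y w" "\<phi> = w \<bullet> u"
  using assms unfolding monic_def by blast

text \<open>The push-forwards agree exactly if \<open>f - f'\<close> factors through
  \<open>al A\<close>. A difference \<open>v u\<close> through some object of \<open>\<X>\<close>
  does so, because \<open>u\<close> extends along the approximation \<open>al A\<close>.\<close>

lemma push_ga_eq_iff:
  assumes "A \<in> \<A>" "arrow C A W f" "arrow C A W f'"
  shows "push f (ga A) = push f' (ga A) \<longleftrightarrow> eqv f f'"
proof
  assume "push f (ga A) = push f' (ga A)"
  then obtain \<psi> where p: "arrow C (XX A) W \<psi>" "f = f' \<boxplus> \<psi> \<bullet> al A"
    using push_eq_iff[OF P_tri[OF assms(1)] assms(2,3)] by blast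
  then show "eqv f f'" using assms by (auto intro!: eqv_of_null_sum nullI)
next
  assume e: "eqv f f'"
  then obtain u v where uv: "arr C u" "arr C v" "tgt C u \<in> \<X>" "src C v = tgt C u" "f \<boxplus> \<boxminus> f' = v \<bullet> u"
    unfolding eqv_def null_def by blast
  have st: "src C u = A" "tgt C v = W"
    using arg_cong[OF uv(5), of "src C"] arg_cong[OF uv(5), of "tgt C"] assms uv(1-4) by simp_all
  obtain w where w: "arrow C (XX A) (tgt C u) w" "u = w \<bullet> al A"
    using monicD[OF al_monic[OF assms(1)] uv(3), of u] uv st assms by auto
  have "f = f' \<boxplus> v \<bullet> u"
    by (rule iffD1[OF diff_eq_iff uv(5)]) (use assms uv(1-4) st in simp_all)
  also have "v \<bullet> u = (v \<bullet> w) \<bullet> al A"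
    using w(1) uv(2,4) assms(1) by (simp add: w(2)[symmetric])
  finally have "f = f' \<boxplus> (v \<bullet> w) \<bullet> al A" .
  moreover have "arrow C (XX A) W (v \<bullet> w)" using w(1) uv st assms by simp
  ultimately show "push f (ga A) = push f' (ga A)"
    using push_eq_iff[OF P_tri[OF assms(1)] assms(2,3)] by blast
qed

text \<open>Equal pull-backs make \<open>h - h'\<close> factor through \<open>be A\<close>, hence
  through \<open>\<X>\<close>. There is no converse in general: a morphism from an object of
  \<open>\<X>\<close> to \<open>Sg A\<close> may fail to lift along \<open>be A\<close>.\<close>

lemma pull_ga_eq:
  assumes "A \<in> \<A>" "arrow C W (Sg A) h" "arrow C W (Sg A) h'" "pull h (ga A) = pull h' (ga A)"
  shows "eqv h h'"
proof -
  obtain \<psi> where p: "arrow C W (XX A) \<psi>" "h = h' \<boxplus> be A \<bullet> \<psi>"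
    using pull_eq_iff[OF P_tri[OF assms(1)] assms(2,3)] assms(4) by blast
  then show ?thesis using assms by (auto intro!: eqv_of_null_sum nullI)
qed

lemma sus_typed:
  assumes "sus f h"
  shows "arr C f" "arr C h" "src C f \<in> \<A>" "tgt C f \<in> \<A>" "src C h = Sg (src C f)"
    "tgt C h = Sg (tgt C f)" "push f (ga (src C f)) = pull h (ga (tgt C f))"
  using assms unfolding suspension_rel_def by auto

lemma susI:
  assumes "arrow C A A' f" "arrow C (Sg A) (Sg A') h" "A \<in> \<A>" "A' \<in> \<A>"
    "push f (ga A) = pull h (ga A')"
  shows "sus f h"
  using assms unfolding suspension_rel_def by blast

text \<open>\<open>al A' f\<close> ends in \<open>\<X>\<close>, so it extends along
  \<open>al A\<close>; the resulting square is completed to a morphism of triangles.\<close>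

lemma sus_ex:
  assumes "arrow C A A' f" "A \<in> \<A>" "A' \<in> \<A>" obtains h where "sus f h"
proof -
  have "arrow C A (XX A') (al A' \<bullet> f)" using assms by simp
  then obtain k where k: "arrow C (XX A) (XX A') k" "al A' \<bullet> f = k \<bullet> al A"
    using monicD[OF al_monic[OF assms(2)] XX_X[OF assms(3)]] by blast
  obtain h where "arrow C (Sg A) (Sg A') h" "push f (ga A) = pull h (ga A')"
    using fill_third[OF P_tri P_tri assms(1) k(1)] k(2) assms by metis
  then show thesis using susI assms that by blast
qed

text \<open>Congruent \<open>f\<close> and \<open>f'\<close> push \<open>ga\<close> to the same
  class, so \<open>h\<close> and \<open>h'\<close> pull \<open>ga\<close> back to the same
  class.\<close>

lemma sus_unique:
  assumes "sus f h" "sus f' h'" "eqv f f'" shows "eqv h h'"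
proof -
  note s = sus_typed[OF assms(1)] and s' = sus_typed[OF assms(2)] and e = eqvD[OF assms(3)]
  have "push f (ga (src C f)) = push f' (ga (src C f))"
    using push_ga_eq_iff[of "src C f" "tgt C f" f f'] s s' e assms(3) by simp
  then have "pull h (ga (tgt C f)) = pull h' (ga (tgt C f))" using s(7) s'(7) e by simp
  then show ?thesis
    using pull_ga_eq[of "tgt C f" "Sg (src C f)" h h'] s(1-6) s'(1-6) e(3,4) by simp
qed

lemma Fob_Susp [simp]: "Fob Susp A = Sg A"
  by (simp add: ext_suspension_def)

text \<open>By \<open>sus_unique\<close> the union defining \<open>Fmor Susp\<close> runs over a
  single class.\<close>

lemma Fmor_Susp: assumes "sus f h" shows "Fmor Susp (cls f) = cls h"
proof -
  have "cls h' = cls h" if "f' \<in> cls f" "sus f' h'" for f' h'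
  proof -
    have "eqv f' f" using that sus_typed(1)[OF assms] by (simp add: cls_eq)
    then show ?thesis using sus_unique[OF that(2) assms] cls_cong by blast
  qed
  then have "{cls h' | f' h'. f' \<in> cls f \<and> sus f' h'} = {cls h}"
    using assms mem_cls sus_typed(1)[OF assms] by blast
  then show ?thesis by (simp add: ext_suspension_def)
qed

lemma sus_comp:
  assumes "sus f h" "sus f' h'" "src C f' = tgt C f" shows "sus (f' \<bullet> f) (h' \<bullet> h)"
proof -
  note s = sus_typed[OF assms(1)] and s' = sus_typed[OF assms(2)]
  have "push (f' \<bullet> f) (ga (src C f)) = push f' (push f (ga (src C f)))"
    using push_push[of "ga (src C f)" "Sg (src C f)" "src C f" "tgt C f" f "tgt C f'" f'] s s' assms(3) by simp
  also have "\<dots> = pull h (push f' (ga (tgt C f)))"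
    using push_pull[of "ga (tgt C f)" "Sg (tgt C f)" "tgt C f" "tgt C f'" f' "Sg (src C f)" h] s s' assms(3)
    by simp
  also have "\<dots> = pull h (pull h' (ga (tgt C f')))" using s'(7) assms(3) by simp
  also have "\<dots> = pull (h' \<bullet> h) (ga (tgt C f'))"
    using pull_pull[of "ga (tgt C f')" "Sg (tgt C f')" "tgt C f'" "Sg (tgt C f)" h' "Sg (src C f)" h]
      s s' assms(3) by simp
  finally show ?thesis
    using s s' assms(3) by (intro susI[of "src C f" "tgt C f'"]) simp_all
qed

lemma sus_ident: "A \<in> \<A> \<Longrightarrow> sus (ident C A) (ident C (Sg A))"
  using push_ident[of "ga A" "Sg A" A] pull_ident[of "ga A" "Sg A" A] by (intro susI[of A A]) simp_all

lemma sus_add: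
  assumes "sus f h" "sus f' h'" "src C f' = src C f" "tgt C f' = tgt C f"
  shows "sus (f \<boxplus> f') (h \<boxplus> h')"
proof -
  note s = sus_typed[OF assms(1)] and s' = sus_typed[OF assms(2)]
  have "push (f \<boxplus> f') (ga (src C f)) = pull (h \<boxplus> h') (ga (tgt C f))"
    using s s' assms(3,4)
    by (intro push_pull_add[of _ "Sg (src C f)" "src C f" _ "Sg (tgt C f)" "tgt C f"]) simp_all
  then show ?thesis using s s' assms(3,4) by (intro susI[of "src C f" "tgt C f"]) simp_all
qed

lemma Susp_cls:
  assumes "arrow D A B F" obtains f h where "F = cls f" "arrow C A B f" "sus f h"
    "Fmor Susp F = cls h" "A \<in> \<A>" "B \<in> \<A>" "arrow C (Sg A) (Sg B) h"
proof -
  obtain f where f: "arrow C A B f" "F = cls f" "A \<in> \<A>" "B \<in> \<A>" using arrow_D_E[OF assms] .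
  obtain h where h: "sus f h" using sus_ex[OF f(1,3,4)] .
  show thesis using that[of f h] f h Fmor_Susp[OF h] sus_typed[OF h] by simp
qed

lemma additive_Susp: "additive_endofunctor D Susp"
  unfolding additive_endofunctor_def
proof (intro conjI ballI)
  fix A assume "A \<in> Ob D"
  then show "Fob Susp A \<in> Ob D" "Fmor Susp (ident D A) = ident D (Fob Susp A)"
    using Fmor_Susp[OF sus_ident] by (simp_all add: D_ident)
next
  fix A B F assume "A \<in> Ob D" "B \<in> Ob D" "F \<in> Mor D A B"
  then have "arrow D A B F" by (intro Q.arrowI)
  then obtain f h where "Fmor Susp F = cls h" "arrow C (Sg A) (Sg B) h" using Susp_cls by metis
  then show "Fmor Susp F \<in> Mor D (Fob Susp A) (Fob Susp B)" by (auto intro: D_MorI)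
next
  fix A B E F F' assume "A \<in> Ob D" "B \<in> Ob D" "E \<in> Ob D" "F \<in> Mor D A B" "F' \<in> Mor D B E"
  then have *: "arrow D A B F" "arrow D B E F'" by (auto intro: Q.arrowI simp del: Q.arrow_iff)
  obtain f h where f: "F = cls f" "arrow C A B f" "sus f h"
    "Fmor Susp F = cls h" "A \<in> \<A>" "B \<in> \<A>" "arrow C (Sg A) (Sg B) h" using Susp_cls[OF *(1)] .
  obtain f' h' where f': "F' = cls f'" "arrow C B E f'" "sus f' h'"
    "Fmor Susp F' = cls h'" "B \<in> \<A>" "E \<in> \<A>" "arrow C (Sg B) (Sg E) h'" using Susp_cls[OF *(2)] .
  show "Fmor Susp (F' \<diamondop> F) = Fmor Susp F' \<diamondop> Fmor Susp F"
    unfolding f(4) f'(4) using Fmor_Susp[OF sus_comp[OF f(3) f'(3)]] f f' by (simp add: cls_comp)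
next
  fix A B F F' assume ob: "A \<in> Ob D" "B \<in> Ob D" and m: "F \<in> Mor D A B" "F' \<in> Mor D A B"
  then have *: "arrow D A B F" "arrow D A B F'" by (auto intro: Q.arrowI simp del: Q.arrow_iff)
  obtain f h where f: "F = cls f" "arrow C A B f" "sus f h"
    "Fmor Susp F = cls h" "A \<in> \<A>" "B \<in> \<A>" "arrow C (Sg A) (Sg B) h" using Susp_cls[OF *(1)] .
  obtain f' h' where f': "F' = cls f'" "arrow C A B f'" "sus f' h'"
    "Fmor Susp F' = cls h'" "A \<in> \<A>" "B \<in> \<A>" "arrow C (Sg A) (Sg B) h'" using Susp_cls[OF *(2)] .
  show "Fmor Susp (F \<oplus>\<^bsub>Hom D A B\<^esub> F') =
      Fmor Susp F \<oplus>\<^bsub>Hom D (Fob Susp A) (Fob Susp B)\<^esub> Fmor Susp F'"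
    using Fmor_Susp[OF sus_add[OF f(3) f'(3)]] f f' D_plus[of A B f f'] D_plus[of "Sg A" "Sg B" h h'] by simp
qed

sublocale QS: endo_category K D Susp
  by unfold_locales (rule additive_Susp)

end

section \<open>Triangles whose first arrow is X-monic\<close>

context suspended
begin

abbreviation clsext where
  "clsext A B E u v w \<equiv> Sext A B E (cls u) (cls v) (cls w)"

text \<open>
  The triangles whose first arrow is \<open>\<X>\<close>-monic give rise to right triangles as well; the sign
  is the one of the third arrow in \<open>pushout\<close>.
\<close>

definition good :: "'o \<Rightarrow> 'o \<Rightarrow> 'o \<Rightarrow> 'm \<Rightarrow> 'm \<Rightarrow> 'm \<Rightarrow> bool" where
  "good A B E u v w \<longleftrightarrow> A \<in> \<A> \<and> B \<in> \<A> \<and> E \<in> \<A> \<and> arrow C E (Sg A) w \<and>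
     tri A B E u v (pull (\<boxminus> w) (ga A)) \<and> monic A B u"

lemma goodD:
  assumes "good A B E u v w"
  shows "A \<in> \<A>" "B \<in> \<A>" "E \<in> \<A>" "arr C u" "src C u = A" "tgt C u = B" "arr C v" "src C v = B"
    "tgt C v = E" "arr C w" "src C w = E" "tgt C w = Sg A"
    "tri A B E u v (pull (\<boxminus> w) (ga A))" "monic A B u"
proof -
  show 1: "A \<in> \<A>" "B \<in> \<A>" "E \<in> \<A>" "tri A B E u v (pull (\<boxminus> w) (ga A))" "monic A B u"
    "arr C w" "src C w = E" "tgt C w = Sg A" using assms unfolding good_def by simp_all
  show "arr C u" "src C u = A" "tgt C u = B" "arr C v" "src C v = B" "tgt C v = E"
    using tri_arrows[OF 1(4)] by simp_all
qed

text \<open>As \<open>u\<close> is X-monic, \<open>al A\<close> extends along it, and the square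
  completes to a map \<open>E -> Sg A\<close> that pulls \<open>ga A\<close> back to \<delta>. Its
  negative is the required \<open>w\<close>.\<close>

lemma good_of_monic:
  assumes "tri A B E u v \<delta>" "monic A B u" "A \<in> \<A>" "B \<in> \<A>"
  obtains w where "good A B E u v w" "pull (\<boxminus> w) (ga A) = \<delta>"
proof -
  have E: "E \<in> \<A>" using cone_mem[OF assms(1,3,4) monic_rel_of_monic[OF assms(2)]] .
  note t = tri_arrows[OF assms(1)] tri_Ob[OF assms(1)]
  obtain k where k: "arrow C B (XX A) k" "al A = k \<bullet> u"
    using monicD[OF assms(2) XX_X[OF assms(3)] al_arrow[OF assms(3)]] .
  have "k \<bullet> u = al A \<bullet> ident C A" using k(2)[symmetric] assms(3) by simp
  then obtain w where w: "arrow C E (Sg A) w" "push (ident C A) \<delta> = pull w (ga A)"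
    using fill_third[OF assms(1) P_tri[OF assms(3)] ident_typed[OF t(3)] k(1)] by blast
  have d: "pull w (ga A) = \<delta>" using w push_ident t by simp
  have "good A B E u v (\<boxminus> w)"
    unfolding good_def using assms E w d by simp
  moreover have "pull (\<boxminus> \<boxminus> w) (ga A) = \<delta>" using w d by simp
  ultimately show thesis by (rule that)
qed

lemma pull_neg_ga_eq:
  assumes "A \<in> \<A>" "arrow C W (Sg A) h" "arrow C W (Sg A) h'"
    "pull (\<boxminus> h) (ga A) = pull (\<boxminus> h') (ga A)"
  shows "eqv h h'"
proof -
  have e: "eqv (\<boxminus> h) (\<boxminus> h')" using pull_ga_eq[OF assms(1) _ _ assms(4)] assms(2,3) by simp
  have "null (\<boxminus> (\<boxminus> h \<boxplus> \<boxminus> \<boxminus> h'))" using null_neg[OF eqvD(5)[OF e]] .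
  then have "null (h \<boxplus> \<boxminus> h')" using assms(2,3) by simp
  then show ?thesis unfolding eqv_def using assms(2,3) by simp
qed

text \<open>Take \<open>u = (f, al A) : A -> B + XX A\<close>. Every morphism from \<open>A\<close>
  to \<open>\<X>\<close> already factors through \<open>al A\<close>, so \<open>u\<close> is
  X-monic; \<open>XX A\<close> is zero in the quotient, so \<open>i\<close> becomes invertible
  there. \<open>pushout\<close> identifies the cone of \<open>u\<close> with the third vertex of the
  standard triangle of \<open>f\<close>.\<close>

lemma standard_good:
  assumes "arrow C A B f" "A \<in> \<A>" "B \<in> \<A>"
  obtains B' i p E u v w where "B' \<in> \<A>" "arrow C B B' i" "arrow C B' B p" "p \<bullet> i = ident C B"
    "eqv (i \<bullet> p) (ident C B')" "eqv u (i \<bullet> f)" "good A B' E u v w"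
    "tri B E (Sg A) (v \<bullet> i) w (push f (ga A))"
proof -
  obtain M i p j q where M: "M \<in> \<A>" "biproduct C M B (XX A) i p j q"
    using A_biproduct[OF assms(3) X_A[OF XX_X[OF assms(2)]]] .
  note bp = biproduct_simps[OF M(2)]
  let ?u = "i \<bullet> f \<boxplus> j \<bullet> al A"
  have u: "arrow C A M ?u" using assms bp by simp
  obtain Z v \<delta> where t: "tri A M Z ?u v \<delta>" using embed_first[OF u] by blast
  obtain s where s: "arrow C Z (Sg A) s" "s \<bullet> v = \<boxminus> (be A \<bullet> q)" "pull (\<boxminus> s) (ga A) = \<delta>"
    "tri B Z (Sg A) (v \<bullet> i) s (push f (ga A))"
    using pushout[OF P_tri[OF assms(2)] assms(1) M(2) t] by blast
  have mon: "monic A M ?u"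
    unfolding monic_def
  proof (intro conjI u ballI allI impI)
    fix Y \<phi> assume Y: "Y \<in> \<X>" "arrow C A Y \<phi>"
    then obtain w where w: "arrow C (XX A) Y w" "\<phi> = w \<bullet> al A" using monicD[OF al_monic[OF assms(2)]] by blast
    then have "\<phi> = (w \<bullet> q) \<bullet> ?u" using assms bp by simp
    moreover have "arrow C M Y (w \<bullet> q)" using w(1) bp by simp
    ultimately show "\<exists>w. arrow C M Y w \<and> \<phi> = w \<bullet> ?u" by blast
  qed
  have "Z \<in> \<A>" using cone_mem[OF t assms(2) M(1) monic_rel_of_monic[OF mon]] .
  then have g: "good A M Z ?u v s" unfolding good_def using assms M s t mon by simp
  have "eqv ?u (i \<bullet> f)"
    using assms bp by (intro eqv_of_null_sum nullI) simp_all
  moreover have "eqv (i \<bullet> p) (ident C M)"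
  proof -
    have "ident C M = i \<bullet> p \<boxplus> j \<bullet> q" using M(2) unfolding biproduct_def by simp
    moreover have "eqv (i \<bullet> p \<boxplus> j \<bullet> q) (i \<bullet> p)"
      using assms bp by (intro eqv_of_null_sum nullI) simp_all
    ultimately show ?thesis using eqv_sym by simp
  qed
  ultimately show thesis using that[OF M(1) _ _ _ _ _ g s(4)] bp by simp
qed

lemma clsext_sextuple:
  assumes "arrow C A B f" "arrow C B E g" "arrow C E (Sg A) h" "A \<in> \<A>" "B \<in> \<A>" "E \<in> \<A>"
  shows "is_sextuple D Susp (clsext A B E f g h)"
  using assms by (simp add: QS.is_sextuple_iff)

lemma stdI:
  assumes "A \<in> \<A>" "B \<in> \<A>" "E \<in> \<A>" "arrow C A B f" "tri B E (Sg A) g h (push f (ga A))"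
  shows "clsext A B E f g h \<in> std"
  using assms unfolding standard_triangles_def by blast

lemma stdE:
  assumes "Sext A B E F G H \<in> std"
  obtains f g h where "F = cls f" "G = cls g" "H = cls h" "A \<in> \<A>" "B \<in> \<A>" "E \<in> \<A>"
    "arrow C A B f" "arrow C B E g" "arrow C E (Sg A) h" "tri B E (Sg A) g h (push f (ga A))"
proof -
  obtain f g h where *: "F = cls f" "G = cls g" "H = cls h" "A \<in> \<A>" "B \<in> \<A>" "E \<in> \<A>"
    "arrow C A B f" "tri B E (Sg A) g h (push f (ga A))"
    using assms unfolding standard_triangles_def by blast
  show thesis using that[OF *(1-7) tri_arrows[OF *(8)] *(8)] .
qed

lemma std_sextuple: "s \<in> std \<Longrightarrow> is_sextuple D Susp s"
  by (cases s) (metis stdE clsext_sextuple)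

lemma std_closure: "s \<in> std \<Longrightarrow> s \<in> iso_closure D Susp std"
  unfolding iso_closure_def using QS.sext_isomorphic_refl std_sextuple by blast

text \<open>The given triangle and the one from \<open>standard_good\<close> both realise the class
  \<open>push f (ga A)\<close>. Comparison maps in both directions come from
  \<open>fill_middle\<close>, and \<open>iso_middle\<close> makes them invertible already in
  \<open>C\<close>.\<close>

lemma std_iso_good:
  assumes "clsext A B E f g h \<in> std" "arrow C A B f" "arrow C B E g" "arrow C E (Sg A) h"
    "tri B E (Sg A) g h (push f (ga A))" "A \<in> \<A>" "B \<in> \<A>" "E \<in> \<A>"
  obtains B' E' u v w where "good A B' E' u v w"
    "sext_isomorphic D Susp (clsext A B E f g h) (clsext A B' E' u v w)"
proof -
  obtain B' i p E' u v w where *: "B' \<in> \<A>" "arrow C B B' i" "arrow C B' B p" "p \<bullet> i = ident C B"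
    "eqv (i \<bullet> p) (ident C B')" "eqv u (i \<bullet> f)" "good A B' E' u v w"
    "tri B E' (Sg A) (v \<bullet> i) w (push f (ga A))"
    using standard_good[OF assms(2,6,7)] .
  note gd = goodD[OF *(7)]
  have pe: "push f (ga A) \<in> Ex (Sg A) B" using tri_Ob[OF assms(5)] by simp
  have pi: "push (ident C B) (push f (ga A)) = push f (ga A)"
    "pull (ident C (Sg A)) (push f (ga A)) = push f (ga A)"
    using push_ident[OF pe] pull_ident[OF pe] assms(6,7) by simp_all
  have id: "arrow C B B (ident C B)" "arrow C (Sg A) (Sg A) (ident C (Sg A))" using assms(6,7) by simp_all
  obtain c where c: "arrow C E E' c" "c \<bullet> g = (v \<bullet> i) \<bullet> ident C B" "ident C (Sg A) \<bullet> h = w \<bullet> c"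
    using fill_middle[OF assms(5) *(8) id] pi by auto
  obtain c' where c': "arrow C E' E c'" "c' \<bullet> v \<bullet> i = g \<bullet> ident C B" "ident C (Sg A) \<bullet> w = h \<bullet> c'"
    using fill_middle[OF *(8) assms(5) id] pi by auto
  note T = assms(2-4,6-8) *(1-3) gd c(1) c'(1)
  have e: "c \<bullet> g = v \<bullet> i" "w \<bullet> c = h" "c' \<bullet> v \<bullet> i = g" "h \<bullet> c' = w"
    using T c(2,3) c'(2,3) by simp_all
  have "is_iso C E E (c' \<bullet> c)"
    by (rule iso_middle[OF assms(5)]) (use T in \<open>simp_all add: e e(4)[THEN comp_reassoc]\<close>)
  moreover have "is_iso C E' E' (c \<bullet> c')"
    by (rule iso_middle[OF *(8)]) (use T in \<open>simp_all add: e e(2)[THEN comp_reassoc]\<close>)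
  ultimately have "is_iso C E E' c" using is_iso_of_iso_comps c(1) c'(1) by blast
  then have ic: "is_iso D E E' (cls c)" using cls_is_iso_of_iso T by blast
  have ii: "is_iso D B B' (cls i)" using * assms by (intro cls_is_isoI[of _ _ _ p]) (simp_all add: eqv_refl)
  have iA: "is_iso D A A (cls (ident C A))" using assms(6) Q.is_iso_ident[of A] by (simp add: D_ident)
  have "sext_isomorphic D Susp (clsext A B E f g h) (clsext A B' E' u v w)"
  proof (rule QS.sext_isomorphicI[OF _ _ iA ii ic])
    show "is_sextuple D Susp (clsext A B E f g h)" "is_sextuple D Susp (clsext A B' E' u v w)"
      using T by (simp_all add: clsext_sextuple)
    show "cls i \<diamondop> cls f = cls u \<diamondop> cls (ident C A)"
      using T cls_cong[OF *(6)] by (simp add: cls_comp)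
    show "cls c \<diamondop> cls g = cls v \<diamondop> cls i" using T e by (simp add: cls_comp)
    show "Fmor Susp (cls (ident C A)) \<diamondop> cls h = cls w \<diamondop> cls c"
      using T Fmor_Susp[OF sus_ident[OF assms(6)]] e by (simp add: cls_comp)
  qed
  then show thesis using that *(7) by blast
qed

text \<open>Although \<open>u\<close> is already X-monic, it is enlarged once more to
  \<open>u' = (u, al A)\<close>, whose cone \<open>Z\<close> belongs to a standard triangle. The
  cones \<open>E\<close> and \<open>Z\<close> are compared through \<open>p u' = u\<close> in one
  direction and through an extension \<open>k\<close> of \<open>al A\<close> along \<open>u\<close>
  in the other; the comparison is invertible in the quotient.\<close>

lemma good_in_closure:
  assumes "good A B E u v w" shows "clsext A B E u v w \<in> iso_closure D Susp std"
proof -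
  note gd = goodD[OF assms]
  let ?\<delta> = "pull (\<boxminus> w) (ga A)"
  obtain M i p j q where M: "M \<in> \<A>" "biproduct C M B (XX A) i p j q"
    using A_biproduct[OF gd(2) X_A[OF XX_X[OF gd(1)]]] .
  note bp = biproduct_simps[OF M(2)]
  define u' where "u' = i \<bullet> u \<boxplus> j \<bullet> al A"
  have u': "arrow C A M u'" unfolding u'_def using gd bp by simp
  obtain Z v' \<delta>' where t: "tri A M Z u' v' \<delta>'" using embed_first[OF u'] by blast
  obtain s where s: "arrow C Z (Sg A) s" "pull (\<boxminus> s) (ga A) = \<delta>'"
    "tri B Z (Sg A) (v' \<bullet> i) s (push u (ga A))"
    using pushout[OF P_tri[OF gd(1)] _ M(2) t[unfolded u'_def], of] gd by (auto simp: u'_def)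
  obtain k where k: "arrow C B (XX A) k" "al A = k \<bullet> u"
    using monicD[OF gd(14) XX_X[OF gd(1)] al_arrow[OF gd(1)]] .
  have mon: "monic A M u'"
    unfolding monic_def
  proof (intro conjI u' ballI allI impI)
    fix Y \<phi> assume Y: "Y \<in> \<X>" "arrow C A Y \<phi>"
    then obtain x where x: "arrow C (XX A) Y x" "\<phi> = x \<bullet> al A" using monicD[OF al_monic[OF gd(1)]] by blast
    then have "\<phi> = (x \<bullet> q) \<bullet> u'" using gd bp unfolding u'_def by simp
    moreover have "arrow C M Y (x \<bullet> q)" using x(1) bp by simp
    ultimately show "\<exists>x. arrow C M Y x \<and> \<phi> = x \<bullet> u'" by blast
  qed
  have Z: "Z \<in> \<A>" using cone_mem[OF t gd(1) M(1) monic_rel_of_monic[OF mon]] .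
  note tv = tri_arrows[OF t] tri_Ob(4)[OF t]
  have dE: "?\<delta> \<in> Ex E A" using tri_Ob(4)[OF gd(13)] .
  have pi: "push (ident C A) \<delta>' = \<delta>'" "push (ident C A) ?\<delta> = ?\<delta>"
    using push_ident[OF tv(3)] push_ident[OF dE] gd Z by simp_all
  have pu': "p \<bullet> u' = u" "q \<bullet> u' = al A" unfolding u'_def using gd bp by simp_all
  have ida: "arrow C A A (ident C A)" using gd by simp
  have "p \<bullet> u' = u \<bullet> ident C A" using gd pu' by simp
  then obtain z where z: "arrow C Z E z" "z \<bullet> v' = v \<bullet> p" "\<delta>' = pull z ?\<delta>"
    using fill_third[OF t gd(13) ida, of p] pi bp by auto
  have "(i \<boxplus> j \<bullet> k) \<bullet> u = u' \<bullet> ident C A"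
    using gd bp k(1) u' by (simp add: k(2)[symmetric]) (simp add: u'_def)
  then obtain z' where z': "arrow C E Z z'" "z' \<bullet> v = v' \<bullet> (i \<boxplus> j \<bullet> k)" "?\<delta> = pull z' \<delta>'"
    using fill_third[OF gd(13) t ida, of "i \<boxplus> j \<bullet> k"] pi bp k(1) by auto
  note T = gd(1-12) bp(1-15) k(1) u' tv(1,2) s(1) z(1) z'(1) M(1) Z
  have iso1: "is_iso C E E (z \<bullet> z')"
  proof (rule iso_third[OF gd(13)])
    show "(z \<bullet> z') \<bullet> v = v"
      using T by (simp add: z'(2) z(2)[THEN comp_reassoc] bp)
    show "pull (z \<bullet> z') ?\<delta> = ?\<delta>"
      using pull_pull[OF dE _ z(1) z'(1)] z(3)[symmetric] z'(3)[symmetric] T by simp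
  qed (use T in simp)
  txt \<open>
    \<open>z' z\<close> need not be invertible, but differs from an automorphism by a morphism through \<open>j\<close>.
  \<close>
  define r where "r = k \<bullet> p \<boxplus> \<boxminus> q"
  have r: "arrow C M (XX A) r" unfolding r_def using T by simp
  have "r \<bullet> u' = zero_mor A (XX A)"
    unfolding r_def using T by (simp add: pu' k(2)[symmetric])
  then obtain y where y: "arrow C Z (XX A) y" "r = y \<bullet> v'" using weak_cokernel[OF t r] by blast
  \<comment> \<open>From \<open>(i + j k) p = 1 + j r\<close> one gets
    \<open>z' z v' = v' + v' j y v'\<close>. Subtracting \<open>v' j y\<close> leaves an
    endomorphism that fixes \<open>v'\<close> and the class \<open>\<delta>'\<close>, as
    \<open>iso_third\<close> demands; the subtracted term passes through
    \<open>XX A\<close>.\<close>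
  let ?c = "z' \<bullet> z \<boxplus> \<boxminus> (v' \<bullet> j \<bullet> y)"
  have "ident C M = i \<bullet> p \<boxplus> j \<bullet> q" using M(2) unfolding biproduct_def by simp
  then have "(i \<boxplus> j \<bullet> k) \<bullet> p = ident C M \<boxplus> j \<bullet> r"
    unfolding r_def using T by (simp add: add_ac)
  then have "v' \<bullet> (i \<boxplus> j \<bullet> k) \<bullet> p = v' \<bullet> (ident C M \<boxplus> j \<bullet> r)" by simp
  also have "\<dots> = v' \<boxplus> v' \<bullet> j \<bullet> y \<bullet> v'" using T y(1) r by (simp add: y(2))
  finally have zv: "(z' \<bullet> z) \<bullet> v' = v' \<boxplus> v' \<bullet> j \<bullet> y \<bullet> v'"
    using T by (simp add: z(2) z'(2)[THEN comp_reassoc])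
  have ty: "arrow C Z Z ?c" using T y(1) by simp
  have iso2: "is_iso C Z Z ?c"
  proof (rule iso_third[OF t ty])
    have "?c \<bullet> v' = (z' \<bullet> z) \<bullet> v' \<boxplus> \<boxminus> (v' \<bullet> j \<bullet> y \<bullet> v')" using T y(1) by simp
    also have "\<dots> = v'" unfolding zv using T y(1) by (simp add: add_assoc)
    finally show "?c \<bullet> v' = v'" .
    have "pull (z' \<bullet> z) \<delta>' = \<delta>'"
      using pull_pull[OF tv(3) _ z'(1) z(1)] z(3)[symmetric] z'(3)[symmetric] T by simp
    moreover have zz: "arrow C Z Z (z' \<bullet> z)" and jy: "arrow C Z M (j \<bullet> y)" using T y(1) by simp_all
    have "z' \<bullet> z = ?c \<boxplus> v' \<bullet> (j \<bullet> y)" using T y(1) by (simp add: add_assoc)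
    then have "pull (z' \<bullet> z) \<delta>' = pull ?c \<delta>'"
      using iffD2[OF pull_eq_iff[OF t zz ty]] jy by blast
    ultimately show "pull ?c \<delta>' = \<delta>'" by simp
  qed
  have "null (\<boxminus> ((v' \<bullet> j) \<bullet> y))" using T y(1) by (intro null_neg nullI) simp_all
  then have "eqv ?c (z' \<bullet> z)" using T y(1) by (intro eqv_of_null_sum) simp_all
  then have cz: "cls ?c = cls z' \<diamondop> cls z" using T by (simp add: cls_cong cls_comp)
  have "is_iso D Z Z (cls z' \<diamondop> cls z)" "is_iso D E E (cls z \<diamondop> cls z')"
    using cls_is_iso_of_iso[OF iso2 Z Z] cls_is_iso_of_iso[OF iso1] cz T by (simp_all add: cls_comp)
  then have iz: "is_iso D Z E (cls z)"
    using Q.is_iso_of_iso_comps[OF cls_typed[OF z(1)] cls_typed[OF z'(1)]] T by blast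
  have iA: "is_iso D A A (cls (ident C A))" and iB: "is_iso D B B (cls (ident C B))"
    using gd Q.is_iso_ident[of A] Q.is_iso_ident[of B] by (simp_all add: D_ident)
  \<comment> \<open>Both sides are the class of the triangle over \<open>Z\<close>, so the third
    arrows agree modulo \<open>\<X>\<close>.\<close>
  have "pull (\<boxminus> (w \<bullet> z)) (ga A) = pull (\<boxminus> s) (ga A)"
    using pull_pull[of "ga A" "Sg A" A E "\<boxminus> w" Z z] z(3)[symmetric] s(2) T by simp
  then have ws: "eqv (w \<bullet> z) s" using T by (intro pull_neg_ga_eq[of A Z]) simp_all
  have "clsext A B Z u (v' \<bullet> i) s \<in> std" using T s(3) by (intro stdI) simp_all
  moreover have "sext_isomorphic D Susp (clsext A B Z u (v' \<bullet> i) s) (clsext A B E u v w)"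
  proof (rule QS.sext_isomorphicI[OF _ _ iA iB iz])
    show "is_sextuple D Susp (clsext A B Z u (v' \<bullet> i) s)" "is_sextuple D Susp (clsext A B E u v w)"
      using T by (simp_all add: clsext_sextuple)
    show "cls (ident C B) \<diamondop> cls u = cls u \<diamondop> cls (ident C A)" using T by (simp add: cls_comp)
    show "cls z \<diamondop> cls (v' \<bullet> i) = cls v \<diamondop> cls (ident C B)"
      using T by (simp add: cls_comp z(2)[THEN comp_reassoc] bp)
    show "Fmor Susp (cls (ident C A)) \<diamondop> cls s = cls w \<diamondop> cls z"
      using T Fmor_Susp[OF sus_ident[OF gd(1)]] cls_cong[OF ws] by (simp add: cls_comp)
  qed
  ultimately show ?thesis unfolding iso_closure_def by blast
qed

text \<open>For \<phi> from \<open>B\<close> to an object of \<open>\<X>\<close>, the composite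
  \<open>\<phi> f\<close> is null and hence kills \<open>ga A\<close> under push-forward. So \<phi>
  kills the class of the triangle and extends along \<open>g\<close>.\<close>

lemma std_second_monic:
  assumes "tri B E (Sg A) g h (push f (ga A))" "arrow C A B f" "A \<in> \<A>" shows "monic B E g"
  unfolding monic_def
proof (intro conjI ballI allI impI)
  show g: "arrow C B E g" using tri_arrows[OF assms(1)] by blast
  fix Y \<phi> assume Y: "Y \<in> \<X>" "arrow C B Y \<phi>"
  have BY: "B \<in> Ob C" "Y \<in> Ob C" using Y by simp_all
  have "arrow C A Y (\<phi> \<bullet> f)" using Y assms by simp
  then obtain x where x: "arrow C (XX A) Y x" "\<phi> \<bullet> f = x \<bullet> al A"
    using monicD[OF al_monic[OF assms(3)] Y(1)] by blast
  have "null (x \<bullet> al A)" using x(1) assms(3) by (intro nullI) simp_all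
  then have "eqv (\<phi> \<bullet> f) (zero_mor A Y)"
    unfolding x(2) using x(1) assms(3) by (subst eqv_zero_iff) simp_all
  then have "push (\<phi> \<bullet> f) (ga A) = push (zero_mor A Y) (ga A)"
    using assms Y by (subst push_ga_eq_iff[of A Y]) simp_all
  moreover have "push \<phi> (push f (ga A)) = push (\<phi> \<bullet> f) (ga A)"
    using push_push[of "ga A" "Sg A" A B f Y \<phi>] assms Y by simp
  moreover have "push (zero_mor B Y) (push f (ga A)) = push (zero_mor A Y) (ga A)"
    using push_push[of "ga A" "Sg A" A B f Y "zero_mor B Y"] assms BY by simp
  ultimately obtain \<psi> where "arrow C E Y \<psi>" "\<phi> = zero_mor B Y \<boxplus> \<psi> \<bullet> g"
    using push_eq_iff[OF assms(1) Y(2) zero_typed[OF BY]] by auto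
  then show "\<exists>w. arrow C E Y w \<and> \<phi> = w \<bullet> g" using g by auto
qed

text \<open>The square commutes only modulo \<open>\<X>\<close>, but \<open>push\<close> of
  \<open>ga A\<close> does not see the difference. Compatibility of the classes is therefore exact,
  and \<open>fill_middle\<close> yields the third component directly.\<close>

lemma std_complete:
  assumes "Sext A B E F G H \<in> std" "Sext A' B' E' F' G' H' \<in> std" "arrow D A A' a" "arrow D B B' b"
    "b \<diamondop> F = F' \<diamondop> a"
  shows "\<exists>c. arrow D E E' c \<and> c \<diamondop> G = G' \<diamondop> b \<and> Fmor Susp a \<diamondop> H = H' \<diamondop> c"
proof -
  obtain f g h where f: "F = cls f" "G = cls g" "H = cls h" "A \<in> \<A>" "B \<in> \<A>" "E \<in> \<A>"
    "arrow C A B f" "arrow C B E g" "arrow C E (Sg A) h" "tri B E (Sg A) g h (push f (ga A))"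
    using stdE[OF assms(1)] .
  obtain f' g' h' where f': "F' = cls f'" "G' = cls g'" "H' = cls h'" "A' \<in> \<A>" "B' \<in> \<A>" "E' \<in> \<A>"
    "arrow C A' B' f'" "arrow C B' E' g'" "arrow C E' (Sg A') h'" "tri B' E' (Sg A') g' h' (push f' (ga A'))"
    using stdE[OF assms(2)] .
  obtain x sx where x: "a = cls x" "arrow C A A' x" "sus x sx" "Fmor Susp a = cls sx"
     "arrow C (Sg A) (Sg A') sx"
    using Susp_cls[OF assms(3)] by metis
  obtain y where y: "arrow C B B' y" "b = cls y" using arrow_D_E[OF assms(4)] by metis
  note T = f(4-9) f'(4-9) x(2,5) y(1)
  have "eqv (y \<bullet> f) (f' \<bullet> x)"
    using assms(5) T cls_iff[of "y \<bullet> f" "f' \<bullet> x"] by (simp add: f(1) f'(1) x(1) y(2) cls_comp)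
  then have "push (y \<bullet> f) (ga A) = push (f' \<bullet> x) (ga A)"
    using T by (subst push_ga_eq_iff[of A B']) simp_all
  moreover have "push y (push f (ga A)) = push (y \<bullet> f) (ga A)"
    using push_push[of "ga A" "Sg A" A B f B' y] T by simp
  moreover have "push f' (push x (ga A)) = push (f' \<bullet> x) (ga A)"
    using push_push[of "ga A" "Sg A" A A' x B' f'] T by simp
  moreover have "push x (ga A) = pull sx (ga A')" using sus_typed(7)[OF x(3)] T by simp
  moreover have "push f' (pull sx (ga A')) = pull sx (push f' (ga A'))"
    using push_pull[of "ga A'" "Sg A'" A' B' f' "Sg A" sx] T by simp
  ultimately have "push y (push f (ga A)) = pull sx (push f' (ga A'))" by simp
  then obtain c where c: "arrow C E E' c" "c \<bullet> g = g' \<bullet> y" "sx \<bullet> h = h' \<bullet> c"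
    using fill_middle[OF f(10) f'(10) y(1) x(5)] by blast
  then show ?thesis
    using T by (intro exI[of _ "cls c"]) (simp add: f f' x(4) y(2) cls_comp)
qed

text \<open>The rotated triangle \<open>B -> E -> Sg A\<close> has an X-monic first arrow and the
  class \<open>push f (ga A) = pull s (ga B)\<close>. In \<open>good\<close> this class belongs to
  the third arrow \<open>- s\<close>, which is the sign that rotation requires.\<close>

lemma std_rotate:
  assumes "Sext A B E F G H \<in> std"
  shows "Sext B E (Fob Susp A) G H (\<sim>\<^bsub>D\<^esub> Fmor Susp F) \<in> iso_closure D Susp std"
proof -
  obtain f g h where f: "F = cls f" "G = cls g" "H = cls h" "A \<in> \<A>" "B \<in> \<A>" "E \<in> \<A>"
    "arrow C A B f" "arrow C B E g" "arrow C E (Sg A) h" "tri B E (Sg A) g h (push f (ga A))"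
    using stdE[OF assms(1)] .
  obtain s where s: "sus f s" using sus_ex[OF f(7,4,5)] .
  note ts = sus_typed[OF s]
  have "good B E (Sg A) g h (\<boxminus> s)"
    unfolding good_def using f ts std_second_monic[OF f(10,7,4)] by simp
  from good_in_closure[OF this] show ?thesis
    using f ts by (simp add: Fmor_Susp[OF s] cls_neg)
qed

text \<open>A zero object of the quotient need not be zero in \<open>C\<close>, so the standard
  triangle of \<open>0 : Z -> A\<close> is not trivial on the nose. Its class is zero, which splits
  \<open>g\<close>, and the complement vanishes modulo \<open>\<X>\<close>.\<close>

lemma std_zero:
  assumes "A \<in> Ob D" "zero_object D Z"
  shows "Sext Z A A (czero D Z A) (ident D A) (czero D A (Fob Susp Z)) \<in> iso_closure D Susp std"
proof -
  have AZ: "A \<in> \<A>" "Z \<in> \<A>" using assms Q.zero_object_iff by simp_all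
  let ?f = "zero_mor Z A"
  have zf: "arrow C Z A ?f" using AZ by simp
  obtain B' i p E u v w where "B' \<in> \<A>" "arrow C A B' i" "arrow C B' A p" "p \<bullet> i = ident C A"
    "eqv (i \<bullet> p) (ident C B')" "eqv u (i \<bullet> ?f)"
    and *: "good Z B' E u v w" "tri A E (Sg Z) (v \<bullet> i) w (push ?f (ga Z))"
    using standard_good[OF zf AZ(2,1)] .
  let ?g = "v \<bullet> i"
  have E: "E \<in> \<A>" using goodD[OF *(1)] by simp
  note t = tri_arrows[OF *(2)] tri_Ob(4)[OF *(2)]
  have g: "arr C ?g" "src C ?g = A" "tgt C ?g = E" using t by auto
  have std: "clsext Z A E ?f ?g w \<in> std" using AZ E *(2) by (intro stdI) simp_all
  have p0: "push k (push ?f (ga Z)) = push (k \<bullet> ?f) (ga Z)" if "arrow C A A k" for k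
    using push_push[of "ga Z" "Sg Z" Z A ?f A k] that AZ by simp
  \<comment> \<open>The class of the triangle is itself a push-forward along zero. Identity and zero
    therefore push it to the same class, which produces a retraction of \<open>v i\<close>.\<close>
  have "push (ident C A) (push ?f (ga Z)) = push (zero_mor A A) (push ?f (ga Z))"
    using p0 AZ by simp
  then obtain r where r: "arrow C E A r" "ident C A = zero_mor A A \<boxplus> r \<bullet> ?g"
    using push_eq_iff[OF *(2), of A "ident C A" "zero_mor A A"] AZ by auto
  have rg: "r \<bullet> ?g = ident C A" using r g AZ by (metis arr_comp src_comp tgt_comp zero_add arrow_iff)
  have n: "arrow C E E (ident C E \<boxplus> \<boxminus> (?g \<bullet> r))" using r(1) g E by (simp del: assoc)
  have "?g \<bullet> r \<bullet> ?g = ?g" using rg g AZ by simp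
  then have "(ident C E \<boxplus> \<boxminus> (?g \<bullet> r)) \<bullet> ?g = zero_mor A E"
    using r(1) g E AZ by (simp del: assoc add: assoc[of ?g r ?g])
  then obtain l where l: "arrow C (Sg Z) E l" "ident C E \<boxplus> \<boxminus> (?g \<bullet> r) = l \<bullet> w"
    using weak_cokernel[OF *(2) n] by blast
  \<comment> \<open>An additive functor preserves zero objects, so \<open>w\<close> is null, and
    with it the error \<open>1 - g r = l w\<close> of the splitting.\<close>
  have SZ: "zero_object D (Sg Z)"
  proof -
    have "Fmor Susp (ident D Z) = ident D (Sg Z)" using AZ by (simp add: QS.F_ident)
    moreover have "ident D Z = czero D Z Z" using assms Q.zero_object_iff by simp
    ultimately have "ident D (Sg Z) = czero D (Sg Z) (Sg Z)" using QS.F_zero[of Z Z] AZ by simp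
    then show ?thesis using AZ by (simp add: Q.zero_object_iff)
  qed
  have w0: "cls w = czero D E (Sg Z)" using Q.zero_object_mor(2)[OF SZ cls_typed] t E AZ by simp
  have "cls (l \<bullet> w) = czero D E E"
  proof -
    have "cls (l \<bullet> w) = cls l \<diamondop> cls w" using l(1) t E AZ by (simp add: cls_comp)
    also have "\<dots> = czero D E E" unfolding w0 using l(1) E AZ by simp
    finally show ?thesis .
  qed
  then have "null (l \<bullet> w)"
    using l(1) t E AZ cls_iff[of "l \<bullet> w" "zero_mor E E"] by (simp add: cls_zero eqv_zero_iff)
  then have "eqv (ident C E) (?g \<bullet> r)"
    unfolding l(2)[symmetric] using r(1) g E by (simp add: eqv_def del: assoc)
  then have ir: "is_iso D E A (cls r)"
    using r(1) g rg E AZ by (intro cls_is_isoI[of _ _ _ ?g]) (simp_all add: eqv_refl eqv_sym del: assoc)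
  have iZ: "is_iso D Z Z (ident D Z)" and iA: "is_iso D A A (ident D A)"
    using AZ Q.is_iso_ident by simp_all
  have "sext_isomorphic D Susp (clsext Z A E ?f ?g w)
      (Sext Z A A (czero D Z A) (ident D A) (czero D A (Fob Susp Z)))"
  proof (rule QS.sext_isomorphicI[OF _ _ iZ iA ir])
    show "is_sextuple D Susp (clsext Z A E ?f ?g w)" using std std_sextuple by blast
    show "is_sextuple D Susp (Sext Z A A (czero D Z A) (ident D A) (czero D A (Fob Susp Z)))"
      using AZ by (simp add: QS.is_sextuple_iff)
    show "ident D A \<diamondop> cls ?f = czero D Z A \<diamondop> ident D Z" using AZ by (simp add: cls_zero)
    show "cls r \<diamondop> cls ?g = ident D A \<diamondop> ident D A"
      using AZ r(1) g rg E by (simp add: cls_comp D_ident del: assoc)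
    show "Fmor Susp (ident D Z) \<diamondop> cls w = czero D A (Fob Susp Z) \<diamondop> cls r"
      using AZ r(1) t E SZ by (simp add: w0 QS.F_ident)
  qed
  then show ?thesis using std unfolding iso_closure_def by blast
qed

text \<open>The octahedron in \<open>C\<close> gives equations between classes. Cancelling
  \<open>ga\<close> by \<open>pull_neg_ga_eq\<close> turns those that involve third arrows into
  congruences modulo \<open>\<X>\<close>.\<close>

lemma good_octahedron:
  assumes "good A B E u1 v1 w1" "good B X Y a b c" "good A X Z (a \<bullet> u1) d e"
  obtains s t \<sigma>u \<sigma>v where "arrow C E Z s" "arrow C Z Y t" "s \<bullet> v1 = d \<bullet> a" "eqv (e \<bullet> s) w1"
    "t \<bullet> d = b" "sus u1 \<sigma>u" "eqv (c \<bullet> t) (\<sigma>u \<bullet> e)" "sus v1 \<sigma>v" "good E Z Y s t (\<sigma>v \<bullet> c)"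
proof -
  note g1 = goodD[OF assms(1)] and g2 = goodD[OF assms(2)] and g3 = goodD[OF assms(3)]
  obtain s t where st: "arrow C E Z s" "arrow C Z Y t" "s \<bullet> v1 = d \<bullet> a"
    "pull s (pull (\<boxminus> e) (ga A)) = pull (\<boxminus> w1) (ga A)" "t \<bullet> d = b"
    "pull t (pull (\<boxminus> c) (ga B)) = push u1 (pull (\<boxminus> e) (ga A))"
    "tri E Z Y s t (push v1 (pull (\<boxminus> c) (ga B)))"
    using octahedron[OF g1(13) g2(13) g3(13)] by blast
  obtain \<sigma>u where su: "sus u1 \<sigma>u" using sus_ex[of A B u1] g1 by auto
  obtain \<sigma>v where sv: "sus v1 \<sigma>v" using sus_ex[of B E v1] g1 by auto
  note tu = sus_typed[OF su] and tv = sus_typed[OF sv]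
  note T = g1(1-12) g2(1-12) g3(1-3,7-12) st(1,2) tu(2,5,6) tv(2,5,6)
  have "pull (\<boxminus> (e \<bullet> s)) (ga A) = pull (\<boxminus> w1) (ga A)"
    using pull_pull[of "ga A" "Sg A" A Z "\<boxminus> e" E s] st(4) T by simp
  then have 1: "eqv (e \<bullet> s) w1" using T by (intro pull_neg_ga_eq[of A E]) simp_all
  have "pull (\<boxminus> (c \<bullet> t)) (ga B) = push u1 (pull (\<boxminus> e) (ga A))"
    using pull_pull[of "ga B" "Sg B" B Y "\<boxminus> c" Z t] st(6) T by simp
  also have "\<dots> = pull (\<boxminus> e) (push u1 (ga A))"
    using push_pull[of "ga A" "Sg A" A B u1 Z "\<boxminus> e"] T by simp
  also have "\<dots> = pull (\<boxminus> e) (pull \<sigma>u (ga B))" using tu(7) T by simp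
  also have "\<dots> = pull (\<boxminus> (\<sigma>u \<bullet> e)) (ga B)"
    using pull_pull[of "ga B" "Sg B" B "Sg A" \<sigma>u Z "\<boxminus> e"] T by simp
  finally have 2: "eqv (c \<bullet> t) (\<sigma>u \<bullet> e)" using T by (intro pull_neg_ga_eq[of B Z]) simp_all
  have "pull (\<boxminus> (\<sigma>v \<bullet> c)) (ga E) = pull (\<boxminus> c) (pull \<sigma>v (ga E))"
    using pull_pull[of "ga E" "Sg E" E "Sg B" \<sigma>v Y "\<boxminus> c"] T by simp
  also have "\<dots> = push v1 (pull (\<boxminus> c) (ga B))"
    using tv(7) push_pull[of "ga B" "Sg B" B E v1 Y "\<boxminus> c"] T by simp
  finally have tr: "tri E Z Y s t (pull (\<boxminus> (\<sigma>v \<bullet> c)) (ga E))" using st(7) by simp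
  have cB: "pull (\<boxminus> c) (ga B) \<in> Ex Y B" using tri_Ob(4)[OF g2(13)] .
  \<comment> \<open>For \<phi> into an object of \<open>\<X>\<close>, \<open>\<phi> v1\<close>
    extends along the X-monic \<open>a\<close>, so it kills the class of the second triangle. Hence
    \<phi> kills \<open>push v1\<close> of that class and extends along \<open>s\<close>.\<close>
  have "monic E Z s"
    unfolding monic_def
  proof (intro conjI st(1) ballI allI impI)
    fix W \<phi> assume W: "W \<in> \<X>" "arrow C E W \<phi>"
    have WA: "W \<in> \<A>" using W by simp
    have "arrow C B W (\<phi> \<bullet> v1)" using W T by simp
    then obtain x where x: "arrow C X W x" "\<phi> \<bullet> v1 = x \<bullet> a" using monicD[OF g2(14) W(1)] by blast
    have "push (\<phi> \<bullet> v1) (pull (\<boxminus> c) (ga B)) = push (zero_mor B W) (pull (\<boxminus> c) (ga B))"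
      using push_eq_iff[OF g2(13), of W "\<phi> \<bullet> v1" "zero_mor B W"] x T WA W by auto
    then have "push \<phi> (push v1 (pull (\<boxminus> c) (ga B))) = push (zero_mor E W) (push v1 (pull (\<boxminus> c) (ga B)))"
      using push_push[OF cB, of E v1 W] T W WA by simp
    then obtain \<psi> where "arrow C Z W \<psi>" "\<phi> = zero_mor E W \<boxplus> \<psi> \<bullet> s"
      using push_eq_iff[OF st(7) W(2) zero_typed] T WA by auto
    then show "\<exists>w. arrow C Z W w \<and> \<phi> = w \<bullet> s" using st(1) by auto
  qed
  then have "good E Z Y s t (\<sigma>v \<bullet> c)" unfolding good_def using T tr by simp
  then show thesis using that st(1-3,5) 1 2 su sv by blast
qed

text \<open>Both morphisms are made X-monic in turn, the second one after its source has been
  replaced. The composite is then X-monic too, and \<open>good_octahedron\<close> applies to all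
  three triangles.\<close>

lemma std_octahedral:
  assumes "arrow D A B F" "arrow D B X G"
  shows "\<exists>B' X' i j a' D' g h Y b c Z d e s t.
          is_iso D B B' i \<and> is_iso D X X' j \<and> B' \<in> Ob D \<and> X' \<in> Ob D \<and> arrow D B' X' a' \<and>
          a' \<diamondop> i = j \<diamondop> G \<and>
          Sext A B' D' (i \<diamondop> F) g h \<in> iso_closure D Susp std \<and>
          Sext B' X' Y a' b c \<in> iso_closure D Susp std \<and>
          Sext A X' Z (a' \<diamondop> i \<diamondop> F) d e \<in> iso_closure D Susp std \<and>
          arrow D D' Z s \<and> arrow D Z Y t \<and>
          s \<diamondop> g = d \<diamondop> a' \<and> e \<diamondop> s = h \<and> t \<diamondop> d = b \<and> c \<diamondop> t = Fmor Susp (i \<diamondop> F) \<diamondop> e \<and>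
          Sext D' Z Y s t (Fmor Susp g \<diamondop> c) \<in> iso_closure D Susp std"
proof -
  obtain f where f: "arrow C A B f" "F = cls f" "A \<in> \<A>" "B \<in> \<A>" using arrow_D_E[OF assms(1)] .
  obtain a where a: "arrow C B X a" "G = cls a" "B \<in> \<A>" "X \<in> \<A>" using arrow_D_E[OF assms(2)] .
  obtain B' i p E u1 v1 w1 where 1: "B' \<in> \<A>" "arrow C B B' i" "arrow C B' B p" "p \<bullet> i = ident C B"
    "eqv (i \<bullet> p) (ident C B')" "eqv u1 (i \<bullet> f)" "good A B' E u1 v1 w1"
    using standard_good[OF f(1,3,4)] .
  \<comment> \<open>In the quotient \<open>p\<close> is the inverse of \<open>i\<close>, so
    \<open>a p\<close> is the second morphism transported to the new source
    \<open>B'\<close>.\<close>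
  have ap: "arrow C B' X (a \<bullet> p)" using a 1 by simp
  obtain X' j q Y u2 v2 w2 where 2: "X' \<in> \<A>" "arrow C X X' j" "arrow C X' X q" "q \<bullet> j = ident C X"
    "eqv (j \<bullet> q) (ident C X')" "eqv u2 (j \<bullet> a \<bullet> p)" "good B' X' Y u2 v2 w2"
    using standard_good[OF ap 1(1) a(4)] .
  note g1 = goodD[OF 1(7)] and g2 = goodD[OF 2(7)]
  have mon: "monic A X' (u2 \<bullet> u1)"
    unfolding monic_def
  proof (intro conjI ballI allI impI)
    show "arrow C A X' (u2 \<bullet> u1)" using g1 g2 by simp
    fix W \<phi> assume W: "W \<in> \<X>" "arrow C A W \<phi>"
    obtain x where x: "arrow C B' W x" "\<phi> = x \<bullet> u1" using monicD[OF g1(14) W] .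
    obtain y where y: "arrow C X' W y" "x = y \<bullet> u2" using monicD[OF g2(14) W(1) x(1)] .
    show "\<exists>w. arrow C X' W w \<and> \<phi> = w \<bullet> u2 \<bullet> u1"
      using x(2) y g1(4-6) g2(4-6) by (intro exI[of _ y]) simp
  qed
  have "arrow C A X' (u2 \<bullet> u1)" using g1 g2 by simp
  then obtain Z d \<zeta> where "tri A X' Z (u2 \<bullet> u1) d \<zeta>" using embed_first by blast
  then obtain e where 3: "good A X' Z (u2 \<bullet> u1) d e" using good_of_monic mon f(3) 2(1) by metis
  note g3 = goodD[OF 3]
  obtain s t \<sigma>u \<sigma>v where st: "arrow C E Z s" "arrow C Z Y t" "s \<bullet> v1 = d \<bullet> u2" "eqv (e \<bullet> s) w1"
    "t \<bullet> d = v2" "sus u1 \<sigma>u" "eqv (w2 \<bullet> t) (\<sigma>u \<bullet> e)" "sus v1 \<sigma>v" "good E Z Y s t (\<sigma>v \<bullet> w2)"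
    using good_octahedron[OF 1(7) 2(7) 3] .
  note tu = sus_typed[OF st(6)] and tv = sus_typed[OF st(8)]
  note T = f(1,3,4) a(1,4) 1(1-3) 2(1-3) g1(1-12) g2(1-12) g3(1-3,7-12) st(1,2) tu(2,5,6) tv(2,5,6)
  have uF: "cls i \<diamondop> F = cls u1" using T cls_cong[OF 1(6)] by (simp add: f(2) cls_comp)
  have "eqv (u2 \<bullet> i) ((j \<bullet> a \<bullet> p) \<bullet> i)" using T 2(6) by (intro eqv_comp eqv_refl) simp_all
  then have ui: "cls u2 \<diamondop> cls i = cls j \<diamondop> G"
    using T cls_cong by (simp add: a(2) cls_comp 1(4))
  have uuF: "cls u2 \<diamondop> cls i \<diamondop> F = cls (u2 \<bullet> u1)" unfolding uF using T by (simp add: cls_comp)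
  show ?thesis
  proof (intro exI conjI)
    show "is_iso D B B' (cls i)" using 1 f by (intro cls_is_isoI[of _ _ _ p]) (simp_all add: eqv_refl)
    show "is_iso D X X' (cls j)" using 2 a by (intro cls_is_isoI[of _ _ _ q]) (simp_all add: eqv_refl)
    show "B' \<in> Ob D" "X' \<in> Ob D" "arrow D B' X' (cls u2)" using T by simp_all
    show "cls u2 \<diamondop> cls i = cls j \<diamondop> G" by (rule ui)
    show "Sext A B' E (cls i \<diamondop> F) (cls v1) (cls w1) \<in> iso_closure D Susp std"
      unfolding uF using good_in_closure[OF 1(7)] .
    show "Sext B' X' Y (cls u2) (cls v2) (cls w2) \<in> iso_closure D Susp std"
      using good_in_closure[OF 2(7)] .
    show "Sext A X' Z (cls u2 \<diamondop> cls i \<diamondop> F) (cls d) (cls e) \<in> iso_closure D Susp std"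
      unfolding uuF using good_in_closure[OF 3] .
    show "arrow D E Z (cls s)" "arrow D Z Y (cls t)" using T by simp_all
    show "cls s \<diamondop> cls v1 = cls d \<diamondop> cls u2" using T st(3) by (simp add: cls_comp)
    show "cls e \<diamondop> cls s = cls w1" using T cls_cong[OF st(4)] by (simp add: cls_comp)
    show "cls t \<diamondop> cls d = cls v2" using T st(5) by (simp add: cls_comp)
    show "cls w2 \<diamondop> cls t = Fmor Susp (cls i \<diamondop> F) \<diamondop> cls e"
      unfolding uF Fmor_Susp[OF st(6)] using T cls_cong[OF st(7)] by (simp add: cls_comp)
    show "Sext E Z Y (cls s) (cls t) (Fmor Susp (cls v1) \<diamondop> cls w2) \<in> iso_closure D Susp std"
      unfolding Fmor_Susp[OF st(8)] using T good_in_closure[OF st(9)] by (simp add: cls_comp)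
  qed
qed

theorem right_triangulated_subfactor: "right_triangulated K D Susp (iso_closure D Susp std)"
proof -
  interpret triangle_base K D Susp std
  proof unfold_locales
    fix A B F assume "arrow D A B F"
    then obtain f where f: "arrow C A B f" "F = cls f" "A \<in> \<A>" "B \<in> \<A>" using arrow_D_E by metis
    obtain B' i p E u v w where "good A B' E u v w" "tri B E (Sg A) (v \<bullet> i) w (push f (ga A))"
      using standard_good[OF f(1,3,4)] by metis
    then show "\<exists>E G H. Sext A B E F G H \<in> iso_closure D Susp std"
      using std_closure[OF stdI] f goodD(3) by blast
  qed (rule std_sextuple std_rotate std_complete std_zero std_octahedral; assumption)+
  show ?thesis by (rule right_triangulated_closure)
qed

end

section \<open>The adjunction and the pretriangulation\<close>

lemma (in ideal_quotient) null_op: "ideal_quotient.null (op_cat C) \<X> f \<longleftrightarrow> null f"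
proof -
  interpret op: ideal_quotient K "op_cat C" \<A> \<X> by (rule ideal_quotient_op)
  show ?thesis unfolding null_def op.null_def op_cat_typing op_cat_simps by metis
qed

lemma (in ideal_quotient) eqv_op: "ideal_quotient.eqv (op_cat C) \<X> f g \<longleftrightarrow> eqv f g"
proof -
  interpret op: ideal_quotient K "op_cat C" \<A> \<X> by (rule ideal_quotient_op)
  show ?thesis unfolding eqv_def op.eqv_def op_cat_typing op_cat_add null_op by blast
qed

text \<open>\<open>P'\<close> consists of the loop triangles read in the opposite category: there
  \<open>ob3 (P' A)\<close> plays the part of a suspension of \<open>A\<close>, and
  \<open>losus\<close> and \<open>Loop\<close> are the opposites of \<open>sus\<close> and
  \<open>Susp\<close>.\<close>

locale bisuspended = suspended K C Ex push pull tri \<A> \<X> P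
  for K :: "'k ring" and C :: "('o, 'm, 'k) lincat"
    and Ex :: "'o \<Rightarrow> 'o \<Rightarrow> 'm set" and push pull :: "'m \<Rightarrow> 'm \<Rightarrow> 'm"
    and tri :: "'o \<Rightarrow> 'o \<Rightarrow> 'o \<Rightarrow> 'm \<Rightarrow> 'm \<Rightarrow> 'm \<Rightarrow> bool" and \<A> \<X> :: "'o set"
    and P :: "'o \<Rightarrow> ('o, 'm) sextuple" +
  fixes P' :: "'o \<Rightarrow> ('o, 'm) sextuple"
  assumes op_suspended: "suspended K (op_cat C) (\<lambda>A B. Ex B A) pull push
      (\<lambda>A B D f g \<delta>. tri D B A g f \<delta>) \<A> \<X> P'"
begin

abbreviation Om where "Om A \<equiv> ob3 (P' A)"
abbreviation ka where "ka A \<equiv> ar3 (P' A)"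
abbreviation losus where "losus \<equiv> suspension_rel (op_cat C) pull push \<A> P'"
abbreviation Loop where "Loop \<equiv> ext_suspension (op_cat C) pull push \<A> \<X> P'"
abbreviation lstd where
  "lstd \<equiv> standard_triangles (op_cat C) pull (\<lambda>A B D f g \<delta>. tri D B A g f \<delta>) \<A> \<X> P'"
abbreviation RT where "RT \<equiv> iso_closure D Susp std"
abbreviation LT where "LT \<equiv> iso_closure (op_cat D) Loop lstd"

lemma Om_A [simp]: "A \<in> \<A> \<Longrightarrow> Om A \<in> \<A>"
  by (rule suspended.Sg_A[OF op_suspended])

lemma ka_mem [simp]: "A \<in> \<A> \<Longrightarrow> ka A \<in> Ex A (Om A)"
  by (rule suspended.ga_mem[OF op_suspended])

lemma pull_ka_eq_iff:
  "\<lbrakk>A \<in> \<A>; arrow C W A f; arrow C W A f'\<rbrakk> \<Longrightarrow> pull f (ka A) = pull f' (ka A) \<longleftrightarrow> eqv f f'"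
  using suspended.push_ga_eq_iff[OF op_suspended, of A W f f'] by (simp add: eqv_op)

lemma losus_typed:
  assumes "losus f h"
  shows "arr C f" "arr C h" "src C f \<in> \<A>" "tgt C f \<in> \<A>" "src C h = Om (src C f)"
    "tgt C h = Om (tgt C f)" "pull f (ka (tgt C f)) = push h (ka (src C f))"
  using suspended.sus_typed[OF op_suspended assms] by simp_all

lemma Loop_cls:
  assumes "arrow D A B F"
  obtains f h where "F = cls f" "arrow C A B f" "losus f h"
    "Fmor Loop F = cls h" "A \<in> \<A>" "B \<in> \<A>" "arrow C (Om A) (Om B) h"
proof -
  have "arrow (subfactor (op_cat C) \<A> \<X>) B A F" using assms by (simp flip: subfactor_op)
  then show thesis
    using suspended.Susp_cls[OF op_suspended, of B A F] that by (auto simp: mor_class_op)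
qed

lemma Fmor_Loop: "losus f h \<Longrightarrow> Fmor Loop (cls f) = cls h"
  using suspended.Fmor_Susp[OF op_suspended] by (simp add: mor_class_op)

lemma Fob_Loop [simp]: "Fob Loop A = Om A"
  by (rule suspended.Fob_Susp[OF op_suspended])

lemma losus_ex:
  assumes "arrow C A B f" "A \<in> \<A>" "B \<in> \<A>" obtains h where "losus f h"
  using suspended.sus_ex[OF op_suspended, of B A f] assms by auto

text \<open>\<open>\<phi> be A\<close> starts in \<open>\<X>\<close>, so it lifts through the right
  approximation of \<open>B\<close>. Completing this square on the left gives \<psi>.\<close>

lemma transpose_ex:
  assumes "arrow C (Sg A) B \<phi>" "A \<in> \<A>" "B \<in> \<A>"
  obtains \<psi> where "arrow C A (Om B) \<psi>" "push \<psi> (ga A) = pull \<phi> (ka B)"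
proof -
  interpret op: suspended K "op_cat C" "\<lambda>A B. Ex B A" pull push "\<lambda>A B D f g \<delta>. tri D B A g f \<delta>"
    \<A> \<X> P' by (rule op_suspended)
  have "arrow (op_cat C) B (XX A) (\<phi> \<bullet> be A)" using assms by simp
  then obtain k where k: "arrow C (XX A) (ob2 (P' B)) k" "\<phi> \<bullet> be A = ar1 (P' B) \<bullet> k"
    using op.monicD[OF op.al_monic[OF assms(3)] XX_X[OF assms(2)]] by auto
  obtain \<psi> where "arrow C A (Om B) \<psi>" "push \<psi> (ga A) = pull \<phi> (ka B)"
    using fill_first[OF P_tri[OF assms(2)] op.P_tri[OF assms(3)] assms(1) k] by blast
  then show thesis by (rule that)
qed

text \<open>Here the composite of \<psi> with the first arrow of the loop triangle ends in
  \<open>\<X>\<close>, so it extends along \<open>al A\<close>; completing on the right gives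
  \<phi>.\<close>

lemma transpose_ex':
  assumes "arrow C A (Om B) \<psi>" "A \<in> \<A>" "B \<in> \<A>"
  obtains \<phi> where "arrow C (Sg A) B \<phi>" "push \<psi> (ga A) = pull \<phi> (ka B)"
proof -
  interpret op: suspended K "op_cat C" "\<lambda>A B. Ex B A" pull push "\<lambda>A B D f g \<delta>. tri D B A g f \<delta>"
    \<A> \<X> P' by (rule op_suspended)
  have b: "arrow C (Om B) (ob2 (P' B)) (ar2 (P' B))" using op.be_arrow[OF assms(3)] by simp
  then have "arrow C A (ob2 (P' B)) (ar2 (P' B) \<bullet> \<psi>)" using assms by simp
  then obtain k where k: "arrow C (XX A) (ob2 (P' B)) k" "ar2 (P' B) \<bullet> \<psi> = k \<bullet> al A"
    using monicD[OF al_monic[OF assms(2)] op.XX_X[OF assms(3)]] by auto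
  obtain \<phi> where "arrow C (Sg A) B \<phi>" "push \<psi> (ga A) = pull \<phi> (ka B)"
    using fill_third[OF P_tri[OF assms(2)] op.P_tri[OF assms(3)] assms(1) k(1) k(2)[symmetric]] by blast
  then show thesis by (rule that)
qed

end

section \<open>Unit, counit and the compatibility of right and left triangles\<close>

locale adjoint_pair = bisuspended K C Ex push pull tri \<A> \<X> P P'
  for K :: "'k ring" and C :: "('o, 'm, 'k) lincat"
    and Ex :: "'o \<Rightarrow> 'o \<Rightarrow> 'm set" and push pull :: "'m \<Rightarrow> 'm \<Rightarrow> 'm"
    and tri :: "'o \<Rightarrow> 'o \<Rightarrow> 'o \<Rightarrow> 'm \<Rightarrow> 'm \<Rightarrow> 'm \<Rightarrow> bool" and \<A> \<X> :: "'o set"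
    and P P' :: "'o \<Rightarrow> ('o, 'm) sextuple" +
  fixes \<eta> \<epsilon> :: "'o \<Rightarrow> 'm"
  assumes eta: "A \<in> \<A> \<Longrightarrow> arrow C A (Om (Sg A)) (\<eta> A) \<and> push (\<boxminus> \<eta> A) (ga A) = ka (Sg A)"
    and eps: "A \<in> \<A> \<Longrightarrow> arrow C (Sg (Om A)) A (\<epsilon> A) \<and> pull (\<boxminus> \<epsilon> A) (ka A) = ga (Om A)"
begin

lemma eta_simps [simp]:
  assumes "A \<in> \<A>" shows "arr C (\<eta> A)" "src C (\<eta> A) = A" "tgt C (\<eta> A) = Om (Sg A)"
  using eta[OF assms] by simp_all

lemma eps_simps [simp]:
  assumes "A \<in> \<A>" shows "arr C (\<epsilon> A)" "src C (\<epsilon> A) = Sg (Om A)" "tgt C (\<epsilon> A) = A"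
  using eps[OF assms] by simp_all

text \<open>Duality exchanges \<open>P\<close> with \<open>P'\<close> and \<eta> with \<epsilon>, so
  each fact about the counit is one about the unit in the opposite category.\<close>

lemma adjoint_pair_op:
  "adjoint_pair K (op_cat C) (\<lambda>A B. Ex B A) pull push (\<lambda>A B D f g \<delta>. tri D B A g f \<delta>) \<A> \<X> P' P \<epsilon> \<eta>"
proof -
  interpret op: suspended K "op_cat C" "\<lambda>A B. Ex B A" pull push "\<lambda>A B D f g \<delta>. tri D B A g f \<delta>"
    \<A> \<X> P' by (rule op_suspended)
  show ?thesis
  proof (intro adjoint_pair.intro bisuspended.intro bisuspended_axioms.intro adjoint_pair_axioms.intro
      op_suspended, unfold op_op_cat op_cat_typing op_cat_add)
    show "suspended K C Ex push pull tri \<A> \<X> P" by unfold_locales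
  qed (use eta eps in blast)+
qed

text \<open>Up to sign both sides push \<open>ga A\<close> forward to the pull-back of
  \<open>ka (Sg B)\<close> along \<open>h\<close>, and by \<open>push_ga_eq_iff\<close> this
  determines them modulo \<open>\<X>\<close>.\<close>

lemma unit_natural:
  assumes "arrow D A B F" shows "cls (\<eta> B) \<diamondop> F = Fmor Loop (Fmor Susp F) \<diamondop> cls (\<eta> A)"
proof -
  obtain f h where f: "F = cls f" "arrow C A B f" "sus f h" "Fmor Susp F = cls h"
    "A \<in> \<A>" "B \<in> \<A>" "arrow C (Sg A) (Sg B) h" using Susp_cls[OF assms] .
  obtain l where l: "losus h l" using losus_ex[OF f(7)] f(5,6) by auto
  note tf = sus_typed[OF f(3)] and tl = losus_typed[OF l]
  note T = f(2,5,6,7) tl(2,5,6)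
  have "push (\<boxminus> (\<eta> B \<bullet> f)) (ga A) = push (\<boxminus> \<eta> B) (push f (ga A))"
    using push_push[of "ga A" "Sg A" A B f "Om (Sg B)" "\<boxminus> \<eta> B"] T by simp
  also have "\<dots> = pull h (push (\<boxminus> \<eta> B) (ga B))"
    using tf(7) push_pull[of "ga B" "Sg B" B "Om (Sg B)" "\<boxminus> \<eta> B" "Sg A" h] T by simp
  also have "\<dots> = push l (push (\<boxminus> \<eta> A) (ga A))" using eta[OF f(5)] eta[OF f(6)] tl(7) T by simp
  also have "\<dots> = push (\<boxminus> (l \<bullet> \<eta> A)) (ga A)"
    using push_push[of "ga A" "Sg A" A "Om (Sg A)" "\<boxminus> \<eta> A" "Om (Sg B)" l] T by simp
  finally have "eqv (\<boxminus> (\<eta> B \<bullet> f)) (\<boxminus> (l \<bullet> \<eta> A))"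
    using T by (subst (asm) push_ga_eq_iff[of A "Om (Sg B)"]) simp_all
  then have "cls (\<boxminus> \<boxminus> (\<eta> B \<bullet> f)) = cls (\<boxminus> \<boxminus> (l \<bullet> \<eta> A))"
    using T cls_cong cls_neg[of "\<boxminus> (\<eta> B \<bullet> f)"] cls_neg[of "\<boxminus> (l \<bullet> \<eta> A)"] by simp
  moreover have "Fmor Loop (Fmor Susp F) = cls l" unfolding f(4) by (rule Fmor_Loop[OF l])
  ultimately show ?thesis using T by (simp add: f(1) cls_comp)
qed

lemma counit_natural:
  assumes "arrow D A B F" shows "F \<diamondop> cls (\<epsilon> A) = cls (\<epsilon> B) \<diamondop> Fmor Susp (Fmor Loop F)"
proof -
  interpret op: adjoint_pair K "op_cat C" "\<lambda>A B. Ex B A" pull push "\<lambda>A B D f g \<delta>. tri D B A g f \<delta>"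
    \<A> \<X> P' P \<epsilon> \<eta> by (rule adjoint_pair_op)
  have "arrow (subfactor (op_cat C) \<A> \<X>) B A F" using assms by (simp flip: subfactor_op)
  from op.unit_natural[OF this] show ?thesis by (simp add: mor_class_op flip: subfactor_op)
qed

text \<open>Let \<open>h\<close> represent the suspension of \<open>\<eta> A\<close>. Negating both
  sides of its defining equation by \<open>push_pull_neg\<close> shows that \<open>ka (Sg A)\<close>
  is its own pull-back along \<open>(- \<epsilon>) (- h) = \<epsilon> h\<close>, whence
  \<open>\<epsilon> h\<close> is congruent to the identity.\<close>

lemma counit_unit:
  assumes "A \<in> \<A>" shows "cls (\<epsilon> (Sg A)) \<diamondop> Fmor Susp (cls (\<eta> A)) = cls (ident C (Sg A))"
proof -
  obtain h where h: "sus (\<eta> A) h" using sus_ex[of A "Om (Sg A)" "\<eta> A"] assms by auto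
  note th = sus_typed[OF h]
  note T = assms th(2,5,6)
  have "push (\<boxminus> \<eta> A) (ga A) = pull (\<boxminus> h) (ga (Om (Sg A)))"
    using push_pull_neg[of "ga A" "Sg A" A "ga (Om (Sg A))" "Sg (Om (Sg A))" "Om (Sg A)" "\<eta> A" h] th(7) T
    by simp
  then have "ka (Sg A) = pull (\<boxminus> h) (pull (\<boxminus> \<epsilon> (Sg A)) (ka (Sg A)))"
    using eta[OF assms] eps[of "Sg A"] T by simp
  also have "\<dots> = pull (\<epsilon> (Sg A) \<bullet> h) (ka (Sg A))"
    using pull_pull[of "ka (Sg A)" "Sg A" "Om (Sg A)" "Sg (Om (Sg A))" "\<boxminus> \<epsilon> (Sg A)" "Sg A" "\<boxminus> h"] T by simp
  finally have "pull (\<epsilon> (Sg A) \<bullet> h) (ka (Sg A)) = pull (ident C (Sg A)) (ka (Sg A))"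
    using pull_ident[of "ka (Sg A)" "Sg A" "Om (Sg A)"] T by simp
  then have "eqv (\<epsilon> (Sg A) \<bullet> h) (ident C (Sg A))"
    using T by (subst (asm) pull_ka_eq_iff[of "Sg A" "Sg A"]) simp_all
  then show ?thesis unfolding Fmor_Susp[OF h] using T by (simp add: cls_comp cls_cong)
qed

lemma loop_counit_unit:
  assumes "A \<in> \<A>" shows "Fmor Loop (cls (\<epsilon> A)) \<diamondop> cls (\<eta> (Om A)) = cls (ident C (Om A))"
proof -
  interpret op: adjoint_pair K "op_cat C" "\<lambda>A B. Ex B A" pull push "\<lambda>A B D f g \<delta>. tri D B A g f \<delta>"
    \<A> \<X> P' P \<epsilon> \<eta> by (rule adjoint_pair_op)
  from op.counit_unit[OF assms] show ?thesis by (simp add: mor_class_op flip: subfactor_op)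
qed

lemma adjunction_Susp_Loop: "adjunction D Susp Loop (\<lambda>A. cls (\<eta> A)) (\<lambda>A. cls (\<epsilon> A))"
  unfolding adjunction_def
proof (intro conjI ballI)
  fix A assume "A \<in> Ob D"
  then have A: "A \<in> \<A>" by simp
  show "cls (\<eta> A) \<in> Mor D A (Fob Loop (Fob Susp A))" using A by (auto intro!: D_MorI)
  show "cls (\<epsilon> A) \<in> Mor D (Fob Susp (Fob Loop A)) A" using A by (auto intro!: D_MorI)
  show "cls (\<epsilon> (Fob Susp A)) \<diamondop> Fmor Susp (cls (\<eta> A)) = ident D (Fob Susp A)"
    using counit_unit[OF A] by (simp add: D_ident)
  show "Fmor Loop (cls (\<epsilon> A)) \<diamondop> cls (\<eta> (Fob Loop A)) = ident D (Fob Loop A)"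
    using loop_counit_unit[OF A] by (simp add: D_ident)
next
  fix A B F assume "A \<in> Ob D" "B \<in> Ob D" "F \<in> Mor D A B"
  then have F: "arrow D A B F" by (rule Q.arrowI)
  show "cls (\<eta> B) \<diamondop> F = Fmor Loop (Fmor Susp F) \<diamondop> cls (\<eta> A)" by (rule unit_natural[OF F])
  show "F \<diamondop> cls (\<epsilon> A) = cls (\<epsilon> B) \<diamondop> Fmor Susp (Fmor Loop F)" by (rule counit_natural[OF F])
qed

text \<open>Fill-in problems are solved over these representatives, whose X-monic first arrow allows
  a square to be corrected.\<close>

lemma RT_goodE:
  assumes "Sext A B E F G H \<in> RT"
  obtains A0 B0 E0 u v w where "good A0 B0 E0 u v w"
    "sext_isomorphic D Susp (clsext A0 B0 E0 u v w) (Sext A B E F G H)"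
proof -
  obtain s where s: "s \<in> std" "sext_isomorphic D Susp s (Sext A B E F G H)"
    using assms unfolding iso_closure_def by blast
  obtain A1 B1 E1 F1 G1 H1 where s1: "s = Sext A1 B1 E1 F1 G1 H1" by (cases s)
  obtain f g h where f: "F1 = cls f" "G1 = cls g" "H1 = cls h" "A1 \<in> \<A>" "B1 \<in> \<A>" "E1 \<in> \<A>"
    "arrow C A1 B1 f" "arrow C B1 E1 g" "arrow C E1 (Sg A1) h" "tri B1 E1 (Sg A1) g h (push f (ga A1))"
    using stdE s(1) unfolding s1 by metis
  have s2: "s = clsext A1 B1 E1 f g h" using s1 f by simp
  obtain B' E' u v w where g: "good A1 B' E' u v w"
    "sext_isomorphic D Susp (clsext A1 B1 E1 f g h) (clsext A1 B' E' u v w)"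
    using std_iso_good[OF s(1)[unfolded s2] f(7-10,4-6)] .
  show thesis
    using that[OF g(1)] QS.sext_isomorphic_trans[OF QS.sext_isomorphic_sym[OF g(2)] s(2)[unfolded s2]]
    by blast
qed

text \<open>The error \<open>\<beta> u - f1 \<alpha>\<close> equals \<open>y x\<close> with
  \<open>x\<close> ending in \<open>\<X>\<close>, and \<open>x = z u\<close> because
  \<open>u\<close> is X-monic. Replacing \<beta> by \<open>\<beta> - y z\<close> keeps its class and
  makes the square commute, so that \<open>fill_third\<close> applies.\<close>

lemma good_fill:
  assumes "good A B E u v w" "tri (Om E1) A1 B1 f1 g1 (pull h1 (ka E1))" "arrow C B1 E1 h1"
    "A1 \<in> \<A>" "B1 \<in> \<A>" "E1 \<in> \<A>" "arrow C B A1 \<beta>" "sus \<alpha> \<sigma>" "src C \<alpha> = A" "tgt C \<alpha> = Om E1"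
    "eqv (\<beta> \<bullet> u) (f1 \<bullet> \<alpha>)"
  obtains \<gamma> where "arrow C E B1 \<gamma>" "eqv (\<gamma> \<bullet> v) (g1 \<bullet> \<beta>)" "eqv (h1 \<bullet> \<gamma>) (\<epsilon> E1 \<bullet> \<sigma> \<bullet> w)"
proof -
  note gd = goodD[OF assms(1)] and ts = sus_typed[OF assms(8)] and tt = tri_arrows[OF assms(2)]
  note T = gd(1-12) assms(3-7,9,10) ts(1,2,5,6) tt
  obtain x y where xy: "arr C x" "arr C y" "tgt C x \<in> \<X>" "src C y = tgt C x"
    "\<beta> \<bullet> u \<boxplus> \<boxminus> (f1 \<bullet> \<alpha>) = y \<bullet> x"
    using eqvD(5)[OF assms(11)] unfolding null_def by blast
  have st: "src C x = A" "tgt C y = A1"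
    using arg_cong[OF xy(5), of "src C"] arg_cong[OF xy(5), of "tgt C"] T xy(1-4) by simp_all
  obtain z where z: "arrow C B (tgt C x) z" "x = z \<bullet> u" using monicD[OF gd(14) xy(3), of x] xy st gd by auto
  have "\<beta> \<bullet> u = f1 \<bullet> \<alpha> \<boxplus> y \<bullet> x" by (rule iffD1[OF diff_eq_iff xy(5)]) (use T xy(1-4) st in simp_all)
  also have "y \<bullet> x = (y \<bullet> z) \<bullet> u" using T z(1) xy(2,4) by (simp add: z(2)[symmetric])
  finally have bu: "\<beta> \<bullet> u = f1 \<bullet> \<alpha> \<boxplus> (y \<bullet> z) \<bullet> u" .
  let ?n = "y \<bullet> z"
  have n: "arrow C B A1 ?n" using z(1) xy st T by simp
  have "null (\<boxminus> ?n)" using z(1) xy by (intro null_neg nullI) simp_all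
  then have e: "eqv (\<beta> \<boxplus> \<boxminus> ?n) \<beta>" using T n by (intro eqv_of_null_sum) simp_all
  have b': "arrow C B A1 (\<beta> \<boxplus> \<boxminus> ?n)" using T n by simp
  have "(\<beta> \<boxplus> \<boxminus> ?n) \<bullet> u = \<beta> \<bullet> u \<boxplus> \<boxminus> (?n \<bullet> u)" using T n by (simp del: assoc)
  also have "\<dots> = f1 \<bullet> \<alpha>" unfolding bu using T n by (simp add: add_assoc del: assoc)
  finally have bf: "(\<beta> \<boxplus> \<boxminus> ?n) \<bullet> u = f1 \<bullet> \<alpha>" .
  have a: "arrow C A (Om E1) \<alpha>" using T by simp
  obtain \<gamma> where g: "arrow C E B1 \<gamma>" "\<gamma> \<bullet> v = g1 \<bullet> (\<beta> \<boxplus> \<boxminus> ?n)"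
    "push \<alpha> (pull (\<boxminus> w) (ga A)) = pull \<gamma> (pull h1 (ka E1))"
    using fill_third[OF gd(13) assms(2) a b' bf] by blast
  \<comment> \<open>The sign in the third arrow of \<open>good\<close> and the sign in the choice of
    \<epsilon> cancel, and a congruence without sign remains.\<close>
  have "pull (h1 \<bullet> \<gamma>) (ka E1) = push \<alpha> (pull (\<boxminus> w) (ga A))"
    using g(3) pull_pull[of "ka E1" E1 "Om E1" B1 h1 E \<gamma>] T g(1) by simp
  also have "\<dots> = pull (\<boxminus> w) (push \<alpha> (ga A))"
    using push_pull[of "ga A" "Sg A" A "Om E1" \<alpha> E "\<boxminus> w"] T by simp
  also have "\<dots> = pull (\<boxminus> w) (pull \<sigma> (pull (\<boxminus> \<epsilon> E1) (ka E1)))" using ts(7) eps T by simp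
  also have "\<dots> = pull (\<boxminus> w) (pull (\<boxminus> (\<epsilon> E1 \<bullet> \<sigma>)) (ka E1))"
    using pull_pull[of "ka E1" E1 "Om E1" "Sg (Om E1)" "\<boxminus> \<epsilon> E1" "Sg A" \<sigma>] T by simp
  also have "\<dots> = pull (\<epsilon> E1 \<bullet> \<sigma> \<bullet> w) (ka E1)"
    using pull_pull[of "ka E1" E1 "Om E1" "Sg A" "\<boxminus> (\<epsilon> E1 \<bullet> \<sigma>)" E "\<boxminus> w"] T by simp
  finally have "eqv (h1 \<bullet> \<gamma>) (\<epsilon> E1 \<bullet> \<sigma> \<bullet> w)"
    using T g(1) by (subst (asm) pull_ka_eq_iff[of E1 E]) simp_all
  moreover have "eqv (\<gamma> \<bullet> v) (g1 \<bullet> \<beta>)"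
    unfolding g(2) using e T n by (intro eqv_comp eqv_refl) simp_all
  ultimately show thesis using that g(1) by blast
qed

text \<open>Both triangles are replaced by representatives, where \<open>good_fill\<close> solves
  the problem. The left triangle is written as a sextuple of the opposite category, so its objects
  and arrows appear in reverse order.\<close>

lemma fill_right:
  assumes "Sext A B E F G H \<in> RT" "Sext E' B' A' H' G' F' \<in> LT"
    "arrow D A (Om E') \<alpha>" "arrow D B A' \<beta>" "\<beta> \<diamondop> F = F' \<diamondop> \<alpha>"
  shows "\<exists>\<gamma>. arrow D E B' \<gamma> \<and> \<gamma> \<diamondop> G = G' \<diamondop> \<beta> \<and> H' \<diamondop> \<gamma> = cls (\<epsilon> E') \<diamondop> Fmor Susp \<alpha> \<diamondop> H"
proof -
  interpret op: suspended K "op_cat C" "\<lambda>A B. Ex B A" pull push "\<lambda>A B D f g \<delta>. tri D B A g f \<delta>"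
    \<A> \<X> P' by (rule op_suspended)
  have opD: "subfactor (op_cat C) \<A> \<X> = op_cat D" by (rule subfactor_op[symmetric])
  obtain A0 B0 E0 u v w where gd: "good A0 B0 E0 u v w"
    and iso: "sext_isomorphic D Susp (clsext A0 B0 E0 u v w) (Sext A B E F G H)"
    using RT_goodE[OF assms(1)] .
  note g = goodD[OF gd]
  obtain a b c a' b' c' where 1:
    "is_sextuple D Susp (clsext A0 B0 E0 u v w)" "is_sextuple D Susp (Sext A B E F G H)"
    "arrow D A0 A a" "arrow D A A0 a'" "a' \<diamondop> a = ident D A0" "a \<diamondop> a' = ident D A"
    "arrow D B0 B b" "arrow D B B0 b'" "b' \<diamondop> b = ident D B0" "b \<diamondop> b' = ident D B"
    "arrow D E0 E c" "arrow D E E0 c'" "c' \<diamondop> c = ident D E0" "c \<diamondop> c' = ident D E"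
    "b \<diamondop> cls u = F \<diamondop> a" "c \<diamondop> cls v = G \<diamondop> b" "Fmor Susp a \<diamondop> cls w = H \<diamondop> c"
    "cls u \<diamondop> a' = b' \<diamondop> F" "cls v \<diamondop> b' = c' \<diamondop> G" "cls w \<diamondop> c' = Fmor Susp a' \<diamondop> H"
    using iso by (rule QS.sext_isomorphicE)
  obtain s where s: "s \<in> lstd" "sext_isomorphic (op_cat D) Loop s (Sext E' B' A' H' G' F')"
    using assms(2) unfolding iso_closure_def by blast
  obtain E1 B1 A1 H1 G1 F1 where s1: "s = Sext E1 B1 A1 H1 G1 F1" by (cases s)
  obtain h1 g1 f1 where f: "H1 = cls h1" "G1 = cls g1" "F1 = cls f1" "E1 \<in> \<A>" "B1 \<in> \<A>" "A1 \<in> \<A>"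
    "arrow C B1 E1 h1" "arrow C A1 B1 g1" "arrow C (Om E1) A1 f1" "tri (Om E1) A1 B1 f1 g1 (pull h1 (ka E1))"
    using op.stdE[OF s(1)[unfolded s1]] unfolding mor_class_op op_cat_typing by metis
  obtain p q r p' q' r' where 2:
    "is_sextuple (op_cat D) Loop (Sext E1 B1 A1 H1 G1 F1)"
    "is_sextuple (op_cat D) Loop (Sext E' B' A' H' G' F')"
    "arrow D E' E1 p" "arrow D E1 E' p'" "p \<diamondop> p' = ident D E1" "p' \<diamondop> p = ident D E'"
    "arrow D B' B1 q" "arrow D B1 B' q'" "q \<diamondop> q' = ident D B1" "q' \<diamondop> q = ident D B'"
    "arrow D A' A1 r" "arrow D A1 A' r'" "r \<diamondop> r' = ident D A1" "r' \<diamondop> r = ident D A'"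
    "H1 \<diamondop> q = p \<diamondop> H'" "G1 \<diamondop> r = q \<diamondop> G'" "F1 \<diamondop> Fmor Loop p = r \<diamondop> F'"
    "p' \<diamondop> H1 = H' \<diamondop> q'"
    using op.QS.sext_isomorphicE[unfolded opD op_cat_typing op_cat_simps, OF s(2)[unfolded s1]] by metis
  have ty2: "arrow D B' E' H'" "arrow D A' B' G'" "arrow D (Om E') A' F'"
    using 2(2) op.QS.is_sextuple_iff[unfolded opD op_cat_typing, of E' B' A' H' G' F'] by simp_all
  have ty1: "arrow D A B F" "arrow D B E G" "arrow D E (Sg A) H" using 1(2) by (simp_all add: QS.is_sextuple_iff)
  have tyg: "arrow D A0 B0 (cls u)" "arrow D B0 E0 (cls v)" "arrow D E0 (Sg A0) (cls w)" using g by simp_all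
  have tyf: "arrow D B1 E1 H1" "arrow D A1 B1 G1" "arrow D (Om E1) A1 F1" using f by simp_all
  obtain pl where Lp: "arrow C (Om E') (Om E1) pl" "Fmor Loop p = cls pl" using Loop_cls[OF 2(3)] by metis
  have E'A: "E' \<in> \<A>" using 2(3) by simp
  have Lpt: "arrow D (Om E') (Om E1) (Fmor Loop p)" using Lp f(4) E'A by simp
  note T = ty1 ty2 tyg tyf Lpt assms(3,4) 1(3,4,7,8,11,12) 2(3,4,7,8,11,12)
  \<comment> \<open>The data \<alpha> and \<beta> transported to the representatives. The map
    \<alpha> ends in a loop object, so \<open>p\<close> enters through \<open>Loop\<close>.\<close>
  let ?\<alpha> = "Fmor Loop p \<diamondop> \<alpha> \<diamondop> a" and ?\<beta> = "r \<diamondop> \<beta> \<diamondop> b"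
  have ab: "arrow D A0 (Om E1) ?\<alpha>" "arrow D B0 A1 ?\<beta>" using T by simp_all
  have sq: "?\<beta> \<diamondop> cls u = F1 \<diamondop> ?\<alpha>"
  proof -
    have "?\<beta> \<diamondop> cls u = r \<diamondop> (\<beta> \<diamondop> F) \<diamondop> a" using T 1(15) by simp
    also have "\<dots> = (r \<diamondop> F') \<diamondop> \<alpha> \<diamondop> a" unfolding assms(5) using T by simp
    also have "\<dots> = F1 \<diamondop> ?\<alpha>" unfolding 2(17)[symmetric] using T by simp
    finally show ?thesis .
  qed
  obtain x sx where x: "?\<alpha> = cls x" "arrow C A0 (Om E1) x" "sus x sx" "Fmor Susp ?\<alpha> = cls sx"
     "arrow C (Sg A0) (Sg (Om E1)) sx"
    using Susp_cls[OF ab(1)] by metis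
  obtain y where y: "arrow C B0 A1 y" "?\<beta> = cls y" using arrow_D_E[OF ab(2)] by metis
  have "cls (y \<bullet> u) = cls (f1 \<bullet> x)" using sq g f(6,9) x y by (simp add: f(3) cls_comp)
  then have "eqv (y \<bullet> u) (f1 \<bullet> x)" using g f(6,9) x y by (subst (asm) cls_iff) simp_all
  then obtain z where z: "arrow C E0 B1 z" "eqv (z \<bullet> v) (g1 \<bullet> y)" "eqv (h1 \<bullet> z) (\<epsilon> E1 \<bullet> sx \<bullet> w)"
    using good_fill[OF gd f(10,7,6,5,4) y(1) x(3)] x(2) by auto
  let ?z = "cls z"
  have tz: "arrow D E0 B1 ?z" using z(1) g f by simp
  have z1: "?z \<diamondop> cls v = G1 \<diamondop> ?\<beta>"
    using cls_cong[OF z(2)] z(1) g f(4-9) y by (simp add: f(2) cls_comp)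
  have z2: "H1 \<diamondop> ?z = cls (\<epsilon> E1) \<diamondop> Fmor Susp ?\<alpha> \<diamondop> cls w"
    using cls_cong[OF z(3)] z(1) g f(4-9) x(2,5) by (simp add: f(1) x(4) cls_comp)
  have te: "arrow D (Sg (Om E1)) E1 (cls (\<epsilon> E1))" "arrow D (Sg (Om E')) E' (cls (\<epsilon> E'))"
    using f(4) E'A by simp_all
  let ?\<gamma> = "q' \<diamondop> ?z \<diamondop> c'"
  have "arrow D E B' ?\<gamma>" using T tz by simp
  moreover have "?\<gamma> \<diamondop> G = G' \<diamondop> \<beta>"
  proof -
    have "?\<gamma> \<diamondop> G = q' \<diamondop> (?z \<diamondop> cls v) \<diamondop> b'" using T tz by (simp add: 1(19))
    also have "\<dots> = q' \<diamondop> (G1 \<diamondop> r) \<diamondop> \<beta> \<diamondop> (b \<diamondop> b')" unfolding z1 using T by simp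
    also have "\<dots> = (q' \<diamondop> q) \<diamondop> G' \<diamondop> \<beta>" unfolding 2(16) 1(10) using T by simp
    also have "\<dots> = G' \<diamondop> \<beta>" unfolding 2(10) using T by simp
    finally show ?thesis .
  qed
  moreover have "H' \<diamondop> ?\<gamma> = cls (\<epsilon> E') \<diamondop> Fmor Susp \<alpha> \<diamondop> H"
  proof -
    have "H' \<diamondop> ?\<gamma> = (H' \<diamondop> q') \<diamondop> ?z \<diamondop> c'" using T tz by simp
    also have "\<dots> = p' \<diamondop> (H1 \<diamondop> ?z) \<diamondop> c'" unfolding 2(18)[symmetric] using T tz by simp
    also have "\<dots> = p' \<diamondop> cls (\<epsilon> E1) \<diamondop> Fmor Susp ?\<alpha> \<diamondop> (cls w \<diamondop> c')"
      unfolding z2 using T te by simp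
    \<comment> \<open>Naturality of the counit moves \<open>p\<close> across \<epsilon>, where it
      cancels against \<open>p'\<close>.\<close>
    also have "\<dots> = p' \<diamondop> (cls (\<epsilon> E1) \<diamondop> Fmor Susp (Fmor Loop p)) \<diamondop> Fmor Susp \<alpha> \<diamondop> (Fmor Susp a \<diamondop> Fmor Susp a') \<diamondop> H"
      unfolding 1(20) using T te by (simp add: QS.F_comp)
    also have "Fmor Susp a \<diamondop> Fmor Susp a' = ident D (Sg A)"
      using QS.F_comp[of a' a] 1(6) T by simp
    also have "cls (\<epsilon> E1) \<diamondop> Fmor Susp (Fmor Loop p) = p \<diamondop> cls (\<epsilon> E')"
      using counit_natural[OF 2(3)] by simp
    also have "p' \<diamondop> (p \<diamondop> cls (\<epsilon> E')) \<diamondop> Fmor Susp \<alpha> \<diamondop> ident D (Sg A) \<diamondop> H =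
        (p' \<diamondop> p) \<diamondop> cls (\<epsilon> E') \<diamondop> Fmor Susp \<alpha> \<diamondop> H"
      using T te by simp
    also have "\<dots> = cls (\<epsilon> E') \<diamondop> Fmor Susp \<alpha> \<diamondop> H" unfolding 2(6) using T te by simp
    finally show ?thesis .
  qed
  ultimately show ?thesis by blast
qed

text \<open>In the opposite category the two triangles exchange their parts, \<delta> and \<gamma>
  take the places of \<alpha> and \<beta>, and the unit is the counit.\<close>

lemma fill_left:
  assumes "Sext A B E F G H \<in> RT" "Sext E' B' A' H' G' F' \<in> LT"
    "arrow D E B' \<gamma>" "arrow D (Sg A) E' \<delta>" "\<delta> \<diamondop> H = H' \<diamondop> \<gamma>"
  shows "\<exists>\<beta>. arrow D B A' \<beta> \<and> G' \<diamondop> \<beta> = \<gamma> \<diamondop> G \<and> \<beta> \<diamondop> F = (F' \<diamondop> Fmor Loop \<delta>) \<diamondop> cls (\<eta> A)"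
proof -
  interpret op: adjoint_pair K "op_cat C" "\<lambda>A B. Ex B A" pull push "\<lambda>A B D f g \<delta>. tri D B A g f \<delta>"
    \<A> \<X> P' P \<epsilon> \<eta> by (rule adjoint_pair_op)
  have opD: "subfactor (op_cat C) \<A> \<X> = op_cat D" by (rule subfactor_op[symmetric])
  show ?thesis
    using op.fill_right[unfolded opD mor_class_op op_cat_typing op_cat_simps op_op_cat,
        of E' B' A' H' G' F' A B E F G H \<delta> \<gamma>] assms by auto
qed

theorem pretriangulation_subfactor:
  "pretriangulation K D Loop Susp (op_sext ` LT) RT (\<lambda>A. cls (\<eta> A)) (\<lambda>A. cls (\<epsilon> A))"
proof (rule pretriangulation.intro)
  interpret op: suspended K "op_cat C" "\<lambda>A B. Ex B A" pull push "\<lambda>A B D f g \<delta>. tri D B A g f \<delta>"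
    \<A> \<X> P' by (rule op_suspended)
  have oo: "op_sext (op_sext s) = s" for s :: "('o, 'm set) sextuple" by (cases s) simp
  have LT: "op_sext t \<in> U" if "t \<in> op_sext ` U" for t :: "('o, 'm set) sextuple" and U
    using that by (auto simp: oo)
  show "right_triangulated K D Susp RT" by (rule right_triangulated_subfactor)
  have "op_sext ` op_sext ` LT = LT" by (simp add: image_image oo)
  then show "left_triangulated K D Loop (op_sext ` LT)"
    unfolding left_triangulated_def using op.right_triangulated_subfactor by (simp flip: subfactor_op)
  show "adjunction D Susp Loop (\<lambda>A. cls (\<eta> A)) (\<lambda>A. cls (\<epsilon> A))" by (rule adjunction_Susp_Loop)
  fix A B E F G H A' B' E' F' G' H'
  assume R: "Sext A B E F G H \<in> RT" and "Sext A' B' E' F' G' H' \<in> op_sext ` LT"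
  then have L: "Sext E' B' A' H' G' F' \<in> LT" using LT[of "Sext A' B' E' F' G' H'" LT] by simp
  have "is_sextuple D Susp (Sext A B E F G H)"
    using R unfolding iso_closure_def sext_isomorphic_def by blast
  then have ob: "A \<in> Ob D" "B \<in> Ob D" "E \<in> Ob D" unfolding is_sextuple_def by simp_all
  have "is_sextuple (op_cat D) Loop (Sext E' B' A' H' G' F')"
    using L unfolding iso_closure_def sext_isomorphic_def by blast
  then have ob': "A' \<in> Ob D" "B' \<in> Ob D" "E' \<in> Ob D" unfolding is_sextuple_def by simp_all
  have ob'': "Fob Loop E' \<in> Ob D" "Fob Susp A \<in> Ob D" using ob ob' by simp_all
  {
    fix \<alpha> \<beta> assume "\<alpha> \<in> Mor D A (Fob Loop E')" "\<beta> \<in> Mor D B A'" and e: "\<beta> \<diamondop> F = F' \<diamondop> \<alpha>"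
    then have ar: "arrow D A (Om E') \<alpha>" "arrow D B A' \<beta>"
      using Q.arrowI[OF ob(1) ob''(1)] Q.arrowI[OF ob(2) ob'(1)] by simp_all
    obtain \<gamma> where \<gamma>: "arrow D E B' \<gamma>" "\<gamma> \<diamondop> G = G' \<diamondop> \<beta>"
      "H' \<diamondop> \<gamma> = cls (\<epsilon> E') \<diamondop> Fmor Susp \<alpha> \<diamondop> H"
      using fill_right[OF R L ar e] by blast
    have "arrow D E (Sg A) H" using \<open>is_sextuple D Susp _\<close> by (simp add: QS.is_sextuple_iff)
    then have "(cls (\<epsilon> E') \<diamondop> Fmor Susp \<alpha>) \<diamondop> H = cls (\<epsilon> E') \<diamondop> Fmor Susp \<alpha> \<diamondop> H"
      using ar ob' by simp
    then show "\<exists>\<gamma> \<in> Mor D E B'. \<gamma> \<diamondop> G = G' \<diamondop> \<beta> \<and> H' \<diamondop> \<gamma> = (cls (\<epsilon> E') \<diamondop> Fmor Susp \<alpha>) \<diamondop> H"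
      using \<gamma> Q.arrow_mem by metis
  next
    fix \<gamma> \<delta> assume "\<gamma> \<in> Mor D E B'" "\<delta> \<in> Mor D (Fob Susp A) E'" and e: "\<delta> \<diamondop> H = H' \<diamondop> \<gamma>"
    then have ar: "arrow D E B' \<gamma>" "arrow D (Sg A) E' \<delta>"
      using Q.arrowI[OF ob(3) ob'(2)] Q.arrowI[OF ob''(2) ob'(3)] by simp_all
    then show "\<exists>\<beta> \<in> Mor D B A'. G' \<diamondop> \<beta> = \<gamma> \<diamondop> G \<and> \<beta> \<diamondop> F = (F' \<diamondop> Fmor Loop \<delta>) \<diamondop> cls (\<eta> A)"
      using fill_left[OF R L ar e] Q.arrow_mem by blast
  }
qed

end

section \<open>Triangulated categories\<close>

context triangulated_category
begin

sublocale endo_category K C F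
  by unfold_locales (rule functor_F)

abbreviation (input) ext where "ext D A \<equiv> Mor C D (Fob F A)"
abbreviation (input) push where "push f \<delta> \<equiv> Fmor F f \<bullet> \<delta>"
abbreviation (input) pull where "pull h \<delta> \<equiv> \<delta> \<bullet> h"
abbreviation (input) tri where "tri A B D f g \<delta> \<equiv> Sext A B D f g \<delta> \<in> N"

lemma N_typed:
  assumes "tri A B D f g h" shows "arrow C A B f" "arrow C B D g" "arrow C D (Fob F A) h"
  using sextuples[OF assms] unfolding is_sextuple_iff by blast+

lemma N_fill:
  assumes "tri A B D f g h" "tri A' B' D' f' g' h'" "arrow C A A' a" "arrow C B B' b" "b \<bullet> f = f' \<bullet> a"
  obtains c where "arrow C D D' c" "c \<bullet> g = g' \<bullet> b" "Fmor F a \<bullet> h = h' \<bullet> c"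
  using complete_morphism[OF assms(1,2) arrow_mem[OF assms(3)] arrow_mem[OF assms(4)] assms(5)]
    sext_morphism_iff[OF sextuples[OF assms(1)] sextuples[OF assms(2)]] by blast

lemma N_rotate: assumes "tri A B D f g h" shows "tri B D (Fob F A) g h (\<boxminus> Fmor F f)"
proof -
  have "\<ominus>\<^bsub>Hom C (Fob F A) (Fob F B)\<^esub> Fmor F f = \<boxminus> Fmor F f"
    using N_typed[OF assms] by (intro neg_eq) (simp_all add: Mor_iff)
  then show ?thesis using rotate[OF assms] by simp
qed

lemma N_rotate_back:
  assumes "arrow C A B f" "arrow C B D g" "arrow C D (Fob F A) h"
    "tri B D (Fob F A) g h (\<boxminus> Fmor F f)"
  shows "tri A B D f g h"
proof -
  have "\<ominus>\<^bsub>Hom C (Fob F A) (Fob F B)\<^esub> Fmor F f = \<boxminus> Fmor F f"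
    using assms by (intro neg_eq) (simp_all add: Mor_iff)
  then show ?thesis using rotate_back[of A B D f g h] assms by (simp add: is_sextuple_iff)
qed

lemma N_rotate2:
  "tri A B D f g h \<Longrightarrow> tri D (Fob F A) (Fob F B) h (\<boxminus> Fmor F f) (\<boxminus> Fmor F g)"
  by (rule N_rotate[OF N_rotate])

text \<open>Serves to come back from triangles whose second and third vertices are shifts, as they
  result from working with rotated triangles.\<close>

lemma N_rotate_back2:
  assumes "arrow C A B f" "arrow C B D g" "arrow C D (Fob F A) h"
    "tri D (Fob F A) (Fob F B) h (\<boxminus> Fmor F f) (\<boxminus> Fmor F g)"
  shows "tri A B D f g h"
  by (rule N_rotate_back[OF assms(1-3) N_rotate_back[OF _ _ _ assms(4)]]) (use assms(1-3) in simp_all)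

lemma N_iso:
  assumes "tri A B D f g h" "is_iso C A A' a" "is_iso C B B' b" "is_iso C D D' c"
    "arrow C A' B' f'" "arrow C B' D' g'" "arrow C D' (Fob F A') h'"
    "b \<bullet> f = f' \<bullet> a" "c \<bullet> g = g' \<bullet> b" "Fmor F a \<bullet> h = h' \<bullet> c"
  shows "tri A' B' D' f' g' h'"
  by (rule iso_closed[OF assms(1) sext_isomorphicI[OF sextuples[OF assms(1)] _ assms(2-4,8-10)]])
     (use assms(5-7) in \<open>simp add: is_sextuple_iff\<close>)

text \<open>Used in \<open>N_iso\<close> at a single vertex, it flips the signs of the two arrows
  that meet there.\<close>

lemma is_iso_neg_ident: "A \<in> Ob C \<Longrightarrow> is_iso C A A (\<boxminus> ident C A)"
  by (rule is_isoI[of _ _ _ "\<boxminus> ident C A"]) simp_all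

section \<open>The shift as a full, faithful and essentially surjective functor, and the exactness
  of triangles\<close>

lemma F_inj:
  assumes "Fmor F f = Fmor F g" "arrow C A B f" "arrow C A B g" shows "f = g"
proof -
  have "inj_on (Fmor F) (Mor C A B)"
    using shift_equivalence assms(2) unfolding autoequivalence_def bij_betw_def by simp
  then show ?thesis using assms arrow_mem inj_onD by metis
qed

lemma F_full:
  assumes "arrow C (Fob F A) (Fob F B) k" "A \<in> Ob C" "B \<in> Ob C"
  obtains f where "arrow C A B f" "k = Fmor F f"
proof -
  have "Fmor F ` Mor C A B = Mor C (Fob F A) (Fob F B)"
    using shift_equivalence assms(2,3) unfolding autoequivalence_def bij_betw_def by blast
  then obtain f where "f \<in> Mor C A B" "k = Fmor F f" using arrow_mem[OF assms(1)] by blast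
  then show thesis using that arrowI assms by blast
qed

lemma F_essentially_surj:
  assumes "B \<in> Ob C" obtains A t where "A \<in> Ob C" "is_iso C (Fob F A) B t"
proof -
  have "\<exists>A \<in> Ob C. isomorphic C (Fob F A) B"
    using shift_equivalence assms unfolding autoequivalence_def by simp
  then show thesis using that unfolding isomorphic_def by auto
qed

text \<open>The first triangle is the identity triangle with the zero object \<open>F Z\<close>,
  rotated back once.\<close>

lemma N_zero:
  assumes "W \<in> Ob C" obtains Z where "Z \<in> Ob C" "tri Z W W (zero_mor Z W) (ident C W) (zero_mor W (Fob F Z))"
    "tri W W Z (ident C W) (zero_mor W Z) (zero_mor Z (Fob F W))"
proof -
  obtain Z where Z: "zero_object C Z" using zero_object_ex .
  then have Zo: "Z \<in> Ob C" and e: "ident C Z = zero_mor Z Z" by (simp_all add: zero_object_iff)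
  have "ident C (Fob F Z) = zero_mor (Fob F Z) (Fob F Z)"
    using Zo arg_cong[OF e, of "Fmor F"] by simp
  then have FZ: "zero_object C (Fob F Z)" using Zo by (simp add: zero_object_iff)
  have "tri Z W W (zero_mor Z W) (ident C W) (zero_mor W (Fob F Z))"
    using identity_triangle[OF assms FZ] assms Zo by - (rule N_rotate_back, simp_all)
  from that[OF Zo this identity_triangle[OF assms Z]] show thesis .
qed

text \<open>Map the identity triangle of \<open>A\<close> to the given one by \<open>(1, f)\<close>:
  then \<open>g f\<close> factors through the zero morphism \<open>A -> Z\<close>.\<close>

lemma N_comp: assumes "tri A B D f g h" shows "g \<bullet> f = zero_mor A D"
proof -
  note t = N_typed[OF assms]
  have A: "A \<in> Ob C" using t by simp
  obtain Z where Z: "Z \<in> Ob C" "tri A A Z (ident C A) (zero_mor A Z) (zero_mor Z (Fob F A))"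
    using N_zero[OF A] .
  obtain c where "arrow C Z D c" and c: "c \<bullet> zero_mor A Z = g \<bullet> f"
    and "Fmor F (ident C A) \<bullet> zero_mor Z (Fob F A) = h \<bullet> c"
    using N_fill[OF Z(2) assms ident_typed[OF A] t(1) refl] .
  then show ?thesis using A by simp
qed

text \<open>Complete \<open>(0, \<phi>)\<close> to a morphism into the triangle
  \<open>Z -> W -> W\<close>.\<close>

lemma N_weak_cokernel:
  assumes "tri A B D f g h" "arrow C B W \<phi>" "\<phi> \<bullet> f = zero_mor A W"
  obtains \<psi> where "arrow C D W \<psi>" "\<phi> = \<psi> \<bullet> g"
proof -
  note t = N_typed[OF assms(1)]
  have W: "W \<in> Ob C" using assms by simp
  obtain Z where Z: "Z \<in> Ob C" "tri Z W W (zero_mor Z W) (ident C W) (zero_mor W (Fob F Z))"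
    using N_zero[OF W] .
  have z: "arrow C A Z (zero_mor A Z)" "\<phi> \<bullet> f = zero_mor Z W \<bullet> zero_mor A Z" using t Z(1) W assms(3) by simp_all
  obtain \<psi> where p: "arrow C D W \<psi>" "\<psi> \<bullet> g = ident C W \<bullet> \<phi>"
    using N_fill[OF assms(1) Z(2) z(1) assms(2) z(2)] .
  then have "\<phi> = \<psi> \<bullet> g" using assms(2) by simp
  then show thesis by (rule that[OF p(1)])
qed

text \<open>Completion only produces third components. The triangle \<open>W -> W -> Z\<close> is
  therefore rotated together with the given one; the component found is a morphism
  \<open>F W -> F A\<close>, and fullness of the shift brings it down to
  \<open>W -> A\<close>.\<close>

lemma N_weak_kernel:
  assumes "tri A B D f g h" "arrow C W B \<phi>" "g \<bullet> \<phi> = zero_mor W D"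
  obtains \<psi> where "arrow C W A \<psi>" "\<phi> = f \<bullet> \<psi>"
proof -
  note t = N_typed[OF assms(1)]
  have W: "W \<in> Ob C" and A: "A \<in> Ob C" using assms(2) t by simp_all
  obtain Z where Z: "Z \<in> Ob C" "tri W W Z (ident C W) (zero_mor W Z) (zero_mor Z (Fob F W))"
    using N_zero[OF W] .
  have z: "arrow C Z D (zero_mor Z D)" "zero_mor Z D \<bullet> zero_mor W Z = g \<bullet> \<phi>"
    using t Z(1) W assms(3) by simp_all
  obtain c where c: "arrow C (Fob F W) (Fob F A) c"
    "Fmor F \<phi> \<bullet> \<boxminus> Fmor F (ident C W) = (\<boxminus> Fmor F f) \<bullet> c"
    using N_fill[OF N_rotate[OF Z(2)] N_rotate[OF assms(1)] assms(2) z] .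
  obtain \<psi> where p: "arrow C W A \<psi>" "c = Fmor F \<psi>" using F_full[OF c(1) W A] .
  have "Fmor F \<phi> = Fmor F (f \<bullet> \<psi>)" using c(2) p t assms(2) by (simp add: F_comp neg_eq_iff)
  then have "\<phi> = f \<bullet> \<psi>" using p t assms(2) by - (rule F_inj[of _ _ W B], simp_all)
  then show thesis using that p(1) by blast
qed

lemma N_comp': assumes "tri A B D f g h" shows "h \<bullet> g = zero_mor B (Fob F A)" "Fmor F f \<bullet> h = zero_mor D (Fob F B)"
proof -
  note t = N_typed[OF assms]
  show "h \<bullet> g = zero_mor B (Fob F A)" by (rule N_comp[OF N_rotate[OF assms]])
  have "\<boxminus> (Fmor F f \<bullet> h) = zero_mor D (Fob F B)" using N_comp[OF N_rotate2[OF assms]] t by simp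
  then have "\<boxminus> \<boxminus> (Fmor F f \<bullet> h) = \<boxminus> zero_mor D (Fob F B)" by (rule arg_cong)
  then show "Fmor F f \<bullet> h = zero_mor D (Fob F B)" using t by simp
qed

text \<open>A difference killed by \<delta> is, after shifting, a morphism out of the middle vertex
  of the twice rotated triangle, so it factors through the shift of \<open>f\<close>; faithfulness
  removes the shift.\<close>

lemma N_push_eq_iff:
  assumes "tri A B D f g \<delta>" "arrow C A W \<phi>" "arrow C A W \<phi>'"
  shows "push \<phi> \<delta> = push \<phi>' \<delta> \<longleftrightarrow> (\<exists>\<psi>. arrow C B W \<psi> \<and> \<phi> = \<phi>' \<boxplus> \<psi> \<bullet> f)"
proof
  note t = N_typed[OF assms(1)]
  have ob: "A \<in> Ob C" "B \<in> Ob C" "W \<in> Ob C" using t assms by simp_all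
  {
    assume e: "push \<phi> \<delta> = push \<phi>' \<delta>"
    let ?n = "\<phi> \<boxplus> \<boxminus> \<phi>'"
    have n: "arrow C A W ?n" using assms by simp
    then have Fn: "arrow C (Fob F A) (Fob F W) (Fmor F ?n)" using F_typed[of ?n] by (simp del: F_arr F_src F_tgt)
    have "Fmor F ?n \<bullet> \<delta> = zero_mor D (Fob F W)"
      using e assms t by (simp add: F_add F_neg)
    then obtain \<psi>' where p: "arrow C (Fob F B) (Fob F W) \<psi>'" "Fmor F ?n = \<psi>' \<bullet> \<boxminus> Fmor F f"
      using N_weak_cokernel[OF N_rotate2[OF assms(1)] Fn] by blast
    obtain \<psi> where q: "arrow C B W \<psi>" "\<psi>' = Fmor F \<psi>" using F_full[OF p(1) ob(2,3)] .
    have "Fmor F ?n = Fmor F ((\<boxminus> \<psi>) \<bullet> f)" unfolding p(2) q(2) using q(1) t by (simp add: F_comp F_neg)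
    then have "?n = (\<boxminus> \<psi>) \<bullet> f" using n q(1) t by - (rule F_inj[of _ _ A W], simp_all)
    then have "\<phi> = \<phi>' \<boxplus> (\<boxminus> \<psi>) \<bullet> f" by (rule iffD1[OF diff_eq_iff, rotated 7]) (use assms q(1) t in simp_all)
    moreover have "arrow C B W (\<boxminus> \<psi>)" using q(1) by simp
    ultimately show "\<exists>\<psi>. arrow C B W \<psi> \<and> \<phi> = \<phi>' \<boxplus> \<psi> \<bullet> f" by blast
  next
    assume "\<exists>\<psi>. arrow C B W \<psi> \<and> \<phi> = \<phi>' \<boxplus> \<psi> \<bullet> f"
    then obtain \<psi> where p: "arrow C B W \<psi>" "\<phi> = \<phi>' \<boxplus> \<psi> \<bullet> f" by blast
    show "push \<phi> \<delta> = push \<phi>' \<delta>"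
      unfolding p(2) using p(1) assms(3) t by (simp add: F_add F_comp N_comp'(2)[OF assms(1)])
  }
qed

text \<open>The difference is annihilated by \<delta>, the second arrow of the rotated triangle, and
  so lifts along its first arrow \<open>g\<close>.\<close>

lemma N_pull_eq_iff:
  assumes "tri A B D f g \<delta>" "arrow C W D \<phi>" "arrow C W D \<phi>'"
  shows "pull \<phi> \<delta> = pull \<phi>' \<delta> \<longleftrightarrow> (\<exists>\<psi>. arrow C W B \<psi> \<and> \<phi> = \<phi>' \<boxplus> g \<bullet> \<psi>)"
proof
  note t = N_typed[OF assms(1)]
  {
    assume e: "pull \<phi> \<delta> = pull \<phi>' \<delta>"
    let ?n = "\<phi> \<boxplus> \<boxminus> \<phi>'"
    have n: "arrow C W D ?n" using assms by simp
    have "\<delta> \<bullet> ?n = zero_mor W (Fob F A)" using e assms t by simp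
    then obtain \<psi> where p: "arrow C W B \<psi>" "?n = g \<bullet> \<psi>"
      using N_weak_kernel[OF N_rotate[OF assms(1)] n] by blast
    have "\<phi> = \<phi>' \<boxplus> g \<bullet> \<psi>" by (rule iffD1[OF diff_eq_iff p(2)]) (use assms p(1) t in simp_all)
    then show "\<exists>\<psi>. arrow C W B \<psi> \<and> \<phi> = \<phi>' \<boxplus> g \<bullet> \<psi>" using p(1) by blast
  next
    assume "\<exists>\<psi>. arrow C W B \<psi> \<and> \<phi> = \<phi>' \<boxplus> g \<bullet> \<psi>"
    then obtain \<psi> where p: "arrow C W B \<psi>" "\<phi> = \<phi>' \<boxplus> g \<bullet> \<psi>" by blast
    show "pull \<phi> \<delta> = pull \<phi>' \<delta>"
      unfolding p(2) using p(1) assms(3) t N_comp'(1)[OF assms(1), THEN comp_reassoc] by simp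
  }
qed

text \<open>After one rotation the missing first component becomes a third component, up to a
  shift.\<close>

lemma N_fill_first:
  assumes "tri A B D f g \<delta>" "tri A' B' D' f' g' \<delta>'" "arrow C D D' c" "arrow C B B' b" "c \<bullet> g = g' \<bullet> b"
  obtains a where "arrow C A A' a" "b \<bullet> f = f' \<bullet> a" "push a \<delta> = pull c \<delta>'"
proof -
  note t = N_typed[OF assms(1)] N_typed[OF assms(2)]
  have ob: "A \<in> Ob C" "A' \<in> Ob C" using t by simp_all
  obtain k where k: "arrow C (Fob F A) (Fob F A') k" "k \<bullet> \<delta> = \<delta>' \<bullet> c"
    "Fmor F b \<bullet> \<boxminus> Fmor F f = (\<boxminus> Fmor F f') \<bullet> k"
    using N_fill[OF N_rotate[OF assms(1)] N_rotate[OF assms(2)] assms(4,3,5)] .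
  obtain a where a: "arrow C A A' a" "k = Fmor F a" using F_full[OF k(1) ob] .
  have "Fmor F (b \<bullet> f) = Fmor F (f' \<bullet> a)" using k(3) a t assms(4) by (simp add: F_comp neg_eq_iff)
  then have "b \<bullet> f = f' \<bullet> a" using a t assms(4) by - (rule F_inj[of _ _ A B'], simp_all)
  then show thesis using that a k(2) by blast
qed

text \<open>After two rotations the missing middle component becomes the third one.\<close>

lemma N_fill_middle:
  assumes "tri A B D f g \<delta>" "tri A' B' D' f' g' \<delta>'" "arrow C A A' a" "arrow C D D' c"
    "push a \<delta> = pull c \<delta>'"
  obtains b where "arrow C B B' b" "b \<bullet> f = f' \<bullet> a" "c \<bullet> g = g' \<bullet> b"
proof -
  note t = N_typed[OF assms(1)] N_typed[OF assms(2)]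
  have ob: "A \<in> Ob C" "A' \<in> Ob C" "B \<in> Ob C" "B' \<in> Ob C" using t by simp_all
  have Fa: "arrow C (Fob F A) (Fob F A') (Fmor F a)" using assms(3) ob by simp
  obtain k where k: "arrow C (Fob F B) (Fob F B') k"
    "k \<bullet> \<boxminus> Fmor F f = (\<boxminus> Fmor F f') \<bullet> Fmor F a"
    "Fmor F c \<bullet> \<boxminus> Fmor F g = (\<boxminus> Fmor F g') \<bullet> k"
    using N_fill[OF N_rotate2[OF assms(1)] N_rotate2[OF assms(2)] assms(4) Fa assms(5)] .
  obtain b where b: "arrow C B B' b" "k = Fmor F b" using F_full[OF k(1) ob(3,4)] .
  have e: "Fmor F (b \<bullet> f) = Fmor F (f' \<bullet> a)" "Fmor F (c \<bullet> g) = Fmor F (g' \<bullet> b)"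
    using k(2,3) b t assms(3,4) by (simp_all add: F_comp neg_eq_iff)
  have "b \<bullet> f = f' \<bullet> a" by (rule F_inj[OF e(1), of A B']) (use b t assms(3,4) in simp_all)
  moreover have "c \<bullet> g = g' \<bullet> b" by (rule F_inj[OF e(2), of B D']) (use b t assms(3,4) in simp_all)
  ultimately show thesis using that b by blast
qed

text \<open>Complete \<open>g\<close> on the right, replace the third vertex by an isomorphic shift
  \<open>F A\<close>, and write the last arrow as \<open>F f\<close>.\<close>

lemma N_embed_second:
  assumes "arrow C B D g" obtains A f \<delta> where "tri A B D f g \<delta>"
proof -
  have ob: "B \<in> Ob C" "D \<in> Ob C" using assms by simp_all
  obtain E h k where E: "tri B D E g h k" using embed[OF ob arrow_mem[OF assms]] by blast
  note t = N_typed[OF E]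
  have Eo: "E \<in> Ob C" using t by simp
  obtain A s where A: "A \<in> Ob C" "is_iso C (Fob F A) E s" using F_essentially_surj[OF Eo] .
  obtain s' where s: "arrow C (Fob F A) E s" "arrow C E (Fob F A) s'" "s' \<bullet> s = ident C (Fob F A)" "s \<bullet> s' = ident C E"
    using is_isoE[OF A(2)] A(1) Eo by auto
  have s': "is_iso C E (Fob F A) s'" using is_isoI[OF s(2,1,4,3)] .
  have T: "tri B D (Fob F A) g (s' \<bullet> h) (k \<bullet> s)"
    by (rule N_iso[OF E is_iso_ident[OF ob(1)] is_iso_ident[OF ob(2)] s'])
       (use t s ob in simp_all)
  have "arrow C (Fob F A) (Fob F B) (k \<bullet> s)" using t s by simp
  then obtain f where f: "arrow C A B f" "k \<bullet> s = Fmor F f" using F_full A(1) ob(1) by blast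
  \<comment> \<open>Rotation negates the shifted arrow, so the first arrow has to be
    \<open>- f\<close>.\<close>
  have "tri A B D (\<boxminus> f) g (s' \<bullet> h)"
    using f t s T ob by - (rule N_rotate_back, simp_all add: F_neg)
  then show thesis by (rule that)
qed

section \<open>The octahedral axiom, its dual, and homotopy pushouts and pullbacks\<close>

lemma N_octahedron:
  assumes "tri A B D f g \<delta>" "tri B X Y a b \<epsilon>" "tri A X Z (a \<bullet> f) d \<zeta>"
  obtains s t where "arrow C D Z s" "arrow C Z Y t" "s \<bullet> g = d \<bullet> a" "pull s \<zeta> = \<delta>"
    "t \<bullet> d = b" "pull t \<epsilon> = push f \<zeta>" "tri D Z Y s t (push g \<epsilon>)"
proof -
  obtain s t where st: "s \<in> Mor C D Z" "t \<in> Mor C Z Y" "s \<bullet> g = d \<bullet> a" "pull s \<zeta> = \<delta>"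
    "t \<bullet> d = b" "pull t \<epsilon> = push f \<zeta>" "tri D Z Y s t (push g \<epsilon>)"
    using octahedral[OF assms] by blast
  have "D \<in> Ob C" "Z \<in> Ob C" "Y \<in> Ob C" using N_typed(2)[OF assms(1)] N_typed(2)[OF assms(2)] N_typed(2)[OF assms(3)] by simp_all
  then show thesis using that[OF arrowI arrowI st(3-)] st(1,2) by blast
qed

text \<open>Rotated once, the three triangles start with \<open>a\<close>, \<open>f\<close> and
  \<open>f a\<close> and form the input of the ordinary octahedron. Its new arrows lie between
  shifts and are brought down by fullness.\<close>

lemma N_octahedron_op:
  assumes "tri D B A g f \<delta>" "tri Y X B b a \<epsilon>" "tri Z X A d (f \<bullet> a) \<zeta>"
  obtains s t where "arrow C Z D s" "arrow C Y Z t" "g \<bullet> s = a \<bullet> d" "push s \<zeta> = \<delta>"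
    "d \<bullet> t = b" "push t \<epsilon> = pull f \<zeta>" "tri Y Z D t s (pull g \<epsilon>)"
proof -
  note T = N_typed[OF assms(1)] N_typed[OF assms(2)] N_typed[OF assms(3)]
  have ob: "D \<in> Ob C" "Y \<in> Ob C" "Z \<in> Ob C" using T by simp_all
  obtain s' t' where st: "arrow C (Fob F Y) (Fob F Z) s'" "arrow C (Fob F Z) (Fob F D) t'"
    "s' \<bullet> \<epsilon> = \<zeta> \<bullet> f" "(\<boxminus> Fmor F d) \<bullet> s' = \<boxminus> Fmor F b" "t' \<bullet> \<zeta> = \<delta>"
    "(\<boxminus> Fmor F g) \<bullet> t' = Fmor F a \<bullet> \<boxminus> Fmor F d"
    "tri (Fob F Y) (Fob F Z) (Fob F D) s' t' (Fmor F \<epsilon> \<bullet> \<boxminus> Fmor F g)"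
    using N_octahedron[OF N_rotate[OF assms(2)] N_rotate[OF assms(1)] N_rotate[OF assms(3)]] .
  obtain t where t: "arrow C Y Z t" "s' = Fmor F t" using F_full[OF st(1) ob(2,3)] .
  obtain s where s: "arrow C Z D s" "t' = Fmor F s" using F_full[OF st(2) ob(3,1)] .
  note T = T t(1) s(1)
  have "Fmor F (d \<bullet> t) = Fmor F b" using st(4) T by (simp add: t(2) F_comp neg_eq_iff)
  then have 1: "d \<bullet> t = b" using T by - (rule F_inj[of _ _ Y X], simp_all)
  have "Fmor F (g \<bullet> s) = Fmor F (a \<bullet> d)" using st(6) T by (simp add: s(2) F_comp neg_eq_iff)
  then have 2: "g \<bullet> s = a \<bullet> d" using T by - (rule F_inj[of _ _ Z B], simp_all)
  have r: "tri D (Fob F Y) (Fob F Z) (\<epsilon> \<bullet> g) (Fmor F t) (Fmor F s)"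
    using st(7) T ob by - (rule N_rotate_back, simp_all add: t(2) s(2) F_comp)
  \<comment> \<open>Multiplication by -1 at \<open>F Z\<close> supplies both signs that rotating
    back twice expects.\<close>
  have "tri D (Fob F Y) (Fob F Z) (\<epsilon> \<bullet> g) (\<boxminus> Fmor F t) (\<boxminus> Fmor F s)"
    by (rule N_iso[OF r is_iso_ident is_iso_ident is_iso_neg_ident]) (use T ob in simp_all)
  then have "tri Y Z D t s (\<epsilon> \<bullet> g)" using T ob by - (rule N_rotate_back2, simp_all)
  then show thesis using that[OF s(1) t(1) 2 _ 1] st(3,5) t(2) s(2) by simp
qed

lemma biproduct_swap: "biproduct C M A B i p j q \<Longrightarrow> biproduct C M B A j q i p"
  unfolding biproduct_def by (auto simp: add_commute[of "j \<bullet> q" "i \<bullet> p"])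

text \<open>Complete \<open>i\<close> to a triangle with third vertex \<open>Q\<close>. As
  \<open>i\<close> is a split monomorphism, the connecting morphism vanishes; hence \<open>h\<close>
  splits, and the comparison of \<open>Q\<close> with \<open>X\<close> is invertible.\<close>

lemma N_biproduct:
  assumes "biproduct C M B X i p j q" shows "tri B M X i q (zero_mor X (Fob F B))"
proof -
  note bp = biproduct_simps[OF assms]
  obtain Q h k where Q: "tri B M Q i h k" using embed[of B M i] bp by (auto simp: Mor_iff)
  note t = N_typed[OF Q]
  have Qo: "Q \<in> Ob C" using t by simp
  have k0: "k = zero_mor Q (Fob F B)"
  proof -
    \<comment> \<open>Insert the identity as \<open>F (p i)\<close> and use that \<open>F i\<close>
      annihilates the connecting morphism.\<close>
    have "k = Fmor F (p \<bullet> i) \<bullet> k" using bp t by simp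
    also have "\<dots> = Fmor F p \<bullet> Fmor F i \<bullet> k" using bp(1-15) t by (simp add: F_comp)
    also have "\<dots> = zero_mor Q (Fob F B)" unfolding N_comp'(2)[OF Q] using bp t by simp
    finally show ?thesis .
  qed
  have qa: "arrow C M X q" using bp by simp
  obtain s where s: "arrow C Q X s" "q = s \<bullet> h" using N_weak_cokernel[OF Q qa bp(18)] .
  have id: "arrow C Q Q (ident C Q)" "arrow C Q Q (zero_mor Q Q)" using Qo by simp_all
  have "k \<bullet> ident C Q = k \<bullet> zero_mor Q Q" unfolding k0 using Qo bp by simp
  then obtain e where e: "arrow C Q M e" "ident C Q = zero_mor Q Q \<boxplus> h \<bullet> e"
    using N_pull_eq_iff[OF Q id] by blast
  have he: "h \<bullet> e = ident C Q" using e t by simp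
  have "ident C M = i \<bullet> p \<boxplus> j \<bullet> q" using assms unfolding biproduct_def by simp
  then have "h = h \<bullet> (i \<bullet> p \<boxplus> j \<bullet> q)" using t by (metis arrow_iff comp_id)
  also have "\<dots> = h \<bullet> j \<bullet> q"
    using t bp N_comp[OF Q, THEN comp_reassoc] by simp
  finally have hj: "h \<bullet> j \<bullet> s \<bullet> h = h" unfolding s(2) ..
  have "(h \<bullet> j) \<bullet> s = (h \<bullet> j \<bullet> s \<bullet> h) \<bullet> e" using he t bp(1-15) s(1) e(1) by simp
  also have "\<dots> = ident C Q" unfolding hj by (rule he)
  finally have hjs: "(h \<bullet> j) \<bullet> s = ident C Q" .
  have "s \<bullet> h \<bullet> j = q \<bullet> j" using s t bp(1-15) by simp
  then have shj: "s \<bullet> h \<bullet> j = ident C X" using bp by simp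
  have "arrow C X Q (h \<bullet> j)" using t bp by simp
  from is_isoI[OF s(1) this hjs shj] have iso: "is_iso C Q X s" .
  show ?thesis
    by (rule N_iso[OF Q is_iso_ident is_iso_ident iso]) (use t bp(1-15) s k0 in simp_all)
qed

text \<open>With \<open>u = (f, \<alpha>)\<close>, this is the octahedron for
  \<open>A -> M -> X\<close>, where \<open>q u = \<alpha>\<close> and the triangle of
  \<open>q\<close> is the rotated split triangle.\<close>

lemma N_pushout:
  assumes "tri A X D \<alpha> \<beta> \<gamma>" "arrow C A B f" "biproduct C M B X i p j q"
    "tri A M Z (i \<bullet> f \<boxplus> j \<bullet> \<alpha>) v \<delta>"
  obtains s where "arrow C Z D s" "s \<bullet> v = \<boxminus> (\<beta> \<bullet> q)" "pull (\<boxminus> s) \<gamma> = \<delta>"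
    "tri B Z D (v \<bullet> i) s (push f \<gamma>)"
proof -
  note bp = biproduct_simps[OF assms(3)]
  let ?u = "i \<bullet> f \<boxplus> j \<bullet> \<alpha>"
  note T = N_typed[OF assms(1)] assms(2) bp(1-15) N_typed(2,3)[OF assms(4)]
  have qu: "q \<bullet> ?u = \<alpha>" and pu: "p \<bullet> ?u = f" using T bp by simp_all
  obtain s t where st: "arrow C Z D s" "arrow C D (Fob F B) t" "s \<bullet> v = \<beta> \<bullet> q" "\<gamma> \<bullet> s = \<delta>"
    "(\<boxminus> Fmor F i) \<bullet> t = Fmor F ?u \<bullet> \<gamma>"
    "tri Z D (Fob F B) s t (Fmor F v \<bullet> \<boxminus> Fmor F i)"
    using N_octahedron[OF assms(4) N_rotate[OF N_biproduct[OF assms(3)]], of D \<beta> \<gamma>]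
    unfolding qu using assms(1) by metis
  have u: "arr C ?u" "src C ?u = A" "tgt C ?u = M" using T by simp_all
  have "t = Fmor F (p \<bullet> i) \<bullet> t" using bp st(2) by simp
  also have "\<dots> = \<boxminus> (Fmor F p \<bullet> (\<boxminus> Fmor F i) \<bullet> t)" using T st(2) by (simp add: F_comp)
  also have "\<dots> = \<boxminus> (Fmor F (p \<bullet> ?u) \<bullet> \<gamma>)"
    unfolding st(5) using T u by (subst F_comp) (simp_all del: comp_add)
  finally have t: "t = \<boxminus> (Fmor F f \<bullet> \<gamma>)" unfolding pu .
  \<comment> \<open>The octahedron yields \<open>t = - (F f \<gamma>)\<close>. Changing the sign at
    \<open>D\<close> makes the class \<open>push f \<gamma>\<close>, at the price of replacing
    \<open>s\<close> by \<open>- s\<close>.\<close>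
  have "tri Z D (Fob F B) (\<boxminus> s) (Fmor F f \<bullet> \<gamma>) (\<boxminus> Fmor F (v \<bullet> i))"
    by (rule N_iso[OF st(6) is_iso_ident is_iso_neg_ident is_iso_ident])
       (use T st(1,2) t in \<open>simp_all add: F_comp\<close>)
  then have "tri B Z D (v \<bullet> i) (\<boxminus> s) (Fmor F f \<bullet> \<gamma>)" using T st(1) by - (rule N_rotate_back, simp_all)
  then show thesis using that[of "\<boxminus> s"] T st(1,3,4) by simp
qed

text \<open>The octahedron for \<open>X -> M -> A\<close> with \<open>u j = \<alpha>\<close>,
  combining the split triangle of \<open>j\<close> with two rotated triangles.\<close>

lemma N_pullback:
  assumes "tri D X A \<beta> \<alpha> \<gamma>" "arrow C B A f" "biproduct C M B X i p j q"
    "tri Z M A v (f \<bullet> p \<boxplus> \<alpha> \<bullet> q) \<delta>"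
  obtains s where "arrow C D Z s" "v \<bullet> s = \<boxminus> (j \<bullet> \<beta>)" "push (\<boxminus> s) \<gamma> = \<delta>"
    "tri D Z B s (p \<bullet> v) (pull f \<gamma>)"
proof -
  note bp = biproduct_simps[OF assms(3)]
  let ?u = "f \<bullet> p \<boxplus> \<alpha> \<bullet> q"
  note T = N_typed[OF assms(1)] assms(2) bp(1-15) N_typed(1,3)[OF assms(4)]
  have ob: "D \<in> Ob C" "Z \<in> Ob C" using T by simp_all
  have uj: "?u \<bullet> j = \<alpha>" and ui: "?u \<bullet> i = f" using T bp by simp_all
  obtain s' t where st: "arrow C B (Fob F D) s'" "arrow C (Fob F D) (Fob F Z) t" "s' \<bullet> p = \<gamma> \<bullet> ?u"
    "t \<bullet> \<gamma> = \<delta>" "(\<boxminus> Fmor F v) \<bullet> t = Fmor F j \<bullet> \<boxminus> Fmor F \<beta>"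
    "tri B (Fob F D) (Fob F Z) s' t (Fmor F p \<bullet> \<boxminus> Fmor F v)"
    using N_octahedron[OF N_biproduct[OF biproduct_swap[OF assms(3)]] N_rotate[OF assms(4)],
        of "Fob F D" \<gamma> "\<boxminus> Fmor F \<beta>"]
    unfolding uj using N_rotate[OF assms(1)] by metis
  obtain s where s: "arrow C D Z s" "t = Fmor F s" using F_full[OF st(2) ob] .
  have "Fmor F (v \<bullet> s) = Fmor F (j \<bullet> \<beta>)" using st(5) T s(1) by (simp add: s(2) F_comp neg_eq_iff)
  then have vs: "v \<bullet> s = j \<bullet> \<beta>" using T s(1) by - (rule F_inj[of _ _ D M], simp_all)
  have u: "arr C ?u" "src C ?u = M" "tgt C ?u = A" using T by simp_all
  have "s' = (s' \<bullet> p) \<bullet> i" using T st(1) bp by simp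
  also have "\<dots> = \<gamma> \<bullet> ?u \<bullet> i" unfolding st(3) using T u by (simp del: comp_add add_comp)
  finally have s': "s' = \<gamma> \<bullet> f" unfolding ui .
  \<comment> \<open>Rotating back twice negates the arrow under the shift, so \<open>- s\<close> is
    the arrow with shift \<open>t\<close> up to that sign.\<close>
  have "tri D Z B (\<boxminus> s) (p \<bullet> v) (\<gamma> \<bullet> f)"
    using st(6) T s by - (rule N_rotate_back2, simp_all add: s' F_neg F_comp)
  then show thesis using that[of "\<boxminus> s"] T s vs st(4) by simp
qed

lemma ext_category_N:
  "ext_category K C (\<lambda>D A. ext D A) (\<lambda>f \<delta>. push f \<delta>) (\<lambda>h \<delta>. pull h \<delta>) (\<lambda>A B D f g \<delta>. tri A B D f g \<delta>)"
proof (unfold_locales, goal_cases)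
  case (1 \<delta> D A A' f) then show ?case by (auto simp: Mor_iff)
next
  case (2 \<delta> D A D' h) then show ?case by (auto simp: Mor_iff)
next
  case (3 \<delta> D A A' f A'' g) then show ?case by (auto simp: Mor_iff F_comp)
next
  case (4 \<delta> D A D' h D'' k) then show ?case by (auto simp: Mor_iff)
next
  case (5 \<delta> D A A' f D' h) then show ?case by (auto simp: Mor_iff)
next
  case (6 \<delta> D A) then show ?case by (auto simp: Mor_iff)
next
  case (7 \<delta> D A) then show ?case by (auto simp: Mor_iff)
next
  case (8 \<delta> D A \<delta>' D' A') then show ?case by (auto simp: Mor_iff)
next
  case (9 \<delta> D A \<delta>' D' A' f h) then show ?case by (auto simp: Mor_iff F_neg)
next
  case (10 \<delta> D A \<delta>' D' A' f f' h h') then show ?case by (auto simp: Mor_iff F_add)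
next
  case (11 A B D f g \<delta>)
  then show ?case using N_typed by (simp add: Mor_iff)
next
  case (12 A B f) then show ?case using embed arrow_mem by auto
next
  case (13 B D g) then show ?case using N_embed_second by blast
next
  case (14 A B D f g \<delta> A' B' D' f' g' \<delta>' a b) then show ?case using N_fill by metis
next
  case (15 A B D f g \<delta> A' B' D' f' g' \<delta>' c b) then show ?case using N_fill_first by metis
next
  case (16 A B D f g \<delta> A' B' D' f' g' \<delta>' a c) then show ?case using N_fill_middle by metis
next
  case (17 A B D f g \<delta>) then show ?case by (rule N_comp)
next
  case (18 A B D f g \<delta> W \<phi>) then show ?case using N_weak_cokernel by metis
next
  case (19 A B D f g \<delta> W \<phi>) then show ?case using N_weak_kernel by metis
next
  case (20 A B D f g \<delta> W \<phi> \<phi>') then show ?case by (rule N_push_eq_iff)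
next
  case (21 A B D f g \<delta> W \<phi> \<phi>') then show ?case by (rule N_pull_eq_iff)
next
  case (22 A B D f g \<delta> X Y a b \<epsilon> Z d \<zeta>)
  show ?case by (rule N_octahedron[OF 22]) blast
next
  case (23 D B A g f \<delta> Y X b a \<epsilon> Z d \<zeta>)
  show ?case by (rule N_octahedron_op[OF 23]) blast
next
  case (24 A X D \<alpha> \<beta> \<gamma> B f M i p j q Z v \<delta>)
  show ?case by (rule N_pushout[OF 24]) blast
next
  case (25 D X A \<beta> \<alpha> \<gamma> B f M i p j q Z v \<delta>)
  show ?case by (rule N_pullback[OF 25]) blast
qed

end

section \<open>The subfactor category of a triangulated category\<close>

text \<open>Unlike in \<open>op_sext\<close>, the third arrow stays in place: it represents the
  class of the triangle, and reversing the category leaves the class as it is.\<close>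

fun rev_sext :: "('o, 'm) sextuple \<Rightarrow> ('o, 'm) sextuple" where
  "rev_sext (Sext A B D f g h) = Sext D B A g f h"

lemma rev_sext_sel [simp]:
  "ob1 (rev_sext s) = ob3 s" "ob2 (rev_sext s) = ob2 s" "ob3 (rev_sext s) = ob1 s"
  "ar1 (rev_sext s) = ar2 s" "ar2 (rev_sext s) = ar1 s" "ar3 (rev_sext s) = ar3 s"
  by (cases s; simp)+

locale triangulated_subfactor = triangulated_category K C F N
  for K :: "'k ring" and C :: "('o, 'm, 'k) lincat" and F :: "('o, 'm) endofunctor" and N +
  fixes \<A> \<X> :: "'o set" and P L :: "'o \<Rightarrow> ('o, 'm) sextuple"
  assumes sub_A: "subcategory C \<A>" and sub_X: "subcategory (full_subcat C \<A>) \<X>"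
    and cones: "monics_have_cones C N \<A> \<X>" and cocones: "epics_have_cocones C N \<A> \<X>"
    and P: "suspension_choice C N \<A> \<X> P" and L: "loop_choice C N \<A> \<X> L"
begin

abbreviation (input) "NEx \<equiv> \<lambda>D A. Mor C D (Fob F A)"
abbreviation (input) "Npush \<equiv> \<lambda>f \<delta>. Fmor F f \<bullet> \<delta>"
abbreviation (input) "Npull \<equiv> \<lambda>h \<delta>. \<delta> \<bullet> h"
abbreviation (input) "Ntri \<equiv> \<lambda>A B D f g \<delta>. Sext A B D f g \<delta> \<in> N"

lemma P_tri:
  assumes "A \<in> \<A>" shows "Sext A (ob2 (P A)) (ob3 (P A)) (ar1 (P A)) (ar2 (P A)) (ar3 (P A)) \<in> N"
  using P assms unfolding suspension_choice_def by (metis sextuple.collapse)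

lemma L_tri:
  assumes "A \<in> \<A>" shows "Sext (ob1 (L A)) (ob2 (L A)) A (ar1 (L A)) (ar2 (L A)) (ar3 (L A)) \<in> N"
  using L assms unfolding loop_choice_def by (metis sextuple.collapse)

lemma ideal_quotient_C: "ideal_quotient K C \<A> \<X>"
  by unfold_locales (rule sub_A sub_X)+

lemma suspended_P: "suspended K C NEx Npush Npull Ntri \<A> \<X> P"
proof (intro suspended.intro ext_category_N ideal_quotient_C suspended_axioms.intro)
  fix A B E f g \<delta> assume "Sext A B E f g \<delta> \<in> N" "A \<in> \<A>" "B \<in> \<A>" "monic_rel C \<X> A B f"
  then show "E \<in> \<A>" using cones unfolding monics_have_cones_def by blast
qed (use P P_tri in \<open>auto simp: suspension_choice_def\<close>)

lemma bisuspended_PL: "bisuspended K C NEx Npush Npull Ntri \<A> \<X> P (\<lambda>A. rev_sext (L A))"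
proof (intro bisuspended.intro suspended_P bisuspended_axioms.intro suspended.intro
    suspended_axioms.intro)
  show "ext_category K (op_cat C) (\<lambda>A B. NEx B A) Npull Npush (\<lambda>A B D f g \<delta>. Ntri D B A g f \<delta>)"
    by (rule ext_category.ext_category_op[OF ext_category_N])
  show "ideal_quotient K (op_cat C) \<A> \<X>"
    by (rule ideal_quotient.ideal_quotient_op[OF ideal_quotient_C])
next
  fix A B E f g \<delta> assume *: "Sext E B A g f \<delta> \<in> N" "A \<in> \<A>" "B \<in> \<A>" "monic_rel (op_cat C) \<X> A B f"
  have "epic_rel C \<X> B A f" using *(4) unfolding monic_rel_def epic_rel_def by simp
  then show "E \<in> \<A>" using * cocones unfolding epics_have_cocones_def by blast
next
  fix A assume A: "A \<in> \<A>"
  show "Sext (ob3 (rev_sext (L A))) (ob2 (rev_sext (L A))) A (ar2 (rev_sext (L A)))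
      (ar1 (rev_sext (L A))) (ar3 (rev_sext (L A))) \<in> N"
    using L_tri[OF A] by simp
  have "right_approximation C \<X> A (ob2 (L A)) (ar2 (L A))"
    using L A unfolding loop_choice_def by blast
  then show "left_approximation (op_cat C) \<X> A (ob2 (rev_sext (L A))) (ar1 (rev_sext (L A)))"
    unfolding left_approximation_def right_approximation_def by simp
qed

sublocale bisuspended K C NEx Npush Npull Ntri \<A> \<X> P "\<lambda>A. rev_sext (L A)"
  by (rule bisuspended_PL)

text \<open>A pair of outer components compatible with the connecting morphisms has a middle
  component by \<open>N_fill_middle\<close>, so both unions range over the same classes.\<close>

lemma suspension_eq: "suspension C F \<A> \<X> P = Susp"
proof -
  have "(\<exists>g A A'. A \<in> \<A> \<and> A' \<in> \<A> \<and> sext_morphism C F (P A) (P A') f g h) \<longleftrightarrow> sus f h" for f h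
  proof
    assume "\<exists>g A A'. A \<in> \<A> \<and> A' \<in> \<A> \<and> sext_morphism C F (P A) (P A') f g h"
    then obtain g A A' where *: "A \<in> \<A>" "A' \<in> \<A>" "sext_morphism C F (P A) (P A') f g h" by blast
    have "ob1 (P A) = A" "ob1 (P A') = A'" using * P unfolding suspension_choice_def by simp_all
    then have "arrow C A A' f" "arrow C (Sg A) (Sg A') h" "Fmor F f \<bullet> ga A = ga A' \<bullet> h"
      using * unfolding sext_morphism_def by (auto simp: Mor_iff)
    then show "sus f h" using * susI by blast
  next
    assume "sus f h"
    then obtain A A' where *: "A \<in> \<A>" "A' \<in> \<A>" "arrow C A A' f" "arrow C (Sg A) (Sg A') h"
      "Fmor F f \<bullet> ga A = ga A' \<bullet> h"
      unfolding suspension_rel_def by blast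
    have o: "ob1 (P A) = A" "ob1 (P A') = A'" using * P unfolding suspension_choice_def by simp_all
    obtain g where "arrow C (XX A) (XX A') g" "g \<bullet> al A = al A' \<bullet> f" "h \<bullet> be A = be A' \<bullet> g"
      using N_fill_middle[OF P_tri[OF *(1)] P_tri[OF *(2)] *(3-5)] .
    then have "sext_morphism C F (P A) (P A') f g h"
      unfolding sext_morphism_def o using * arrow_mem by blast
    then show "\<exists>g A A'. A \<in> \<A> \<and> A' \<in> \<A> \<and> sext_morphism C F (P A) (P A') f g h" using * by blast
  qed
  then have "{cls h |f g h A A'. f \<in> G \<and> A \<in> \<A> \<and> A' \<in> \<A> \<and> sext_morphism C F (P A) (P A') f g h} =
      {cls h |f h. f \<in> G \<and> sus f h}" for G
    by blast
  then show ?thesis unfolding suspension_def ext_suspension_def by simp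
qed

text \<open>As for the suspension, with the outer components of a morphism of loop triangles
  exchanged by \<open>rev_sext\<close>.\<close>

lemma loop_eq: "loop C F \<A> \<X> L = Loop"
proof -
  have "(\<exists>g A A'. A \<in> \<A> \<and> A' \<in> \<A> \<and> sext_morphism C F (L A) (L A') h g f) \<longleftrightarrow> losus f h" for f h
  proof
    assume "\<exists>g A A'. A \<in> \<A> \<and> A' \<in> \<A> \<and> sext_morphism C F (L A) (L A') h g f"
    then obtain g A A' where *: "A \<in> \<A>" "A' \<in> \<A>" "sext_morphism C F (L A) (L A') h g f" by blast
    have o: "ob3 (L A) = A" "ob3 (L A') = A'" using * L unfolding loop_choice_def by simp_all
    have "arrow C (ob1 (L A)) (ob1 (L A')) h"
      using * Om_A[OF *(1)] Om_A[OF *(2)] unfolding sext_morphism_def by (intro arrowI) simp_all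
    moreover have "arrow C A A' f" using * o unfolding sext_morphism_def by (intro arrowI) simp_all
    moreover have "ar3 (L A') \<bullet> f = Fmor F h \<bullet> ar3 (L A)" using * unfolding sext_morphism_def by simp
    ultimately show "losus f h"
      unfolding suspension_rel_def op_cat_typing rev_sext_sel using * by blast
  next
    assume "losus f h"
    then obtain A A' where *: "A \<in> \<A>" "A' \<in> \<A>" "arrow C A A' f" "arrow C (ob1 (L A)) (ob1 (L A')) h"
      "Fmor F h \<bullet> ar3 (L A) = ar3 (L A') \<bullet> f"
      unfolding suspension_rel_def op_cat_typing rev_sext_sel by metis
    have o: "ob3 (L A) = A" "ob3 (L A') = A'" using * L unfolding loop_choice_def by simp_all
    obtain g where "arrow C (ob2 (L A)) (ob2 (L A')) g" "g \<bullet> ar1 (L A) = ar1 (L A') \<bullet> h"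
      "f \<bullet> ar2 (L A) = ar2 (L A') \<bullet> g"
      using N_fill_middle[OF L_tri[OF *(1)] L_tri[OF *(2)] *(4,3,5)] .
    then have "sext_morphism C F (L A) (L A') h g f"
      unfolding sext_morphism_def o using * arrow_mem by blast
    then show "\<exists>g A A'. A \<in> \<A> \<and> A' \<in> \<A> \<and> sext_morphism C F (L A) (L A') h g f" using * by blast
  qed
  then have "{cls h |f g h A A'. f \<in> G \<and> A \<in> \<A> \<and> A' \<in> \<A> \<and> sext_morphism C F (L A) (L A') h g f} =
      {cls h |f h. f \<in> G \<and> losus f h}" for G
    by blast
  then show ?thesis unfolding loop_def ext_suspension_def by (simp add: mor_class_op)
qed

lemma right_triangles_eq: "right_triangles C F N \<A> \<X> P = RT"
proof (intro Set.set_eqI iffI)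
  fix t assume "t \<in> right_triangles C F N \<A> \<X> P"
  then obtain A B f E g h where *: "A \<in> \<A>" "B \<in> \<A>" "f \<in> Mor C A B"
    "Sext B E (Sg A) g h (Fmor F f \<bullet> ga A) \<in> N"
    "sext_isomorphic D Susp (clsext A B E f g h) t"
    unfolding right_triangles_def suspension_eq by blast
  \<comment> \<open>That the third vertex lies in \<open>\<A>\<close> is implicit here: the sextuple
    is one of the quotient, whose objects are those of \<open>\<A>\<close>.\<close>
  have "is_sextuple D Susp (clsext A B E f g h)" using *(5) unfolding sext_isomorphic_def by blast
  then have "E \<in> \<A>" unfolding is_sextuple_def by simp
  then have "clsext A B E f g h \<in> std" using * by (intro stdI arrowI) simp_all
  then show "t \<in> RT" using *(5) unfolding iso_closure_def by blast
next
  fix t assume "t \<in> RT"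
  then obtain A B E f g h where "A \<in> \<A>" "B \<in> \<A>" "arrow C A B f"
    "Sext B E (Sg A) g h (Fmor F f \<bullet> ga A) \<in> N" "sext_isomorphic D Susp (clsext A B E f g h) t"
    unfolding iso_closure_def standard_triangles_def by blast
  then show "t \<in> right_triangles C F N \<A> \<X> P"
    unfolding right_triangles_def suspension_eq using arrow_mem by blast
qed

lemma op_sext_op_sext: "op_sext (op_sext s) = s"
  by (cases s) simp

lemma left_triangles_eq: "left_triangles C F N \<A> \<X> L = op_sext ` LT"
proof (intro Set.set_eqI iffI)
  fix t assume "t \<in> left_triangles C F N \<A> \<X> L"
  then obtain A B f E g h where *: "B \<in> \<A>" "A \<in> \<A>" "f \<in> Mor C B A"
    "Sext (ob1 (L A)) E B h g (ar3 (L A) \<bullet> f) \<in> N"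
    "sext_isomorphic (op_cat D) Loop (op_sext (Sext E B A (cls h) (cls g) (cls f))) (op_sext t)"
    unfolding left_triangles_def loop_eq by blast
  have "is_sextuple (op_cat D) Loop (op_sext (Sext E B A (cls h) (cls g) (cls f)))"
    using *(5) unfolding sext_isomorphic_def by blast
  then have "E \<in> \<A>" unfolding is_sextuple_def by simp
  moreover have "arrow C B A f" using * by (intro arrowI) simp_all
  ultimately have "Sext A B E (cls f) (cls g) (cls h) \<in> lstd"
    unfolding standard_triangles_def mor_class_op op_cat_typing rev_sext_sel using * by blast
  then have "op_sext t \<in> LT" using *(5) unfolding iso_closure_def by auto
  then show "t \<in> op_sext ` LT" using op_sext_op_sext[of t] by (intro image_eqI[of _ _ "op_sext t"]) simp_all
next
  fix t assume "t \<in> op_sext ` LT"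
  then obtain s where s: "s \<in> LT" "t = op_sext s" by blast
  then obtain A B E f g h where "A \<in> \<A>" "B \<in> \<A>" "arrow C B A f"
    "Sext (ob1 (L A)) E B h g (ar3 (L A) \<bullet> f) \<in> N"
    "sext_isomorphic (op_cat D) Loop (op_sext (Sext E B A (cls h) (cls g) (cls f))) (op_sext t)"
    unfolding iso_closure_def standard_triangles_def mor_class_op op_cat_typing rev_sext_sel
    by (auto simp: op_sext_op_sext simp del: arrow_iff)
  then show "t \<in> left_triangles C F N \<A> \<X> L"
    unfolding left_triangles_def loop_eq using arrow_mem by blast
qed

lemma pretriangulation_ex:
  "\<exists>\<eta> \<epsilon>. pretriangulation K (subfactor C \<A> \<X>) (loop C F \<A> \<X> L) (suspension C F \<A> \<X> P)
     (left_triangles C F N \<A> \<X> L) (right_triangles C F N \<A> \<X> P) \<eta> \<epsilon>"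
proof -
  have "\<exists>\<psi>. arrow C A (Om (Sg A)) \<psi> \<and> Npush (\<boxminus> \<psi>) (ga A) = ka (Sg A)" if A: "A \<in> \<A>" for A
  proof -
    have "arrow C (Sg A) (Sg A) (ident C (Sg A))" using A by simp
    then obtain \<psi> where p: "arrow C A (Om (Sg A)) \<psi>" "Npush \<psi> (ga A) = Npull (ident C (Sg A)) (ka (Sg A))"
      using transpose_ex A Sg_A by blast
    have "Npull (ident C (Sg A)) (ka (Sg A)) = ka (Sg A)"
      using pull_ident[OF ka_mem] A Om_A[OF Sg_A[OF A]] by simp
    then show ?thesis using p by (intro exI[of _ "\<boxminus> \<psi>"]) simp
  qed
  then obtain \<eta> where eta: "\<And>A. A \<in> \<A> \<Longrightarrow> arrow C A (Om (Sg A)) (\<eta> A) \<and> Npush (\<boxminus> \<eta> A) (ga A) = ka (Sg A)"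
    by metis
  have "\<exists>\<phi>. arrow C (Sg (Om A)) A \<phi> \<and> Npull (\<boxminus> \<phi>) (ka A) = ga (Om A)" if A: "A \<in> \<A>" for A
  proof -
    have "arrow C (Om A) (Om A) (ident C (Om A))" using Om_A[OF A] by simp
    then obtain \<phi> where p: "arrow C (Sg (Om A)) A \<phi>" "Npush (ident C (Om A)) (ga (Om A)) = Npull \<phi> (ka A)"
      using transpose_ex' A Om_A by blast
    have "Npush (ident C (Om A)) (ga (Om A)) = ga (Om A)"
      using push_ident[OF ga_mem] Om_A[OF A] Sg_A by simp
    then show ?thesis using p by (intro exI[of _ "\<boxminus> \<phi>"]) simp
  qed
  then obtain \<epsilon> where eps: "\<And>A. A \<in> \<A> \<Longrightarrow> arrow C (Sg (Om A)) A (\<epsilon> A) \<and> Npull (\<boxminus> \<epsilon> A) (ka A) = ga (Om A)"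
    by metis
  interpret adjoint_pair K C NEx Npush Npull Ntri \<A> \<X> P "\<lambda>A. rev_sext (L A)" \<eta> \<epsilon>
    using eta eps by unfold_locales blast+
  show ?thesis
    unfolding loop_eq suspension_eq left_triangles_eq right_triangles_eq
    using pretriangulation_subfactor by blast
qed

end

text \<open>A full subcategory has the same morphism sets, so approximations formed in it serve in
  the ambient category.\<close>

lemma (in triangulated_category) suspension_choice_ex:
  assumes "\<A> \<subseteq> Ob C" "\<X> \<subseteq> \<A>" "functorially_finite (full_subcat C \<A>) \<X>"
  shows "\<exists>P. suspension_choice C N \<A> \<X> P"
proof -
  have "\<exists>s. s \<in> N \<and> ob1 s = A \<and> left_approximation C \<X> A (ob2 s) (ar1 s)" if A: "A \<in> \<A>" for A
  proof -
    obtain Y f where f: "left_approximation C \<X> A Y f"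
      using assms(3) A unfolding functorially_finite_def left_approximation_def by auto
    then have "arrow C A Y f" using A assms unfolding left_approximation_def by (intro arrowI) auto
    then obtain E g h where "Sext A Y E f g h \<in> N" using embed[of A Y f] arrow_mem by auto
    then show ?thesis using f by (intro exI[of _ "Sext A Y E f g h"]) simp
  qed
  then show ?thesis unfolding suspension_choice_def by metis
qed

lemma (in triangulated_category) loop_choice_ex:
  assumes "\<A> \<subseteq> Ob C" "\<X> \<subseteq> \<A>" "functorially_finite (full_subcat C \<A>) \<X>"
  shows "\<exists>L. loop_choice C N \<A> \<X> L"
proof -
  have "\<exists>s. s \<in> N \<and> ob3 s = A \<and> right_approximation C \<X> A (ob2 s) (ar2 s)" if A: "A \<in> \<A>" for A
  proof -
    obtain Y f where f: "right_approximation C \<X> A Y f"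
      using assms(3) A unfolding functorially_finite_def right_approximation_def by auto
    then have "arrow C Y A f" using A assms unfolding right_approximation_def by (intro arrowI) auto
    then obtain E g h where "Sext E Y A g f h \<in> N" using N_embed_second by blast
    then show ?thesis using f by (intro exI[of _ "Sext E Y A g f h"]) simp
  qed
  then show ?thesis unfolding loop_choice_def by metis
qed

theorem corollary2p10:
  fixes K :: "'k ring"
    and T :: "('o, 'm, 'k) lincat"
    and S :: "('o, 'm) endofunctor"
    and \<T> :: "('o, 'm) sextuple set"
    and \<A> \<X> :: "'o set"
  assumes "triangulated_category K T S \<T>"
    and "hom_finite K T"
    and "krull_schmidt T"
    and "subcategory T \<A>"
    and "subcategory (full_subcat T \<A>) \<X>"
    and "functorially_finite (full_subcat T \<A>) \<X>"
    and "monics_have_cones T \<T> \<A> \<X>"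
    and "epics_have_cocones T \<T> \<A> \<X>"
  shows "(\<exists>P. suspension_choice T \<T> \<A> \<X> P) \<and> (\<exists>L. loop_choice T \<T> \<A> \<X> L) \<and>
    (\<forall>P L. suspension_choice T \<T> \<A> \<X> P \<and> loop_choice T \<T> \<A> \<X> L \<longrightarrow>
      (\<exists>\<eta> \<epsilon>. pretriangulation K (subfactor T \<A> \<X>)
        (loop T S \<A> \<X> L) (suspension T S \<A> \<X> P)
        (left_triangles T S \<T> \<A> \<X> L) (right_triangles T S \<T> \<A> \<X> P) \<eta> \<epsilon>))"
proof -
  interpret triangulated_category K T S \<T> by (rule assms(1))
  have "\<A> \<subseteq> Ob T" "\<X> \<subseteq> \<A>" using assms(4,5) unfolding subcategory_def by simp_all
  then have "\<exists>P. suspension_choice T \<T> \<A> \<X> P" "\<exists>L. loop_choice T \<T> \<A> \<X> L"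
    using suspension_choice_ex loop_choice_ex assms(6) by blast+
  moreover have "\<exists>\<eta> \<epsilon>. pretriangulation K (subfactor T \<A> \<X>)
        (loop T S \<A> \<X> L) (suspension T S \<A> \<X> P)
        (left_triangles T S \<T> \<A> \<X> L) (right_triangles T S \<T> \<A> \<X> P) \<eta> \<epsilon>"
    if "suspension_choice T \<T> \<A> \<X> P" "loop_choice T \<T> \<A> \<X> L" for P L
    by (rule triangulated_subfactor.pretriangulation_ex, unfold_locales) (use assms that in simp_all)
  ultimately show ?thesis by blast
qed

end
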